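(* Let $\mathfrak g=\bigoplus_{i\in\mathbf Z_m}\mathfrak g_i$ be a $\mathbf Z_m$-graded semisimple Lie algebra as in the context. Every two packets in $\mathfrak g_1$ are either equal or disjoint.
   Context: Let $k$ be an algebraically closed field of characteristic zero, $m$ a positive integer or $\infty$, and $\mathbf Z_m$ the additive cyclic group of order $m$ (with $\mathbf Z_\infty=\mathbf Z$). Let $G$ be a simply connected semisimple algebraic group over $k$ whose Lie algebra is graded (as a Lie algebra): $\mathfrak g=\mathrm{Lie}\,G=\bigoplus_{i\in\mathbf Z_m}\mathfrak g_i$. Let $G_0$ be the closed connected subgroup of $G$ with $\mathrm{Lie}\,G_0=\mathfrak g_0$; it acts on each $\mathfrak g_i$ by the adjoint action, written $g\cdot x$. A Cartan subspace of $\mathfrak g_1$ is a maximal linear subspace of $\mathfrak g_1$ consisting of pairwise commuting semisimple elements. For a subset $\mathfrak s\subseteq\mathfrak g$: $\mathfrak s_i:=\mathfrak s\cap\mathfrak g_i$ and $\mathfrak g^{\mathfrak s}$ is the centralizer of $\mathfrak s$ in $\mathfrak g$; $\mathfrak g^{\mathfrak s}_i:=\mathfrak g^{\mathfrak s}\cap\mathfrak g_i$. Fix a maximal torus $\mathfrak t$ of $\mathfrak g$ (Lie algebra of a maximal torus of $G$) such that $\mathfrak t_1$ is a Cartan subspace of $\mathfrak g_1$, and let $R\subset\mathfrak t^*$ be the root system of $\mathfrak g$ with respect to $\mathfrak t$. Define an equivalence relation on $\mathfrak t$: $x\sim_R y$ iff for every $\alpha\in R$ either $\alpha(x)=\alpha(y)=0$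 or $\alpha(x)\alpha(y)\neq0$. Its equivalence classes are called cells; $\mathscr C_R(\mathfrak t)$ is the set of cells. A packet in $\mathfrak g_1$ is a set of the form $G_0\cdot(\mathfrak c_1+n)$, where $\mathfrak c\in\mathscr C_R(\mathfrak t)$ is a cell with $\mathfrak c_1\neq\varnothing$ and $n\in\mathfrak g^{\mathfrak c}_1$ is a nilpotent element. *)

theory Defs
  imports
    "Jordan_Normal_Form.VS_Connect"
    "HOL-Algebra.Solvable_Groups"
    "HOL-Algebra.Elementary_Groups"
begin

text \<open>
  Linear algebraic groups over an algebraically closed field of characteristic zero are taken as
  Zariski closed subgroups of a general linear group; every affine algebraic group is isomorphic to
  one of these. Matrices carry their size at the level of terms, so that one can quantify over all
  algebraic groups (this is needed for simple connectedness).
\<close>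

abbreviation GL :: "nat \<Rightarrow> 'k::field mat monoid" where
  "GL n \<equiv> units_of (ring_mat TYPE('k) n ())"

abbreviation gl :: "nat \<Rightarrow> ('k::field, 'k mat) module" where
  "gl n \<equiv> module_mat TYPE('k) n n"

abbreviation subgp :: "nat \<Rightarrow> 'k::field mat set \<Rightarrow> 'k mat monoid" where
  "subgp n G \<equiv> (GL n)\<lparr>carrier := G\<rparr>"


section \<open>Linear algebraic groups\<close>

inductive_set poly_fun :: "nat \<Rightarrow> ('k::field mat \<Rightarrow> 'k) set" for n :: nat where
  const: "(\<lambda>_. c) \<in> poly_fun n"
| entry: "i < n \<Longrightarrow> j < n \<Longrightarrow> (\<lambda>A. A $$ (i, j)) \<in> poly_fun n"
| add: "f \<in> poly_fun n \<Longrightarrow> h \<in> poly_fun n \<Longrightarrow> (\<lambda>A. f A + h A) \<in> poly_fun n"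
| mult: "f \<in> poly_fun n \<Longrightarrow> h \<in> poly_fun n \<Longrightarrow> (\<lambda>A. f A * h A) \<in> poly_fun n"

definition zariski_closed :: "nat \<Rightarrow> 'k::field mat set \<Rightarrow> bool" where
  "zariski_closed n Z \<longleftrightarrow>
     (\<exists>P \<subseteq> poly_fun n. Z = {a \<in> carrier (GL n). \<forall>f \<in> P. f a = 0})"

definition zariski_connected :: "nat \<Rightarrow> 'k::field mat set \<Rightarrow> bool" where
  "zariski_connected n Z \<longleftrightarrow>
     \<not> (\<exists>A B. zariski_closed n A \<and> zariski_closed n B \<and> A \<noteq> {} \<and> B \<noteq> {} \<and>
              A \<inter> B = {} \<and> A \<union> B = Z)"

definition alg_group :: "nat \<Rightarrow> 'k::field mat set \<Rightarrow> bool" where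
  "alg_group n G \<longleftrightarrow> subgroup G (GL n) \<and> zariski_closed n G"

definition connected_alg_group :: "nat \<Rightarrow> 'k::field mat set \<Rightarrow> bool" where
  "connected_alg_group n G \<longleftrightarrow> alg_group n G \<and> zariski_connected n G"

text \<open>The coordinate ring of the general linear group is generated by the matrix entries and the
  inverse of the determinant.\<close>

definition regular_on :: "nat \<Rightarrow> 'k::field mat set \<Rightarrow> ('k mat \<Rightarrow> 'k) \<Rightarrow> bool" where
  "regular_on n G f \<longleftrightarrow> (\<exists>q \<in> poly_fun n. \<exists>r::nat. \<forall>a \<in> G. f a = q a / det a ^ r)"

definition alg_hom ::
  "nat \<Rightarrow> 'k::field mat set \<Rightarrow> nat \<Rightarrow> 'k mat set \<Rightarrow> ('k mat \<Rightarrow> 'k mat) \<Rightarrow> bool" where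
  "alg_hom p H n G \<phi> \<longleftrightarrow>
     \<phi> \<in> hom (subgp p H) (subgp n G) \<and>
     (\<forall>i<n. \<forall>j<n. regular_on p H (\<lambda>a. \<phi> a $$ (i, j)))"

definition alg_iso ::
  "nat \<Rightarrow> 'k::field mat set \<Rightarrow> nat \<Rightarrow> 'k mat set \<Rightarrow> ('k mat \<Rightarrow> 'k mat) \<Rightarrow> bool" where
  "alg_iso p H n G \<phi> \<longleftrightarrow>
     alg_hom p H n G \<phi> \<and> bij_betw \<phi> H G \<and> alg_hom n G p H (inv_into H \<phi>)"

definition isogeny ::
  "nat \<Rightarrow> 'k::field mat set \<Rightarrow> nat \<Rightarrow> 'k mat set \<Rightarrow> ('k mat \<Rightarrow> 'k mat) \<Rightarrow> bool" where
  "isogeny p H n G \<phi> \<longleftrightarrow>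
     alg_hom p H n G \<phi> \<and> \<phi> ` H = G \<and> finite (kernel (subgp p H) (subgp n G) \<phi>)"

text \<open>Semisimple means connected with trivial radical.\<close>

definition semisimple_group :: "nat \<Rightarrow> 'k::field mat set \<Rightarrow> bool" where
  "semisimple_group n G \<longleftrightarrow>
     connected_alg_group n G \<and>
     (\<forall>N. connected_alg_group n N \<and> N \<lhd> subgp n G \<and> solvable (subgp n N) \<longrightarrow> N = {1\<^sub>m n})"

text \<open>In characteristic zero all isogenies are separable and central, so no restriction on the
  isogenies is necessary.\<close>

definition simply_connected_group :: "nat \<Rightarrow> 'k::field mat set \<Rightarrow> bool" where
  "simply_connected_group n G \<longleftrightarrow>
     (\<forall>p H \<phi>. connected_alg_group p H \<and> isogeny p H n G \<phi> \<longrightarrow> alg_iso p H n G \<phi>)"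

definition diag_group :: "nat \<Rightarrow> 'k::field mat set" where
  "diag_group r = {a \<in> carrier (GL r). diagonal_mat a}"

definition torus :: "nat \<Rightarrow> 'k::field mat set \<Rightarrow> bool" where
  "torus n T \<longleftrightarrow> alg_group n T \<and> (\<exists>r \<phi>. alg_iso n T r (diag_group r) \<phi>)"

definition maximal_torus :: "nat \<Rightarrow> 'k::field mat set \<Rightarrow> 'k mat set \<Rightarrow> bool" where
  "maximal_torus n G T \<longleftrightarrow>
     torus n T \<and> T \<subseteq> G \<and> (\<forall>S. torus n S \<and> S \<subseteq> G \<and> T \<subseteq> S \<longrightarrow> S = T)"


section \<open>Lie algebras of linear algebraic groups\<close>

text \<open>The tangent space at the identity: \<open>X\<close> is tangent iff every polynomial \<open>f\<close> vanishing on
  the group has zero derivative at the identity in direction \<open>X\<close>. This derivative is the linear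
  coefficient of the univariate polynomial \<open>f (1 + s X)\<close> in \<open>s\<close>.\<close>

definition Lie :: "nat \<Rightarrow> 'k::field mat set \<Rightarrow> 'k mat set" where
  "Lie n G = {X \<in> carrier_mat n n. \<forall>f \<in> poly_fun n. (\<forall>a \<in> G. f a = 0) \<longrightarrow>
     (\<exists>q. (\<forall>s. f (1\<^sub>m n + s \<cdot>\<^sub>m X) = poly q s) \<and> coeff q 1 = 0)}"

definition bracket :: "'k::field mat \<Rightarrow> 'k mat \<Rightarrow> 'k mat" where
  "bracket x y = x * y - y * x"

definition Ad :: "nat \<Rightarrow> 'k::field mat \<Rightarrow> 'k mat \<Rightarrow> 'k mat" where
  "Ad n a x = a * x * inv\<^bsub>GL n\<^esub> a"

definition centralizer_in :: "nat \<Rightarrow> 'k::field mat set \<Rightarrow> 'k mat set \<Rightarrow> 'k mat set" where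
  "centralizer_in n L S = {x \<in> L. \<forall>s \<in> S. bracket x s = 0\<^sub>m n n}"

text \<open>Over an algebraically closed field, an element of the Lie algebra of a linear algebraic group
  is semisimple (nilpotent) iff it is diagonalizable (nilpotent) as a matrix.\<close>

definition semisimple_elem :: "'k::field mat \<Rightarrow> bool" where
  "semisimple_elem x \<longleftrightarrow> (\<exists>D. diagonal_mat D \<and> similar_mat x D)"

definition nilpotent_elem :: "nat \<Rightarrow> 'k::field mat \<Rightarrow> bool" where
  "nilpotent_elem n x \<longleftrightarrow> (\<exists>k. x ^\<^sub>m k = 0\<^sub>m n n)"

text \<open>Gradings by the cyclic group of order \<open>m\<close>, where \<open>m = 0\<close> encodes the infinite cyclic group
  (as in the library's \<open>integer_mod_group\<close>). The components \<open>gr i\<close> matter only for \<open>i\<close> in the carrier of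
  that group, that is \<open>0 \<le> i < m\<close> if \<open>m > 0\<close>.\<close>

definition lie_grading :: "nat \<Rightarrow> nat \<Rightarrow> 'k::field mat set \<Rightarrow> (int \<Rightarrow> 'k mat set) \<Rightarrow> bool" where
  "lie_grading n m L gr \<longleftrightarrow>
     (let Z = integer_mod_group m in
       (\<forall>i \<in> carrier Z. subspace class_ring (gr i) (gl n) \<and> gr i \<subseteq> L) \<and>
       (\<forall>x \<in> L. \<exists>!c. c \<in> (\<Pi>\<^sub>E i \<in> carrier Z. gr i) \<and>
          finite {i \<in> carrier Z. c i \<noteq> 0\<^sub>m n n} \<and>
          x = finsum (gl n) c {i \<in> carrier Z. c i \<noteq> 0\<^sub>m n n}) \<and>
       (\<forall>i \<in> carrier Z. \<forall>j \<in> carrier Z. \<forall>x \<in> gr i. \<forall>y \<in> gr j.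
          bracket x y \<in> gr (i \<otimes>\<^bsub>Z\<^esub> j)))"

text \<open>The component of degree one. The class of \<open>1\<close> is \<open>0\<close> if \<open>m = 1\<close>.\<close>

definition degree_one :: "nat \<Rightarrow> (int \<Rightarrow> 'k::field mat set) \<Rightarrow> 'k mat set" where
  "degree_one m gr = gr (1 mod int m)"

definition commuting_semisimple_subspace :: "nat \<Rightarrow> 'k::field mat set \<Rightarrow> bool" where
  "commuting_semisimple_subspace n V \<longleftrightarrow>
     subspace class_ring V (gl n) \<and> (\<forall>x \<in> V. semisimple_elem x) \<and>
     (\<forall>x \<in> V. \<forall>y \<in> V. bracket x y = 0\<^sub>m n n)"

definition Cartan_subspace :: "nat \<Rightarrow> 'k::field mat set \<Rightarrow> 'k mat set \<Rightarrow> bool" where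
  "Cartan_subspace n V C \<longleftrightarrow>
     C \<subseteq> V \<and> commuting_semisimple_subspace n C \<and>
     (\<forall>D. D \<subseteq> V \<and> commuting_semisimple_subspace n D \<and> C \<subseteq> D \<longrightarrow> D = C)"


section \<open>Roots, cells and packets\<close>

definition dual_space :: "'k::field mat set \<Rightarrow> ('k mat \<Rightarrow> 'k) set" where
  "dual_space t = {\<alpha> \<in> extensional t.
     (\<forall>x \<in> t. \<forall>y \<in> t. \<alpha> (x + y) = \<alpha> x + \<alpha> y) \<and> (\<forall>c. \<forall>x \<in> t. \<alpha> (c \<cdot>\<^sub>m x) = c * \<alpha> x)}"

definition roots :: "nat \<Rightarrow> 'k::field mat set \<Rightarrow> 'k mat set \<Rightarrow> ('k mat \<Rightarrow> 'k) set" where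
  "roots n L t = {\<alpha> \<in> dual_space t. (\<exists>h \<in> t. \<alpha> h \<noteq> 0) \<and>
     (\<exists>x \<in> L. x \<noteq> 0\<^sub>m n n \<and> (\<forall>h \<in> t. bracket h x = \<alpha> h \<cdot>\<^sub>m x))}"

definition cell_rel :: "('k::field mat \<Rightarrow> 'k) set \<Rightarrow> 'k mat set \<Rightarrow> 'k mat rel" where
  "cell_rel R t = {(x, y). x \<in> t \<and> y \<in> t \<and>
     (\<forall>\<alpha> \<in> R. (\<alpha> x = 0 \<and> \<alpha> y = 0) \<or> \<alpha> x * \<alpha> y \<noteq> 0)}"

definition cells :: "('k::field mat \<Rightarrow> 'k) set \<Rightarrow> 'k mat set \<Rightarrow> 'k mat set set" where
  "cells R t = t // cell_rel R t"

definition packets ::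
  "nat \<Rightarrow> 'k::field mat set \<Rightarrow> 'k mat set \<Rightarrow> 'k mat set \<Rightarrow> 'k mat set \<Rightarrow> 'k mat set set" where
  "packets n L L1 G0 t =
     {{Ad n a (y + e) | a y. a \<in> G0 \<and> y \<in> c \<inter> L1} | c e.
        c \<in> cells (roots n L t) t \<and> c \<inter> L1 \<noteq> {} \<and>
        e \<in> centralizer_in n L c \<inter> L1 \<and> nilpotent_elem n e}"

end

theory Submission
  imports Defs "HOL-Library.Function_Algebras"
begin

text \<open>
  If two packets meet, then some \<open>g\<close> in \<open>G0\<close> carries an element \<open>y + e\<close> of one to an element \<open>y' + e'\<close> of
  the other, and by uniqueness of the Jordan decomposition it carries \<open>y\<close> to \<open>y'\<close> and \<open>e\<close> to \<open>e'\<close>.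
  All elements of a cell have the same centralizer: a difference would contain a common eigenvector of
  the torus, hence a root separating them. So for \<open>x\<close> in the cell of \<open>y\<close> and of degree one, \<open>g x\<close> has the
  centralizer of \<open>y'\<close>, which contains the Cartan subspace; by maximality \<open>g x\<close> lies in the
  Cartan subspace, and in the cell of \<open>y'\<close>.

  This uses that \<open>G0\<close> preserves the degree one component \<open>V\<close>, which is known only infinitesimally. The functions
  on \<open>G0\<close> expressing \<open>g V \<subseteq> V\<close> vanish at 1 and span a space stable under the left invariant
  derivations. An Euler field acts on functions vanishing to order \<open>k\<close> at 1 as multiplication by \<open>k\<close>
  modulo order \<open>k + 1\<close>, so in characteristic zero these functions vanish to infinite order. By Krull's theorem
  they vanish near 1; the stabilizer of \<open>V\<close> is therefore open and closed in \<open>G0\<close>.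
\<close>

section \<open>Noetherian rings\<close>

text \<open>Vanishing to infinite order at 1 does not by itself give vanishing: the coordinate ring
  of \<open>G0\<close> is not known to be a domain, only connectedness is available. What survives
  is Krull's theorem in the form \<open>f = a f\<close> on \<open>G0\<close> with
  \<open>a(1) = 0\<close>: \<open>f\<close> is zero wherever \<open>a\<close> differs from 1, an
  open set containing 1. The noetherian ring behind it is the Rees ring of the ideal of 1, a
  finitely generated algebra; this is why Hilbert's basis theorem is developed for subrings of rings
  of functions. Inversion is not polynomial, so the functions expressing
  \<open>g V \<subseteq> V\<close> are built from \<open>A v adj(A) = det(A) Ad(A) v\<close>. The
  factor \<open>det(A)\<close> adds to each derivative a multiple of the function itself, which the
  induction on the order of vanishing tolerates. The Euler field combines left invariant
  derivations, which are tangent to the group, with coordinates dual to a basis of its Lie algebra.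
  It is radial only up to second order, and only along the group.\<close>

definition is_subring :: "'a::comm_ring_1 set \<Rightarrow> bool" where
  "is_subring S \<longleftrightarrow> 1 \<in> S \<and> (\<forall>x\<in>S. \<forall>y\<in>S. x - y \<in> S) \<and> (\<forall>x\<in>S. \<forall>y\<in>S. x * y \<in> S)"

lemma is_subringD:
  assumes "is_subring S"
  shows "1 \<in> S" "0 \<in> S" "x \<in> S \<Longrightarrow> y \<in> S \<Longrightarrow> x - y \<in> S" "x \<in> S \<Longrightarrow> y \<in> S \<Longrightarrow> x * y \<in> S"
    "x \<in> S \<Longrightarrow> - x \<in> S" "x \<in> S \<Longrightarrow> y \<in> S \<Longrightarrow> x + y \<in> S"
proof -
  note a = assms[unfolded is_subring_def]
  show 1: "1 \<in> S" using a by blast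
  have d: "x - y \<in> S" if "x \<in> S" "y \<in> S" for x y using a that by blast
  show 0: "0 \<in> S" using d[OF 1 1] by simp
  show "x - y \<in> S" if "x \<in> S" "y \<in> S" for x y using d that by blast
  show "x * y \<in> S" if "x \<in> S" "y \<in> S" for x y using a that by blast
  have m: "- x \<in> S" if "x \<in> S" for x using d[OF 0 that] by simp
  show "x \<in> S \<Longrightarrow> - x \<in> S" using m by blast
  show "x + y \<in> S" if "x \<in> S" "y \<in> S" for x y using d[OF that(1) m[OF that(2)]] by simp
qed

lemma is_subring_sum: "is_subring S \<Longrightarrow> (\<And>i. i \<in> I \<Longrightarrow> f i \<in> S) \<Longrightarrow> sum f I \<in> S"
  by (induction I rule: infinite_finite_induct) (auto intro: is_subringD)

lemma is_subring_power: "is_subring S \<Longrightarrow> x \<in> S \<Longrightarrow> x ^ n \<in> S"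
  by (induction n) (auto intro: is_subringD)

text \<open>The \<open>S\<close>-span of \<open>F\<close>, where \<open>F\<close> may lie outside
  \<open>S\<close>. One term is added per step, so facts about it follow by induction on the length
  of a combination.\<close>

inductive_set gen_ideal :: "'a::comm_ring_1 set \<Rightarrow> 'a set \<Rightarrow> 'a set" for S F where
  zero: "0 \<in> gen_ideal S F"
| step: "x \<in> gen_ideal S F \<Longrightarrow> s \<in> S \<Longrightarrow> f \<in> F \<Longrightarrow> x + s * f \<in> gen_ideal S F"

lemma gen_ideal_add:
  assumes "y \<in> gen_ideal S F" "x \<in> gen_ideal S F"
  shows "x + y \<in> gen_ideal S F"
  using assms(1)
proof induction
  case (step y s f)
  then have "(x + y) + s * f \<in> gen_ideal S F" by (intro gen_ideal.step)
  then show ?case by (simp add: add.assoc)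
qed (use assms(2) in simp)

lemma gen_ideal_mult:
  assumes S: "is_subring S" and "y \<in> gen_ideal S F" "r \<in> S"
  shows "r * y \<in> gen_ideal S F"
  using assms(2)
proof induction
  case (step y s f)
  then have "r * y + (r * s) * f \<in> gen_ideal S F"
    using is_subringD(4)[OF S \<open>r \<in> S\<close>] by (intro gen_ideal.step)
  then show ?case by (simp add: algebra_simps)
qed (auto intro: gen_ideal.zero)

lemma gen_ideal_diff:
  assumes "is_subring S" "x \<in> gen_ideal S F" "y \<in> gen_ideal S F"
  shows "x - y \<in> gen_ideal S F"
  using gen_ideal_add[OF gen_ideal_mult[OF assms(1,3), of "-1"] assms(2)] is_subringD(1,5)[OF assms(1)]
  by simp

lemma gen_ideal_base: "is_subring S \<Longrightarrow> f \<in> F \<Longrightarrow> f \<in> gen_ideal S F"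
  using gen_ideal.step[OF gen_ideal.zero, of 1 S f F] is_subringD(1)[of S] by simp

lemma gen_ideal_least:
  assumes S: "is_subring S" and F: "F \<subseteq> gen_ideal S F'" and x: "x \<in> gen_ideal S F"
  shows "x \<in> gen_ideal S F'"
  using x
proof induction
  case (step x s f)
  then show ?case using F by (intro gen_ideal_add gen_ideal_mult[OF S]) auto
qed (rule gen_ideal.zero)

lemma gen_ideal_mono: "is_subring S \<Longrightarrow> F \<subseteq> F' \<Longrightarrow> gen_ideal S F \<subseteq> gen_ideal S F'"
  by (meson gen_ideal_base gen_ideal_least subset_iff)

lemma gen_ideal_subset: "is_subring S \<Longrightarrow> F \<subseteq> S \<Longrightarrow> gen_ideal S F \<subseteq> S"
proof
  fix x assume "is_subring S" "F \<subseteq> S" "x \<in> gen_ideal S F"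
  from this(3) show "x \<in> S"
    by induction (use \<open>F \<subseteq> S\<close> is_subringD[OF \<open>is_subring S\<close>] in auto)
qed

lemma gen_ideal_sequence:
  assumes S: "is_subring S" and x: "x \<in> gen_ideal S (range g)"
  shows "\<exists>N::nat. x \<in> gen_ideal S (g ` {..<N})"
  using x
proof induction
  case zero
  show ?case using gen_ideal.zero by blast
next
  case (step x s f)
  then obtain N M where N: "x \<in> gen_ideal S (g ` {..<N})" and M: "f = g M" by blast
  have "x \<in> gen_ideal S (g ` {..<N + Suc M})"
    using N by (rule gen_ideal_mono[OF S, THEN subsetD, rotated]) auto
  moreover have "f \<in> g ` {..<N + Suc M}" using M by auto
  ultimately show ?case using gen_ideal.step step.hyps by blast
qed

text \<open>Equivalent to the ascending chain condition. The sequential form is the one applied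
  below, to leading coefficients in Hilbert's theorem and to representatives of a function in
  Krull's.\<close>

definition noetherian :: "'a::comm_ring_1 set \<Rightarrow> bool" where
  "noetherian S \<longleftrightarrow> (\<forall>f::nat \<Rightarrow> 'a. range f \<subseteq> S \<longrightarrow> (\<exists>n. f n \<in> gen_ideal S (f ` {..<n})))"

definition polys_over :: "'a::comm_ring_1 set \<Rightarrow> 'a poly set" where
  "polys_over S = {p. \<forall>i. poly.coeff p i \<in> S}"

lemma is_subring_polys_over: "is_subring S \<Longrightarrow> is_subring (polys_over S)"
  unfolding is_subring_def[of "polys_over S"]
  by (auto simp: polys_over_def coeff_mult intro!: is_subringD is_subring_sum)

lemma noetherian_sequence_gen:
  assumes S: "is_subring S" and J: "finite F" "F \<subseteq> gen_ideal S (range g)"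
  shows "\<exists>N::nat. F \<subseteq> gen_ideal S (g ` {..<N})"
  using J
proof (induction F)
  case (insert x F)
  then obtain N where N: "F \<subseteq> gen_ideal S (g ` {..<N})" by auto
  obtain M where M: "x \<in> gen_ideal S (g ` {..<M})" using gen_ideal_sequence[OF S] insert by blast
  have "gen_ideal S (g ` {..<N}) \<subseteq> gen_ideal S (g ` {..<N+M})"
    "gen_ideal S (g ` {..<M}) \<subseteq> gen_ideal S (g ` {..<N+M})"
    by (intro gen_ideal_mono[OF S]; auto)+
  then show ?case using N M by blast
qed simp

text \<open>A sequence without relations generates an ideal \<open>J\<close> that is not finitely
  generated. Picking repeatedly an element of least degree in \<open>J\<close> outside the ideal of
  the earlier picks gives polynomials whose leading coefficients satisfy a relation over
  \<open>S\<close>; lifting it cancels a leading term, against minimality.\<close>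

theorem hilbert_basis:
  assumes S: "is_subring S" and noeth: "noetherian S"
  shows "noetherian (polys_over S)"
  unfolding noetherian_def
proof (intro allI impI, rule ccontr)
  let ?X = "polys_over S"
  note X = is_subring_polys_over[OF S]
  fix g :: "nat \<Rightarrow> 'a poly"
  assume g: "range g \<subseteq> ?X" and "\<nexists>n. g n \<in> gen_ideal ?X (g ` {..<n})"
  then have bad: "g n \<notin> gen_ideal ?X (g ` {..<n})" for n by blast
  define J where "J = gen_ideal ?X (range g)"
  have JX: "J \<subseteq> ?X" unfolding J_def using gen_ideal_subset[OF X g] .
  have ex: "\<exists>p. p \<in> J \<and> p \<notin> gen_ideal ?X F" if F: "finite F" "F \<subseteq> J" for F
  proof -
    obtain N where N: "F \<subseteq> gen_ideal ?X (g ` {..<N})"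
      using noetherian_sequence_gen[OF X F(1) F(2)[unfolded J_def]] by blast
    have "g N \<notin> gen_ideal ?X F" using bad[of N] gen_ideal_least[OF X N] by blast
    moreover have "g N \<in> J" unfolding J_def by (intro gen_ideal_base[OF X]) auto
    ultimately show ?thesis by blast
  qed
  define pick where "pick F = (ARG_MIN Polynomial.degree p. p \<in> J \<and> p \<notin> gen_ideal ?X F)" for F
  have pick: "pick F \<in> J" "pick F \<notin> gen_ideal ?X F"
    "\<And>p. p \<in> J \<Longrightarrow> p \<notin> gen_ideal ?X F \<Longrightarrow> Polynomial.degree (pick F) \<le> Polynomial.degree p"
    if F: "finite F" "F \<subseteq> J" for F
  proof -
    obtain p0 where "p0 \<in> J \<and> p0 \<notin> gen_ideal ?X F" using ex[OF F] by blast
    note * = arg_min_nat_lemma[of "\<lambda>p. p \<in> J \<and> p \<notin> gen_ideal ?X F", OF this, of Polynomial.degree,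
        folded pick_def]
    show "pick F \<in> J" "pick F \<notin> gen_ideal ?X F" 
      "\<And>p. p \<in> J \<Longrightarrow> p \<notin> gen_ideal ?X F \<Longrightarrow> Polynomial.degree (pick F) \<le> Polynomial.degree p"
      using * by auto
  qed
  define F where "F = rec_nat {} (\<lambda>_ A. insert (pick A) A)"
  define f where "f n = pick (F n)" for n
  have F0: "F 0 = {}" and FS: "F (Suc n) = insert (f n) (F n)" for n by (auto simp: F_def f_def)
  have F: "F n = f ` {..<n}" for n by (induction n) (auto simp: F0 FS lessThan_Suc)
  have FJ: "finite (F n)" "F n \<subseteq> J" for n
    by (induction n) (auto simp: F0 FS f_def intro: pick)
  define d where "d n = Polynomial.degree (f n)" for n
  define a where "a n = lead_coeff (f n)" for n
  have fJ: "f n \<in> J" for n unfolding f_def using pick(1)[OF FJ] .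
  have dmono: "d i \<le> d n" if "i \<le> n" for i n
  proof -
    have "F i \<subseteq> F n" using that by (auto simp: F)
    then have "gen_ideal ?X (F i) \<subseteq> gen_ideal ?X (F n)" by (rule gen_ideal_mono[OF X])
    then have "f n \<notin> gen_ideal ?X (F i)" using pick(2)[OF FJ, of n] by (auto simp: f_def)
    then show ?thesis using pick(3)[OF FJ fJ] by (auto simp: d_def f_def)
  qed
  have "range a \<subseteq> S" using fJ JX by (auto simp: a_def polys_over_def)
  then obtain n where n: "a n \<in> gen_ideal S (a ` {..<n})" using noeth unfolding noetherian_def by blast
  \<comment> \<open>A combination of earlier leading coefficients is realised in degree
    \<open>d n\<close>: the term from \<open>f i\<close> is shifted up by \<open>d n - d i\<close>,
    which is possible because the degrees do not decrease.\<close>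
  have lift: "\<exists>h \<in> gen_ideal ?X (F n). Polynomial.degree h \<le> d n \<and> poly.coeff h (d n) = b"
    if "b \<in> gen_ideal S (a ` {..<n})" for b
    using that
  proof induction
    case zero
    show ?case by (intro bexI[of _ 0]) (auto intro: gen_ideal.zero)
  next
    case (step b s y)
    then obtain h i where h: "h \<in> gen_ideal ?X (F n)" "Polynomial.degree h \<le> d n" "poly.coeff h (d n) = b"
      and i: "i < n" "y = a i" by blast
    have di: "d i \<le> d n" using dmono i by simp
    let ?m = "Polynomial.monom s (d n - d i)"
    have "?m \<in> ?X" using step.hyps is_subringD(2)[OF S] by (auto simp: polys_over_def)
    moreover have "f i \<in> F n" using i by (auto simp: F)
    ultimately have "h + ?m * f i \<in> gen_ideal ?X (F n)" using h by (intro gen_ideal.step)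
    moreover have "Polynomial.degree (?m * f i) \<le> d n"
      using degree_mult_le[of ?m "f i"] Polynomial.degree_monom_le[of s "d n - d i"] di by (simp add: d_def)
    then have "Polynomial.degree (h + ?m * f i) \<le> d n" using h(2) by (intro degree_add_le)
    moreover have "poly.coeff (?m * f i) (d n) = s * poly.coeff (f i) (d i)"
      using di by (simp add: coeff_monom_mult)
    then have "poly.coeff (h + ?m * f i) (d n) = b + s * y" using h(3) i by (simp add: a_def d_def)
    ultimately show ?case by blast
  qed
  obtain h where h: "h \<in> gen_ideal ?X (F n)" "Polynomial.degree h \<le> d n" "poly.coeff h (d n) = a n"
    using lift[OF n] by blast
  let ?r = "f n - h"
  have "h \<in> J" using gen_ideal_least[OF X FJ(2)[of n, unfolded J_def] h(1)] by (simp add: J_def)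
  then have rJ: "?r \<in> J" unfolding J_def using fJ gen_ideal_diff[OF X] by (auto simp: J_def)
  have rn: "?r \<notin> gen_ideal ?X (F n)"
  proof
    assume "?r \<in> gen_ideal ?X (F n)"
    from gen_ideal_add[OF h(1) this] show False using pick(2)[OF FJ, of n] by (simp add: f_def)
  qed
  \<comment> \<open>Minimality of \<open>f n\<close> bounds the degree of the difference from below,
    while its coefficient at \<open>d n\<close> cancels. So it is the zero polynomial, which lies in
    every ideal; this includes the case \<open>d n = 0\<close>.\<close>
  have "d n \<le> Polynomial.degree ?r" using pick(3)[OF FJ rJ rn] by (simp add: d_def f_def)
  moreover have "Polynomial.degree ?r \<le> d n" using h(2) by (intro degree_diff_le) (auto simp: d_def)
  ultimately have "Polynomial.degree ?r = d n" by simp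
  moreover have "poly.coeff ?r (d n) = 0" using h(3) by (simp add: a_def d_def)
  ultimately have "?r = 0" by (metis leading_coeff_0_iff)
  then show False using rn gen_ideal.zero by metis
qed

section \<open>Finitely generated extensions of noetherian rings\<close>

definition adjoin :: "'a::comm_ring_1 \<Rightarrow> 'a set \<Rightarrow> 'a set" where
  "adjoin x S = (\<lambda>p. poly p x) ` polys_over S"

lemma adjoin_subring:
  assumes "is_subring S"
  shows "is_subring (adjoin x S)"
proof -
  note P = is_subringD[OF is_subring_polys_over[OF assms]]
  have "1 \<in> adjoin x S" unfolding adjoin_def using P(1) by (intro image_eqI[of _ _ "1::'a poly"]) auto
  then show ?thesis
    unfolding is_subring_def by (auto simp: adjoin_def simp flip: poly_diff poly_mult intro!: imageI P)
qed

lemma adjoin_superset: "is_subring S \<Longrightarrow> S \<subseteq> adjoin x S"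
proof
  fix s assume "is_subring S" "s \<in> S"
  then have "[:s:] \<in> polys_over S" by (auto simp: polys_over_def coeff_pCons is_subringD split: nat.split)
  then show "s \<in> adjoin x S" unfolding adjoin_def by (rule rev_image_eqI) simp
qed

lemma adjoin_mem: "is_subring S \<Longrightarrow> x \<in> adjoin x S"
proof -
  assume "is_subring S"
  then have "[:0,1:] \<in> polys_over S" by (auto simp: polys_over_def coeff_pCons is_subringD split: nat.split)
  then show "x \<in> adjoin x S" unfolding adjoin_def by (rule rev_image_eqI) simp
qed

lemma adjoin_least:
  assumes R: "is_subring R" and "S \<subseteq> R" "x \<in> R"
  shows "adjoin x S \<subseteq> R"
  using assms(2,3) unfolding adjoin_def polys_over_def
  by (auto simp: poly_altdef intro!: is_subring_sum[OF R] is_subringD[OF R] is_subring_power[OF R])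

text \<open>Evaluation at \<open>x\<close> maps the polynomial ring onto the extension and carries
  relations along. The extension lives in the original type again, so the construction can be
  iterated with \<open>foldr\<close>.\<close>

lemma noetherian_adjoin:
  assumes S: "is_subring S" and noeth: "noetherian S"
  shows "noetherian (adjoin x S)"
  unfolding noetherian_def
proof (intro allI impI)
  fix f :: "nat \<Rightarrow> 'a" assume "range f \<subseteq> adjoin x S"
  then have "\<forall>i. \<exists>p. p \<in> polys_over S \<and> f i = poly p x" by (auto simp: adjoin_def)
  then obtain g where g: "\<And>i. g i \<in> polys_over S" "\<And>i. f i = poly (g i) x" by metis
  obtain n where n: "g n \<in> gen_ideal (polys_over S) (g ` {..<n})"
    using hilbert_basis[OF S noeth] g(1) unfolding noetherian_def by blast
  have "poly p x \<in> gen_ideal (adjoin x S) (f ` {..<n})" if "p \<in> gen_ideal (polys_over S) (g ` {..<n})" for p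
    using that
  proof induction
    case (step p s q)
    then show ?case using g(2) by (auto simp: adjoin_def intro!: gen_ideal.step)
  qed (auto intro: gen_ideal.zero)
  then show "\<exists>n. f n \<in> gen_ideal (adjoin x S) (f ` {..<n})" using n g(2) by metis
qed

lemma foldr_adjoin:
  assumes S: "is_subring S" and noeth: "noetherian S"
  shows "is_subring (foldr adjoin xs S)" (is ?a) and "noetherian (foldr adjoin xs S)" (is ?b)
    and "S \<union> set xs \<subseteq> foldr adjoin xs S" (is ?c)
proof -
  have "?a \<and> ?b \<and> ?c"
  proof (induction xs)
    case (Cons x xs)
    then show ?case using adjoin_subring[of "foldr adjoin xs S" x] adjoin_superset[of "foldr adjoin xs S" x]
        adjoin_mem[of "foldr adjoin xs S" x] noetherian_adjoin[of "foldr adjoin xs S" x] by auto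
  qed (use S noeth in auto)
  then show ?a ?b ?c by auto
qed

lemma foldr_adjoin_least:
  "is_subring R \<Longrightarrow> S \<subseteq> R \<Longrightarrow> set xs \<subseteq> R \<Longrightarrow> foldr adjoin xs S \<subseteq> R"
  by (induction xs) (auto dest: adjoin_least[THEN subsetD, rotated 3])

section \<open>Polynomial functions on matrices and their derivatives\<close>

text \<open>Matrices of the wrong size have junk entries; cutting to size \<open>n\<close> makes identities between
  polynomial functions hold on the whole matrix type.\<close>

definition cut :: "nat \<Rightarrow> 'k mat \<Rightarrow> 'k mat" where
  "cut n A = mat n n (\<lambda>ij. A $$ ij)"

lemma cut_carrier [simp]: "cut n A \<in> carrier_mat n n" "dim_row (cut n A) = n" "dim_col (cut n A) = n"
  by (auto simp: cut_def)

lemma cut_index [simp]: "i < n \<Longrightarrow> j < n \<Longrightarrow> cut n A $$ (i, j) = A $$ (i, j)"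
  by (simp add: cut_def)

lemma cut_id [simp]: "A \<in> carrier_mat n n \<Longrightarrow> cut n A = A"
  by (intro eq_matI) auto

lemma poly_fun_cut: "f \<in> poly_fun n \<Longrightarrow> f (cut n A) = f A"
  by (induction rule: poly_fun.induct) auto

lemma poly_fun_cmult: "f \<in> poly_fun n \<Longrightarrow> (\<lambda>A. c * f A) \<in> poly_fun n"
  by (rule poly_fun.mult[OF poly_fun.const])

lemma poly_fun_diff: "f \<in> poly_fun n \<Longrightarrow> h \<in> poly_fun n \<Longrightarrow> (\<lambda>A. f A - h A) \<in> poly_fun n"
  using poly_fun.add[OF _ poly_fun_cmult, of f n h "-1"] by simp

lemma poly_fun_sum: "(\<And>x. x \<in> I \<Longrightarrow> f x \<in> poly_fun n) \<Longrightarrow> (\<lambda>A. \<Sum>x\<in>I. f x A) \<in> poly_fun n"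
  by (induction I rule: infinite_finite_induct) (auto intro: poly_fun.intros)

lemma poly_fun_prod: "(\<And>x. x \<in> I \<Longrightarrow> f x \<in> poly_fun n) \<Longrightarrow> (\<lambda>A. \<Prod>x\<in>I. f x A) \<in> poly_fun n"
  by (induction I rule: infinite_finite_induct) (auto intro: poly_fun.intros)

text \<open>The size is prescribed for every \<open>A\<close>, even one of the wrong dimensions, so
  that the entry formulas for products and determinants hold on the whole type; \<open>cut\<close>
  is the basic example.\<close>

definition poly_mat :: "nat \<Rightarrow> nat \<Rightarrow> nat \<Rightarrow> ('k::field mat \<Rightarrow> 'k mat) \<Rightarrow> bool" where
  "poly_mat n p q M \<longleftrightarrow> (\<forall>A. M A \<in> carrier_mat p q) \<and>
     (\<forall>i<p. \<forall>j<q. (\<lambda>A. M A $$ (i, j)) \<in> poly_fun n)"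

lemma poly_matD:
  assumes "poly_mat n p q M"
  shows "M A \<in> carrier_mat p q" "i < p \<Longrightarrow> j < q \<Longrightarrow> (\<lambda>A. M A $$ (i, j)) \<in> poly_fun n"
  using assms by (auto simp: poly_mat_def)

lemma poly_mat_const: "B \<in> carrier_mat p q \<Longrightarrow> poly_mat n p q (\<lambda>A. B)"
  by (auto simp: poly_mat_def intro: poly_fun.const)

lemma poly_mat_cut: "poly_mat n n n (cut n)"
  by (auto simp: poly_mat_def intro: poly_fun.entry)

lemma poly_mat_mult:
  assumes M: "poly_mat n p q M" and N: "poly_mat n q r N"
  shows "poly_mat n p r (\<lambda>A. M A * N A)"
  unfolding poly_mat_def
proof (intro conjI allI impI)
  show "M A * N A \<in> carrier_mat p r" for A
    using poly_matD(1)[OF M] poly_matD(1)[OF N] by (rule mult_carrier_mat)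
  fix i j assume ij: "i < p" "j < r"
  have "(M A * N A) $$ (i, j) = (\<Sum>k<q. M A $$ (i, k) * N A $$ (k, j))" for A
    using ij poly_matD(1)[OF M, of A] poly_matD(1)[OF N, of A]
    by (auto simp: scalar_prod_def lessThan_atLeast0)
  moreover have "(\<lambda>A. \<Sum>k<q. M A $$ (i, k) * N A $$ (k, j)) \<in> poly_fun n"
    using ij poly_matD(2)[OF M] poly_matD(2)[OF N] by (intro poly_fun_sum poly_fun.mult) auto
  ultimately show "(\<lambda>A. (M A * N A) $$ (i, j)) \<in> poly_fun n" by simp
qed

lemma poly_fun_compose:
  assumes "f \<in> poly_fun p" and M: "poly_mat n p p M"
  shows "(\<lambda>A. f (M A)) \<in> poly_fun n"
  using assms(1) by induction (auto intro: poly_fun.intros poly_matD(2)[OF M])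

lemma poly_fun_det:
  assumes M: "poly_mat n p p M"
  shows "(\<lambda>A. det (M A)) \<in> poly_fun n"
proof -
  have "det (M A) = (\<Sum>s | s permutes {0..<p}. signof s * (\<Prod>i = 0..<p. M A $$ (i, s i)))" for A
    using det_def'[OF poly_matD(1)[OF M]] .
  moreover have "(\<lambda>A. \<Sum>s | s permutes {0..<p}. signof s * (\<Prod>i = 0..<p. M A $$ (i, s i))) \<in> poly_fun n"
    by (intro poly_fun_sum poly_fun_cmult poly_fun_prod poly_matD(2)[OF M])
       (auto dest: permutes_in_image[of _ "{0..<p}"])
  ultimately show ?thesis by simp
qed

lemma poly_mat_adj:
  assumes M: "poly_mat n p p M"
  shows "poly_mat n p p (\<lambda>A. adj_mat (M A))"
  unfolding poly_mat_def
proof (intro conjI allI impI)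
  show "adj_mat (M A) \<in> carrier_mat p p" for A using adj_mat(1)[OF poly_matD(1)[OF M]] .
  fix i j assume ij: "i < p" "j < p"
  have del: "poly_mat n (p-1) (p-1) (\<lambda>A. mat_delete (M A) j i)"
    unfolding poly_mat_def
  proof (intro conjI allI impI)
    show "mat_delete (M A) j i \<in> carrier_mat (p-1) (p-1)" for A
      using poly_matD(1)[OF M, of A] by (rule mat_delete_carrier)
    fix a b assume ab: "a < p-1" "b < p-1"
    have "mat_delete (M A) j i $$ (a, b) = M A $$ (if a < j then a else Suc a, if b < i then b else Suc b)" for A
      using ab poly_matD(1)[OF M, of A] by (auto simp: mat_delete_def)
    then show "(\<lambda>A. mat_delete (M A) j i $$ (a, b)) \<in> poly_fun n"
      using ab by (auto intro!: poly_matD(2)[OF M])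
  qed
  have "adj_mat (M A) $$ (i, j) = (- 1) ^ (j + i) * det (mat_delete (M A) j i)" for A
    using ij poly_matD(1)[OF M, of A] by (auto simp: adj_mat_def cofactor_def)
  then show "(\<lambda>A. adj_mat (M A) $$ (i, j)) \<in> poly_fun n"
    using poly_fun_cmult[OF poly_fun_det[OF del]] by simp
qed

section \<open>Directional derivatives of polynomial functions\<close>

definition ddir :: "('k::field mat \<Rightarrow> 'k) \<Rightarrow> 'k mat \<Rightarrow> 'k mat \<Rightarrow> 'k" where
  "ddir f A B = poly.coeff (THE q. \<forall>s. f (A + s \<cdot>\<^sub>m B) = poly q s) 1"

text \<open>A field of characteristic zero is infinite, so the values of a polynomial determine it
  and the definite description in \<open>ddir\<close> has a unique solution.\<close>

lemma ddirI:
  fixes f :: "'k::field_char_0 mat \<Rightarrow> 'k"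
  assumes "\<And>s. f (A + s \<cdot>\<^sub>m B) = poly q s"
  shows "ddir f A B = poly.coeff q 1"
proof -
  have "(THE q. \<forall>s. f (A + s \<cdot>\<^sub>m B) = poly q s) = q"
    using assms by (intro the_equality) (auto simp: poly_eq_poly_eq_iff[symmetric])
  then show ?thesis by (simp add: ddir_def)
qed

lemma poly_fun_along_line:
  fixes A B :: "'k::field_char_0 mat"
  assumes "f \<in> poly_fun n" "A \<in> carrier_mat n n" "B \<in> carrier_mat n n"
  shows "\<exists>q. (\<forall>s. f (A + s \<cdot>\<^sub>m B) = poly q s) \<and> poly.coeff q 0 = f A \<and> poly.coeff q 1 = ddir f A B"
proof -
  have "\<exists>q. \<forall>s. f (A + s \<cdot>\<^sub>m B) = poly q s"
    using assms(1)
  proof induction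
    case (const c)
    show ?case by (rule exI[of _ "[:c:]"]) simp
  next
    case (entry i j)
    then show ?case using assms(2,3) by (intro exI[of _ "[:A $$ (i, j), B $$ (i, j):]"]) auto
  next
    case (add f h)
    then obtain q r where "\<And>s. f (A + s \<cdot>\<^sub>m B) = poly q s" "\<And>s. h (A + s \<cdot>\<^sub>m B) = poly r s" by metis
    then show ?case by (intro exI[of _ "q + r"]) simp
  next
    case (mult f h)
    then obtain q r where "\<And>s. f (A + s \<cdot>\<^sub>m B) = poly q s" "\<And>s. h (A + s \<cdot>\<^sub>m B) = poly r s" by metis
    then show ?case by (intro exI[of _ "q * r"]) simp
  qed
  then obtain q where q: "\<And>s. f (A + s \<cdot>\<^sub>m B) = poly q s" by blast
  have "A + 0 \<cdot>\<^sub>m B = A" using assms(2,3) by auto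
  then have "poly.coeff q 0 = f A" using q[of 0] by (simp add: poly_0_coeff_0)
  then show ?thesis using q ddirI[of f A B q] by auto
qed

lemma ddir_const [simp]: "ddir (\<lambda>A. c) A B = (0 :: 'k::field_char_0)"
  using ddirI[of "\<lambda>A. c" A B "[:c:]"] by simp

context
  fixes n :: nat and A B :: "'k::field_char_0 mat"
  assumes A: "A \<in> carrier_mat n n" and B: "B \<in> carrier_mat n n"
begin

lemma ddir_entry: "i < n \<Longrightarrow> j < n \<Longrightarrow> ddir (\<lambda>A. A $$ (i, j)) A B = B $$ (i, j)"
  using A B by (subst ddirI[of _ _ _ "[:A $$ (i, j), B $$ (i, j):]"]) auto

lemma ddir_add:
  assumes "f \<in> poly_fun n" "h \<in> poly_fun n"
  shows "ddir (\<lambda>A. f A + h A) A B = ddir f A B + ddir h A B"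
proof -
  obtain q r where "\<And>s. f (A + s \<cdot>\<^sub>m B) = poly q s" "\<And>s. h (A + s \<cdot>\<^sub>m B) = poly r s"
     "poly.coeff q 1 = ddir f A B" "poly.coeff r 1 = ddir h A B"
    using poly_fun_along_line[OF assms(1) A B] poly_fun_along_line[OF assms(2) A B] by blast
  then show ?thesis by (subst ddirI[of _ _ _ "q + r"]) auto
qed

lemma ddir_mult:
  assumes "f \<in> poly_fun n" "h \<in> poly_fun n"
  shows "ddir (\<lambda>A. f A * h A) A B = ddir f A B * h A + f A * ddir h A B"
proof -
  obtain q r where "\<And>s. f (A + s \<cdot>\<^sub>m B) = poly q s" "\<And>s. h (A + s \<cdot>\<^sub>m B) = poly r s"
     "poly.coeff q 1 = ddir f A B" "poly.coeff r 1 = ddir h A B"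
     "poly.coeff q 0 = f A" "poly.coeff r 0 = h A"
    using poly_fun_along_line[OF assms(1) A B] poly_fun_along_line[OF assms(2) A B] by blast
  then show ?thesis
    by (subst ddirI[of _ _ _ "q * r"]) (auto simp: coeff_mult algebra_simps)
qed

lemma ddir_cmult: "f \<in> poly_fun n \<Longrightarrow> ddir (\<lambda>A. c * f A) A B = c * ddir f A B"
  using ddir_mult[OF poly_fun.const[of c]] by simp

lemma ddir_sum:
  assumes "\<And>x. x \<in> I \<Longrightarrow> f x \<in> poly_fun n"
  shows "ddir (\<lambda>A. \<Sum>x\<in>I. f x A) A B = (\<Sum>x\<in>I. ddir (f x) A B)"
  using assms by (induction I rule: infinite_finite_induct) (auto simp: ddir_add poly_fun_sum)

definition mddir :: "nat \<Rightarrow> nat \<Rightarrow> ('k mat \<Rightarrow> 'k mat) \<Rightarrow> 'k mat" where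
  "mddir p q M = mat p q (\<lambda>(i, j). ddir (\<lambda>A. M A $$ (i, j)) A B)"

lemma mddir_carrier [simp]: "mddir p q M \<in> carrier_mat p q"
  by (simp add: mddir_def)

lemma mddir_const: "C \<in> carrier_mat p q \<Longrightarrow> mddir p q (\<lambda>A. C) = 0\<^sub>m p q"
  by (intro eq_matI) (auto simp: mddir_def)

lemma mddir_cut: "mddir n n (cut n) = B"
  using B by (intro eq_matI) (auto simp: mddir_def ddir_entry)

lemma mddir_mult:
  assumes M: "poly_mat n p q M" and N: "poly_mat n q r N"
  shows "mddir p r (\<lambda>A. M A * N A) = mddir p q M * N A + M A * mddir q r N"
proof (intro eq_matI)
  note c = poly_matD(1)[OF M] poly_matD(1)[OF N]
  fix i j assume "i < dim_row (mddir p q M * N A + M A * mddir q r N)"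
    "j < dim_col (mddir p q M * N A + M A * mddir q r N)"
  then have ij: "i < p" "j < r" using c[of A] by (auto simp: mddir_def)
  have "(M A * N A) $$ (i, j) = (\<Sum>k<q. M A $$ (i, k) * N A $$ (k, j))" for A
    using ij c[of A] by (auto simp: scalar_prod_def lessThan_atLeast0)
  then have "mddir p r (\<lambda>A. M A * N A) $$ (i, j) = ddir (\<lambda>A. \<Sum>k<q. M A $$ (i, k) * N A $$ (k, j)) A B"
    using ij by (simp add: mddir_def)
  also have "\<dots> = (\<Sum>k<q. ddir (\<lambda>A. M A $$ (i, k)) A B * N A $$ (k, j) + M A $$ (i, k) * ddir (\<lambda>A. N A $$ (k, j)) A B)"
    using ij poly_matD(2)[OF M] poly_matD(2)[OF N]
    by (subst ddir_sum) (auto intro!: sum.cong poly_fun.mult simp: ddir_mult)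
  also have "\<dots> = (mddir p q M * N A + M A * mddir q r N) $$ (i, j)"
    using ij c[of A] by (auto simp: scalar_prod_def lessThan_atLeast0 mddir_def sum.distrib)
  finally show "mddir p r (\<lambda>A. M A * N A) $$ (i, j) = (mddir p q M * N A + M A * mddir q r N) $$ (i, j)" .
qed (use poly_matD(1)[OF M, of A] poly_matD(1)[OF N, of A] in \<open>auto simp: mddir_def\<close>)

end

text \<open>From \<open>det (A + s A X) = det A * det (1 + s X)\<close>: the logarithmic derivative
  along a left invariant field is constant, with value the trace of \<open>X\<close>.\<close>

lemma ddir_det:
  fixes A X :: "'k::field_char_0 mat"
  assumes A: "A \<in> carrier_mat n n" and X: "X \<in> carrier_mat n n"
  shows "ddir (\<lambda>A. det (cut n A)) A (A * X) = det A * ddir (\<lambda>A. det (cut n A)) (1\<^sub>m n) X"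
proof -
  obtain q where q: "\<And>s. det (cut n (1\<^sub>m n + s \<cdot>\<^sub>m X)) = poly q s"
    "poly.coeff q 1 = ddir (\<lambda>A. det (cut n A)) (1\<^sub>m n) X"
    using poly_fun_along_line[OF poly_fun_det[OF poly_mat_cut] one_carrier_mat X] by blast
  have "det (cut n (A + s \<cdot>\<^sub>m (A * X))) = poly (Polynomial.smult (det A) q) s" for s
  proof -
    have "A + s \<cdot>\<^sub>m (A * X) = A * (1\<^sub>m n + s \<cdot>\<^sub>m X)"
      using A X by (subst mult_add_distrib_mat[of _ n n]) auto
    then show ?thesis using A X q(1)[of s] by (simp add: det_mult)
  qed
  from ddirI[of "\<lambda>A. det (cut n A)", OF this] show ?thesis by (simp flip: q(2))
qed

text \<open>Differentiating \<open>A * adj A = det A\<close> avoids computing with cofactors.\<close>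

lemma mddir_adj:
  fixes A X :: "'k::field_char_0 mat"
  assumes A: "A \<in> carrier_mat n n" and X: "X \<in> carrier_mat n n" and d: "det A \<noteq> 0"
  defines "c \<equiv> ddir (\<lambda>A. det (cut n A)) (1\<^sub>m n) X"
  shows "mddir A (A * X) n n (\<lambda>A. adj_mat (cut n A)) = c \<cdot>\<^sub>m adj_mat A - X * adj_mat A"
proof -
  let ?N = "mddir A (A * X) n n (\<lambda>A. adj_mat (cut n A))"
  have AX: "A * X \<in> carrier_mat n n" using A X by auto
  have adj: "adj_mat A \<in> carrier_mat n n" "adj_mat A * A = det A \<cdot>\<^sub>m 1\<^sub>m n" using adj_mat[OF A] by auto
  have N: "?N \<in> carrier_mat n n" by (rule mddir_carrier[OF A AX])
  have "A * X * adj_mat A + A * ?N = mddir A (A * X) n n (\<lambda>A. cut n A * adj_mat (cut n A))"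
    using mddir_mult[OF A AX poly_mat_cut poly_mat_adj[OF poly_mat_cut]] mddir_cut[OF A AX] A by simp
  also have "\<dots> = mddir A (A * X) n n (\<lambda>A. det (cut n A) \<cdot>\<^sub>m 1\<^sub>m n)"
    by (simp add: adj_mat(2)[of _ n])
  also have "\<dots> = (det A * c) \<cdot>\<^sub>m 1\<^sub>m n"
    by (intro eq_matI) (auto simp: mddir_def[OF A AX] ddir_det[OF A X] c_def)
  \<comment> \<open>Multiplying by \<open>adj_mat A\<close> on the left turns the unknown
    \<open>A * ?N\<close> into \<open>det A\<close> times \<open>?N\<close>; the nonzero factor
    \<open>det A\<close> is divided out entrywise at the end.\<close>
  finally have "adj_mat A * (A * X * adj_mat A + A * ?N) = adj_mat A * ((det A * c) \<cdot>\<^sub>m 1\<^sub>m n)" by simp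
  moreover have "adj_mat A * (A * X * adj_mat A + A * ?N)
      = (adj_mat A * A) * (X * adj_mat A) + (adj_mat A * A) * ?N"
  proof -
    have "adj_mat A * (A * X * adj_mat A + A * ?N) = adj_mat A * (A * (X * adj_mat A)) + adj_mat A * (A * ?N)"
      using A X adj(1) N by (subst mult_add_distrib_mat[of _ n n]) (auto simp: assoc_mult_mat[of _ n n _ n _ n])
    then show ?thesis using A X adj(1) N by (simp only: assoc_mult_mat[of _ n n _ n _ n] mult_carrier_mat)
  qed
  moreover have "(c * det A) \<cdot>\<^sub>m adj_mat A = det A \<cdot>\<^sub>m (c \<cdot>\<^sub>m adj_mat A)"
    by (intro eq_matI) auto
  ultimately have "det A \<cdot>\<^sub>m (X * adj_mat A + ?N) = det A \<cdot>\<^sub>m (c \<cdot>\<^sub>m adj_mat A)"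
    using A X adj N
    by (simp add: mult_smult_assoc_mat[of _ n n _ n] mult_smult_distrib[of _ n n _ n] add_smult_distrib_left_mat[of _ n n] smult_smult_assoc mult.commute)
  then have e: "(det A \<cdot>\<^sub>m (X * adj_mat A + ?N)) $$ (i, j) = (det A \<cdot>\<^sub>m (c \<cdot>\<^sub>m adj_mat A)) $$ (i, j)" for i j by simp
  show ?thesis
  proof (intro eq_matI)
    fix i j assume "i < dim_row (c \<cdot>\<^sub>m adj_mat A - X * adj_mat A)" "j < dim_col (c \<cdot>\<^sub>m adj_mat A - X * adj_mat A)"
    then have "i < n" "j < n" using A X adj by auto
    then have "(X * adj_mat A) $$ (i, j) + ?N $$ (i, j) = c * adj_mat A $$ (i, j)"
      using e[of i j] A X adj N d by (simp add: index_mult_mat del: index_mult_mat(1))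
    then show "?N $$ (i, j) = (c \<cdot>\<^sub>m adj_mat A - X * adj_mat A) $$ (i, j)"
      using A X adj N \<open>i < n\<close> \<open>j < n\<close> by (simp add: algebra_simps del: index_mult_mat(1))
  qed (use A X adj carrier_matD[OF N] in auto)
qed

section \<open>Linear algebra of finitely supported functions\<close>

text \<open>The interpretations stay local because they turn multiplication into a scalar multiplication,
  whose simplification rules clash with those of multiplication.\<close>

context
begin

interpretation fv: vector_space "\<lambda>(c::'k::field) (f::'i \<Rightarrow> 'k) i. c * f i"
  by unfold_locales (auto simp: fun_eq_iff algebra_simps)

interpretation fv_self: vector_space_pair "\<lambda>(c::'k::field) (f::'i \<Rightarrow> 'k) i. c * f i" "(*) :: 'k \<Rightarrow> 'k \<Rightarrow> 'k"
  by unfold_locales (auto simp: fun_eq_iff algebra_simps)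

definition unit_fun :: "'i \<Rightarrow> 'i \<Rightarrow> 'k::field" where
  "unit_fun i = (\<lambda>j. if j = i then 1 else 0)"

lemma unit_fun_expansion:
  assumes "finite I" "\<And>i. i \<notin> I \<Longrightarrow> f i = 0"
  shows "f = (\<Sum>i\<in>I. (\<lambda>j. f i * unit_fun i j))"
proof
  fix j
  have "(\<Sum>i\<in>I. (\<lambda>j. f i * unit_fun i j)) j = (\<Sum>i\<in>I. f i * unit_fun i j)"
    by (induction I rule: infinite_finite_induct) auto
  also have "\<dots> = (\<Sum>i\<in>I. if i = j then f j else 0)"
    by (intro sum.cong) (auto simp: unit_fun_def)
  also have "\<dots> = f j" using assms by (simp add: sum.delta')
  finally show "f j = (\<Sum>i\<in>I. (\<lambda>j. f i * unit_fun i j)) j" by simp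
qed

lemma supported_span:
  assumes "finite I" "\<And>i. i \<notin> I \<Longrightarrow> f i = 0"
  shows "f \<in> fv.span (unit_fun ` I)"
proof -
  have "(\<Sum>i\<in>I. (\<lambda>j. f i * unit_fun i j)) \<in> fv.span (unit_fun ` I)"
    by (intro fv.span_sum fv.span_scale fv.span_base) auto
  moreover have "f = (\<Sum>i\<in>I. (\<lambda>j. f i * unit_fun i j))"
    using assms by (rule unit_fun_expansion)
  ultimately show ?thesis by argo
qed

lemma supported_finite_basis:
  fixes W :: "('i \<Rightarrow> 'k::field) set"
  assumes "finite I" "\<And>f i. f \<in> W \<Longrightarrow> i \<notin> I \<Longrightarrow> f i = 0"
  obtains B where "finite B" "B \<subseteq> W" "W \<subseteq> fv.span B" "fv.independent B"
proof -
  obtain B where B: "B \<subseteq> W" "fv.independent B" "W \<subseteq> fv.span B"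
    using fv.maximal_independent_subset by blast
  have "B \<subseteq> fv.span (unit_fun ` I)" using B(1) supported_span[OF assms(1)] assms(2) by blast
  then have "finite B" using fv.independent_span_bound[OF _ B(2)] assms(1) by blast
  then show ?thesis using that B by blast
qed

text \<open>Adding \<open>y\<close> to a basis of the span of \<open>W\<close> keeps it independent,
  so some linear form is 1 at \<open>y\<close> and 0 on the basis. Its values at the unit functions
  are the coefficients \<open>d\<close>.\<close>

lemma separating_functional:
  fixes W :: "('i \<Rightarrow> 'k::field) set"
  assumes I: "finite I" and W: "\<And>f i. f \<in> W \<Longrightarrow> i \<notin> I \<Longrightarrow> f i = 0"
    and y: "\<And>i. i \<notin> I \<Longrightarrow> y i = 0" "y \<notin> fv.span W"
  obtains d where "\<And>f. f \<in> W \<Longrightarrow> (\<Sum>i\<in>I. d i * f i) = 0" "(\<Sum>i\<in>I. d i * y i) \<noteq> 0"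
proof -
  obtain B where B: "B \<subseteq> W" "fv.independent B" "W \<subseteq> fv.span B"
    using fv.maximal_independent_subset by blast
  have "y \<notin> fv.span B" using y(2) fv.span_mono[OF B(1)] by blast
  then have "fv.independent (insert y B)" using B(2) by (simp add: fv.independent_insert)
  then obtain \<phi> where lin: "Vector_Spaces.linear (\<lambda>c f i. c * f i) (*) \<phi>" and \<phi>: "\<And>x. x \<in> insert y B \<Longrightarrow> \<phi> x = (if x = y then 1 else 0)"
    using fv_self.linear_independent_extend[of "insert y B" "\<lambda>x. if x = y then 1 else 0"] by blast
  interpret l: module_hom "\<lambda>(c::'k) (f::'i \<Rightarrow> 'k) i. c * f i" "(*) :: 'k \<Rightarrow> 'k \<Rightarrow> 'k" \<phi>
    using lin by (simp add: Vector_Spaces.linear_def)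
  have exp: "\<phi> f = (\<Sum>i\<in>I. \<phi> (unit_fun i) * f i)" if "\<And>i. i \<notin> I \<Longrightarrow> f i = 0" for f
  proof -
    have "\<phi> f = \<phi> (\<Sum>i\<in>I. (\<lambda>j. f i * unit_fun i j))" using unit_fun_expansion[OF I that] by (rule arg_cong)
    also have "\<dots> = (\<Sum>i\<in>I. f i * \<phi> (unit_fun i))" by (simp only: l.sum l.scale)
    finally show ?thesis by (simp only: mult.commute)
  qed
  have zero: "\<phi> f = 0" if "f \<in> fv.span B" for f
    using that
  proof (induction rule: fv.span_induct_alt)
    case (step c x z)
    then have "\<phi> x = 0" using \<phi>[of x] \<open>y \<notin> fv.span B\<close> fv.span_base[of x B] by auto
    then show ?case using step by (simp only: l.add l.scale) simp
  qed (rule l.zero)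
  show thesis
  proof (rule that[of "\<lambda>i. \<phi> (unit_fun i)"])
    show "(\<Sum>i\<in>I. \<phi> (unit_fun i) * f i) = 0" if "f \<in> W" for f
      using exp[OF W[OF that]] zero[of f] B(3) that by auto
    show "(\<Sum>i\<in>I. \<phi> (unit_fun i) * y i) \<noteq> 0"
      using exp[OF y(1)] \<phi>[of y] by simp
  qed
qed

text \<open>Matrices of a fixed size do not form a type, so linear algebra is transported to
  functions on index pairs; extension by zero makes this linear and injective on matrices of size
  \<open>n\<close>.\<close>

definition entries :: "nat \<Rightarrow> 'k::field mat \<Rightarrow> nat \<times> nat \<Rightarrow> 'k" where
  "entries n A = (\<lambda>(i, j). if i < n \<and> j < n then A $$ (i, j) else 0)"

lemma entries_simps [simp]: "i < n \<Longrightarrow> j < n \<Longrightarrow> entries n A (i, j) = A $$ (i, j)"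
  "\<not> (i < n \<and> j < n) \<Longrightarrow> entries n A (i, j) = 0"
  by (auto simp: entries_def)

lemma entries_support: "ij \<notin> {..<n} \<times> {..<n} \<Longrightarrow> entries n A ij = 0"
  by (cases ij) (auto simp: entries_def)

lemma entries_mat [simp]: "(\<And>ij. ij \<notin> {..<n} \<times> {..<n} \<Longrightarrow> f ij = 0) \<Longrightarrow> entries n (mat n n f) = f"
  by (auto simp: entries_def fun_eq_iff)

lemma mat_entries [simp]: "A \<in> carrier_mat n n \<Longrightarrow> mat n n (entries n A) = A"
  by (intro eq_matI) auto

lemma entries_add: "A \<in> carrier_mat n n \<Longrightarrow> B \<in> carrier_mat n n \<Longrightarrow> entries n (A + B) = entries n A + entries n B"
  by (auto simp: entries_def fun_eq_iff)

lemma entries_smult: "A \<in> carrier_mat n n \<Longrightarrow> entries n (c \<cdot>\<^sub>m A) = (\<lambda>ij. c * entries n A ij)"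
  by (auto simp: entries_def fun_eq_iff)

lemma entries_inject:
  assumes "A \<in> carrier_mat n n" "B \<in> carrier_mat n n" "entries n A = entries n B"
  shows "A = B"
proof -
  have "A = mat n n (entries n A)" using mat_entries[OF assms(1)] by (rule sym)
  also have "\<dots> = mat n n (entries n B)" using assms(3) by (rule arg_cong)
  also have "\<dots> = B" using assms(2) by (rule mat_entries)
  finally show ?thesis .
qed

section \<open>Subspaces of matrices and functionals on them\<close>

definition mat_subspace :: "nat \<Rightarrow> 'k::field mat set \<Rightarrow> bool" where
  "mat_subspace n U \<longleftrightarrow> U \<subseteq> carrier_mat n n \<and> 0\<^sub>m n n \<in> U \<and>
     (\<forall>x\<in>U. \<forall>y\<in>U. x + y \<in> U) \<and> (\<forall>c. \<forall>x\<in>U. c \<cdot>\<^sub>m x \<in> U)"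

lemma mat_subspaceD:
  assumes "mat_subspace n U"
  shows "x \<in> U \<Longrightarrow> x \<in> carrier_mat n n" "0\<^sub>m n n \<in> U" "x \<in> U \<Longrightarrow> y \<in> U \<Longrightarrow> x + y \<in> U"
    "x \<in> U \<Longrightarrow> c \<cdot>\<^sub>m x \<in> U"
  using assms by (auto simp: mat_subspace_def)

lemma subspace_iff_mat_subspace: "subspace class_ring U (gl n) \<longleftrightarrow> mat_subspace n U"
proof -
  interpret vectorspace "class_ring :: 'a ring" "gl n :: ('a, 'a mat) module" by (rule matrix_vs)
  show ?thesis
  proof
    assume "subspace class_ring U (gl n)"
    then interpret s: subspace class_ring U "gl n" .
    show "mat_subspace n U" using s.submod
      unfolding mat_subspace_def submodule_def matrix_vs_simps by auto
  next
    assume "mat_subspace n U"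
    then show "subspace class_ring U (gl n)"
      unfolding mat_subspace_def subspace_def submodule_def matrix_vs_simps
      using vectorspace_axioms module_axioms by (auto simp: matrix_vs_simps)
  qed
qed

lemma subspace_entries: "mat_subspace n U \<Longrightarrow> fv.subspace (entries n ` U)"
  unfolding fv.subspace_def
proof (intro conjI ballI allI)
  assume U: "mat_subspace n U"
  have "entries n (0\<^sub>m n n) = 0" by (auto simp: entries_def fun_eq_iff)
  then show "0 \<in> entries n ` U" using mat_subspaceD(2)[OF U] by force
  show "x + y \<in> entries n ` U" if "x \<in> entries n ` U" "y \<in> entries n ` U" for x y
  proof -
    from that obtain X Y where "X \<in> U" "Y \<in> U" "x = entries n X" "y = entries n Y" by blast
    then show ?thesis using mat_subspaceD[OF U] by (auto simp flip: entries_add)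
  qed
  show "(\<lambda>i. c * x i) \<in> entries n ` U" if "x \<in> entries n ` U" for c x
  proof -
    from that obtain X where "X \<in> U" "x = entries n X" by blast
    then show ?thesis using mat_subspaceD[OF U] by (auto simp flip: entries_smult)
  qed
qed

text \<open>The form through which arrays \<open>d\<close> stand for linear functionals on matrices;
  only the values of \<open>d\<close> inside the index square count.\<close>

definition pairing :: "nat \<Rightarrow> (nat \<times> nat \<Rightarrow> 'k::field) \<Rightarrow> 'k mat \<Rightarrow> 'k" where
  "pairing n d Y = (\<Sum>ij\<in>{..<n}\<times>{..<n}. d ij * Y $$ ij)"

lemma pairing_entries: "pairing n d Y = (\<Sum>ij\<in>{..<n}\<times>{..<n}. d ij * entries n Y ij)"
  unfolding pairing_def by (intro sum.cong) auto

lemma pairing_add: "Y \<in> carrier_mat n n \<Longrightarrow> Z \<in> carrier_mat n n \<Longrightarrow> pairing n d (Y + Z) = pairing n d Y + pairing n d Z"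
  unfolding pairing_entries by (simp add: entries_add distrib_left sum.distrib)

lemma pairing_smult: "Y \<in> carrier_mat n n \<Longrightarrow> pairing n d (c \<cdot>\<^sub>m Y) = c * pairing n d Y"
  unfolding pairing_entries sum_distrib_left by (intro sum.cong) (simp_all add: entries_smult)

lemma subspace_separation:
  assumes U: "mat_subspace n U" and Y: "Y \<in> carrier_mat n n" "Y \<notin> U"
  obtains d where "\<And>u. u \<in> U \<Longrightarrow> pairing n d u = 0" "pairing n d Y \<noteq> 0"
proof -
  have "fv.span (entries n ` U) = entries n ` U"
    using subspace_entries[OF U] by (rule fv.span_eq_iff[THEN iffD2])
  moreover have "entries n Y \<notin> entries n ` U"
    using Y entries_inject mat_subspaceD(1)[OF U] by blast
  ultimately have y: "entries n Y \<notin> fv.span (entries n ` U)" by metis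
  obtain d where
    "\<And>f. f \<in> entries n ` U \<Longrightarrow> (\<Sum>i\<in>{..<n}\<times>{..<n}. d i * f i) = 0"
    "(\<Sum>i\<in>{..<n}\<times>{..<n}. d i * entries n Y i) \<noteq> 0"
    by (rule separating_functional[OF _ _ _ y, of "{..<n}\<times>{..<n}"]) (auto intro: entries_support)
  then show thesis using that[of d] by (auto simp: pairing_entries)
qed

text \<open>The double annihilator theorem. Were \<open>d\<close> outside \<open>W\<close>, a linear
  form on arrays would separate it from \<open>W\<close>; by finite dimension that form is
  evaluation at a matrix, at which \<open>W\<close> vanishes and \<open>d\<close> does not.\<close>

lemma annihilator_of_functionals:
  fixes d :: "nat \<times> nat \<Rightarrow> 'k::field"
  assumes W: "\<And>f ij. f \<in> W \<Longrightarrow> ij \<notin> {..<n}\<times>{..<n} \<Longrightarrow> f ij = 0" and zero: "0 \<in> W"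
    and add: "\<And>f h. f \<in> W \<Longrightarrow> h \<in> W \<Longrightarrow> f + h \<in> W" and scale: "\<And>f c. f \<in> W \<Longrightarrow> (\<lambda>ij. c * f ij) \<in> W"
    and d: "\<And>ij. ij \<notin> {..<n}\<times>{..<n} \<Longrightarrow> d ij = 0"
    and ann: "\<And>X. X \<in> carrier_mat n n \<Longrightarrow> (\<And>f. f \<in> W \<Longrightarrow> pairing n f X = 0) \<Longrightarrow> pairing n d X = 0"
  shows "d \<in> W"
proof (rule ccontr)
  assume "d \<notin> W"
  moreover have sub: "fv.subspace W" unfolding fv.subspace_def using zero add scale by blast
  ultimately have "d \<notin> fv.span W" using fv.span_eq_iff by metis
  then obtain x where x:
    "\<And>f. f \<in> W \<Longrightarrow> (\<Sum>ij\<in>{..<n}\<times>{..<n}. x ij * f ij) = 0" "(\<Sum>ij\<in>{..<n}\<times>{..<n}. x ij * d ij) \<noteq> 0"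
    by (rule separating_functional[of "{..<n}\<times>{..<n}" W d, rotated 3]) (use W d in auto)
  have "pairing n f (mat n n x) = (\<Sum>ij\<in>{..<n}\<times>{..<n}. x ij * f ij)" for f
    by (auto simp: pairing_def mult.commute intro!: sum.cong)
  then show False using ann[of "mat n n x"] x by simp
qed

text \<open>\<open>B\<close> is a basis of \<open>L\<close>. The functional \<open>\<phi> b\<close>
  separates \<open>b\<close> from the span of the other basis elements, scaled to be 1 at
  \<open>b\<close>; it is defined on all matrices, not just on \<open>L\<close>, as the coefficients
  of the Euler field require.\<close>

lemma dual_frame:
  assumes L: "mat_subspace n L"
  obtains B \<phi> where "finite B" "B \<subseteq> entries n ` L"
    "\<And>X. X \<in> L \<Longrightarrow> entries n X = (\<Sum>b\<in>B. (\<lambda>ij. pairing n (\<phi> b) X * b ij))"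
proof -
  let ?I = "{..<n} \<times> {..<n}"
  have sup: "\<And>f ij. f \<in> entries n ` L \<Longrightarrow> ij \<notin> ?I \<Longrightarrow> f ij = 0" by (auto intro: entries_support)
  obtain B where B: "finite B" "B \<subseteq> entries n ` L" "entries n ` L \<subseteq> fv.span B" "fv.independent B"
    by (rule supported_finite_basis[of ?I "entries n ` L"]) (use sup in auto)
  have supB: "\<And>f ij. f \<in> B \<Longrightarrow> ij \<notin> ?I \<Longrightarrow> f ij = 0" using sup B(2) by blast
  have "\<exists>d. \<forall>b'\<in>B. (\<Sum>ij\<in>?I. d ij * b' ij) = (if b' = b then 1 else 0)" if b: "b \<in> B" for b
  proof -
    have bs: "b \<notin> fv.span (B - {b})" using B(4) b unfolding fv.dependent_def by blast
    obtain d where d: "\<And>f. f \<in> B - {b} \<Longrightarrow> (\<Sum>ij\<in>?I. d ij * f ij) = 0" "(\<Sum>ij\<in>?I. d ij * b ij) \<noteq> 0"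
    proof (rule separating_functional[of ?I "B - {b}" b])
      show "f ij = 0" if "f \<in> B - {b}" "ij \<notin> ?I" for f ij using supB that by blast
      show "b ij = 0" if "ij \<notin> ?I" for ij using supB b that by blast
    qed (use bs in blast)+
    let ?c = "\<Sum>ij\<in>?I. d ij * b ij"
    have "(\<Sum>ij\<in>?I. d ij / ?c * b' ij) = (\<Sum>ij\<in>?I. d ij * b' ij) / ?c" for b'
      by (simp add: sum_divide_distrib)
    then show ?thesis using d by (intro exI[of _ "\<lambda>ij. d ij / ?c"]) auto
  qed
  then obtain \<phi> where \<phi>: "\<And>b b'. b \<in> B \<Longrightarrow> b' \<in> B \<Longrightarrow> (\<Sum>ij\<in>?I. \<phi> b ij * b' ij) = (if b' = b then 1 else 0)"
    by metis
  have sumB: "(\<Sum>b\<in>B. (\<lambda>ij. u b * b ij)) kl = (\<Sum>b\<in>B. u b * b kl)" for u kl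
    by (induction B rule: infinite_finite_induct) auto
  have "e kl = (\<Sum>b\<in>B. (\<Sum>ij\<in>?I. \<phi> b ij * e ij) * b kl)" if "e \<in> fv.span B" for e kl
    using that
  proof (induction rule: fv.span_induct_alt)
    case base
    then show ?case by simp
  next
    case (step c x y)
    have "(\<Sum>b\<in>B. (\<Sum>ij\<in>?I. \<phi> b ij * x ij) * b kl) = (\<Sum>b\<in>B. if b = x then x kl else 0)"
      using step.hyps(1) by (intro sum.cong) (auto simp: \<phi>)
    also have "\<dots> = x kl" using B(1) step.hyps(1) by simp
    finally have x: "(\<Sum>b\<in>B. (\<Sum>ij\<in>?I. \<phi> b ij * x ij) * b kl) = x kl" .
    have "p * (c * r + s) = c * (p * r) + p * s" for p r s
      by (simp only: distrib_left mult.left_commute)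
    then have pb: "(\<Sum>ij\<in>?I. \<phi> b ij * (c * x ij + y ij))
        = c * (\<Sum>ij\<in>?I. \<phi> b ij * x ij) + (\<Sum>ij\<in>?I. \<phi> b ij * y ij)" for b
      by (simp only: sum.distrib sum_distrib_left)
    have "(\<Sum>b\<in>B. (\<Sum>ij\<in>?I. \<phi> b ij * (c * x ij + y ij)) * b kl)
        = (\<Sum>b\<in>B. c * ((\<Sum>ij\<in>?I. \<phi> b ij * x ij) * b kl) + (\<Sum>ij\<in>?I. \<phi> b ij * y ij) * b kl)"
      unfolding pb by (simp only: distrib_right mult.assoc)
    also have "\<dots> = c * (\<Sum>b\<in>B. (\<Sum>ij\<in>?I. \<phi> b ij * x ij) * b kl) + (\<Sum>b\<in>B. (\<Sum>ij\<in>?I. \<phi> b ij * y ij) * b kl)"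
      by (simp only: sum.distrib sum_distrib_left[symmetric])
    finally have "(\<Sum>b\<in>B. (\<Sum>ij\<in>?I. \<phi> b ij * (c * x ij + y ij)) * b kl)
       = c * (\<Sum>b\<in>B. (\<Sum>ij\<in>?I. \<phi> b ij * x ij) * b kl) + (\<Sum>b\<in>B. (\<Sum>ij\<in>?I. \<phi> b ij * y ij) * b kl)" .
    then show ?case by (simp only: x step.IH[symmetric] plus_fun_apply)
  qed
  then have "entries n X = (\<Sum>b\<in>B. (\<lambda>ij. pairing n (\<phi> b) X * b ij))" if "X \<in> L" for X
    using that B(3) unfolding fun_eq_iff sumB pairing_entries by blast
  then show thesis using that B by blast
qed

end

section \<open>The Krull intersection theorem at the identity\<close>

definition coord :: "nat \<Rightarrow> nat \<Rightarrow> nat \<Rightarrow> 'k::field mat \<Rightarrow> 'k" where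
  "coord n i j A = A $$ (i, j) - 1\<^sub>m n $$ (i, j)"

lemma coord_one [simp]: "coord n i j (1\<^sub>m n) = 0"
  by (simp add: coord_def)

text \<open>The \<open>k\<close>-th power of the ideal of the identity in the ring of polynomial
  functions, generated by products of \<open>k\<close> entries of \<open>A - 1\<close>. Arguments
  about it become inductions on the number of such factors.\<close>

inductive vanish :: "nat \<Rightarrow> nat \<Rightarrow> ('k::field mat \<Rightarrow> 'k) \<Rightarrow> bool" for n where
  base: "f \<in> poly_fun n \<Longrightarrow> vanish n 0 f"
| zero: "vanish n k (\<lambda>A. 0)"
| gen: "vanish n k f \<Longrightarrow> i < n \<Longrightarrow> j < n \<Longrightarrow> vanish n (Suc k) (\<lambda>A. coord n i j A * f A)"
| add: "vanish n k f \<Longrightarrow> vanish n k h \<Longrightarrow> vanish n k (\<lambda>A. f A + h A)"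

lemma poly_fun_coord: "i < n \<Longrightarrow> j < n \<Longrightarrow> coord n i j \<in> poly_fun n"
  unfolding coord_def[abs_def] by (intro poly_fun_diff poly_fun.intros)

lemma vanish_coord: "i < n \<Longrightarrow> j < n \<Longrightarrow> vanish n 1 (coord n i j)"
  using vanish.gen[OF vanish.base[OF poly_fun.const[of 1]], of i n j] by simp

lemma vanish_poly_fun: "vanish n k f \<Longrightarrow> f \<in> poly_fun n"
  by (induction rule: vanish.induct) (auto intro: poly_fun.intros poly_fun_coord)

lemma vanish_sum: "(\<And>x. x \<in> I \<Longrightarrow> vanish n k (f x)) \<Longrightarrow> vanish n k (\<lambda>A. \<Sum>x\<in>I. f x A)"
  by (induction I rule: infinite_finite_induct) (auto intro: vanish.zero vanish.add)

lemma vanish_mult_poly: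
  assumes "vanish n k f" "h \<in> poly_fun n"
  shows "vanish n k (\<lambda>A. f A * h A)"
  using assms(1)
proof induction
  case (base f)
  then show ?case using assms(2) by (intro vanish.base poly_fun.mult)
next
  case (gen k f i j)
  have "vanish n (Suc k) (\<lambda>A. coord n i j A * (f A * h A))"
    using gen by (intro vanish.gen)
  then show ?case by (simp only: mult.assoc)
next
  case (add k f g)
  then show ?case using vanish.add[OF add.IH] by (simp only: distrib_right)
qed (simp add: vanish.zero)

lemma vanish_cmult: "vanish n k f \<Longrightarrow> vanish n k (\<lambda>A. c * f A)"
  using vanish_mult_poly[OF _ poly_fun.const[of c], of n k f] by (simp only: mult.commute[of _ c])

lemma vanish_diff: "vanish n k f \<Longrightarrow> vanish n k h \<Longrightarrow> vanish n k (\<lambda>A. f A - h A)"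
  using vanish.add[OF _ vanish_cmult[of n k h "-1"]] by simp

lemma vanish_mult:
  assumes "vanish n k f" "vanish n l h"
  shows "vanish n (k + l) (\<lambda>A. f A * h A)"
  using assms(1)
proof induction
  case (base f)
  then show ?case using vanish_mult_poly[OF assms(2), of f] by (simp add: mult.commute)
next
  case (gen k f i j)
  have "vanish n (Suc (k + l)) (\<lambda>A. coord n i j A * (f A * h A))"
    using gen by (intro vanish.gen)
  then show ?case by (simp only: mult.assoc add_Suc)
next
  case (add k f g)
  then show ?case using vanish.add[OF add.IH] by (simp only: distrib_right)
qed (simp add: vanish.zero)

lemma vanish_Suc_at_one:
  assumes "vanish n (Suc k) f"
  shows "f (1\<^sub>m n) = 0"
proof -
  have "f (1\<^sub>m n) = 0" if "vanish n l f" "l \<noteq> 0" for l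
    using that by induction auto
  then show ?thesis using assms by blast
qed

text \<open>The entries of \<open>A - 1\<close> generate the whole ideal of functions vanishing at
  1. Products are handled by
  \<open>f h - f(1) h(1) = (f - f(1)) h + f(1) (h - h(1))\<close>.\<close>

lemma vanish_one:
  assumes "f \<in> poly_fun n"
  shows "vanish n 1 (\<lambda>A. f A - f (1\<^sub>m n))"
  using assms
proof induction
  case (const c)
  show ?case by (simp add: vanish.zero)
next
  case (entry i j)
  from vanish.gen[OF vanish.base[OF poly_fun.const[of 1]] this]
  have "vanish n 1 (\<lambda>A. coord n i j A * 1)" by simp
  then show ?case by (simp only: coord_def mult_1_right)
next
  case (add f h)
  then show ?case using vanish.add[OF add.IH] by (simp add: algebra_simps)
next
  case (mult f h)
  have "vanish n 1 (\<lambda>A. (f A - f (1\<^sub>m n)) * h A + f (1\<^sub>m n) * (h A - h (1\<^sub>m n)))"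
    using mult by (intro vanish.add vanish_mult_poly vanish_cmult)
  then show ?case by (simp add: algebra_simps)
qed

text \<open>The Rees ring of the ideal of the identity: the variable records the power in which a
  coefficient lies. Coefficients are multiplied pointwise as functions.\<close>

definition rees :: "nat \<Rightarrow> ('k::field mat \<Rightarrow> 'k) poly set" where
  "rees n = {Q. \<forall>j. vanish n j (poly.coeff Q j)}"

lemma is_subring_rees: "is_subring (rees n :: ('k::field mat \<Rightarrow> 'k) poly set)"
  unfolding is_subring_def
proof (intro conjI ballI)
  have "vanish n j (poly.coeff 1 j)" for j :: nat
    using vanish.base[OF poly_fun.const[of 1 n]] vanish.zero[of n j]
    by (cases "j = 0") (simp_all add: func_one func_zero)
  then show "1 \<in> rees n" unfolding rees_def by blast
  fix x y :: "('k mat \<Rightarrow> 'k) poly" assume "x \<in> rees n" "y \<in> rees n"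
  then have x: "vanish n j (poly.coeff x j)" and y: "vanish n j (poly.coeff y j)" for j by (auto simp: rees_def)
  have "vanish n j (poly.coeff (x - y) j)" for j
    using vanish_diff[OF x y] by (simp only: coeff_diff fun_diff_def)
  then show "x - y \<in> rees n" unfolding rees_def by blast
  have sum: "vanish n j (sum f I)" if "\<And>i. i \<in> I \<Longrightarrow> vanish n j (f i)" for j f and I :: "nat set"
    using that
  proof (induction I rule: infinite_finite_induct)
    case (insert i I)
    then have "vanish n j (\<lambda>A. f i A + sum f I A)" by (intro vanish.add) auto
    moreover have "sum f (insert i I) = (\<lambda>A. f i A + sum f I A)"
      using insert.hyps by (simp add: func_plus)
    ultimately show ?case by (simp only:)
  qed (use vanish.zero[of n j] in \<open>simp_all add: func_zero\<close>)
  have "vanish n j (poly.coeff x i * poly.coeff y (j - i))" if "i \<le> j" for i j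
    using vanish_mult[OF x[of i] y[of "j - i"]] that by (simp only: func_times le_add_diff_inverse)
  then have "vanish n j (poly.coeff (x * y) j)" for j
    unfolding coeff_mult by (rule sum) simp
  then show "x * y \<in> rees n" unfolding rees_def by blast
qed

definition const_polys :: "('k::field mat \<Rightarrow> 'k) poly set" where
  "const_polys = range (\<lambda>c. [:\<lambda>_. c:])"

lemma is_subring_const_polys: "is_subring (const_polys :: ('k::field mat \<Rightarrow> 'k) poly set)"
proof -
  have "1 = [:\<lambda>_::'k mat. 1::'k:]" by (simp add: one_pCons func_one)
  moreover have "[:\<lambda>_::'k mat. c:] - [:\<lambda>_. d:] = [:\<lambda>_. c - d:]" "[:\<lambda>_::'k mat. c:] * [:\<lambda>_. d:] = [:\<lambda>_. c * d:]"
    for c d :: 'k by (simp_all add: fun_diff_def func_times mult.commute)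
  ultimately show ?thesis unfolding is_subring_def const_polys_def by blast
qed

text \<open>The constants are a copy of the field. Either the first term is zero and lies in the
  ideal generated by nothing, or it is a unit and the second term is a multiple of it.\<close>

lemma noetherian_const_polys: "noetherian (const_polys :: ('k::field mat \<Rightarrow> 'k) poly set)"
  unfolding noetherian_def
proof (intro allI impI)
  fix f :: "nat \<Rightarrow> ('k mat \<Rightarrow> 'k) poly" assume f: "range f \<subseteq> const_polys"
  show "\<exists>n. f n \<in> gen_ideal const_polys (f ` {..<n})"
  proof (cases "f 0 = 0")
    case True
    then show ?thesis using gen_ideal.zero by metis
  next
    case False
    from f obtain c d where c: "f 0 = [:\<lambda>_. c:]" and d: "f 1 = [:\<lambda>_. d:]" unfolding const_polys_def by blast
    have "c \<noteq> 0" using False c by (auto simp: func_zero)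
    then have "f 1 = 0 + [:\<lambda>_. d / c:] * f 0" using c d by (simp add: func_times)
    also have "\<dots> \<in> gen_ideal const_polys (f ` {..<1})"
      by (intro gen_ideal.intros) (auto simp: const_polys_def)
    finally show ?thesis by blast
  qed
qed

definition rees_gens :: "nat \<Rightarrow> ('k::field mat \<Rightarrow> 'k) poly list" where
  "rees_gens n = map (\<lambda>(i, j). [:\<lambda>A. A $$ (i, j):]) (List.product [0..<n] [0..<n]) @
     map (\<lambda>(i, j). Polynomial.monom (coord n i j) 1) (List.product [0..<n] [0..<n])"

text \<open>Generated over the constants by the matrix entries in degree 0 and the entries of
  \<open>A - 1\<close> in degree 1, hence noetherian. It is contained in \<open>rees\<close> and
  contains its homogeneous elements; these two facts feed Krull's theorem.\<close>

definition rees_sub :: "nat \<Rightarrow> ('k::field mat \<Rightarrow> 'k) poly set" where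
  "rees_sub n = foldr adjoin (rees_gens n) const_polys"

lemma rees_sub: "is_subring (rees_sub n)" "noetherian (rees_sub n)" "const_polys \<union> set (rees_gens n) \<subseteq> rees_sub n"
  unfolding rees_sub_def by (rule foldr_adjoin[OF is_subring_const_polys noetherian_const_polys])+

lemma rees_gens_mem:
  assumes "i < n" "j < n"
  shows "[:\<lambda>A::'k::field mat. A $$ (i, j):] \<in> set (rees_gens n)" (is ?a)
    and "Polynomial.monom (coord n i j :: 'k::field mat \<Rightarrow> 'k) 1 \<in> set (rees_gens n)" (is ?b)
proof -
  have ij: "(i, j) \<in> set (List.product [0..<n] [0..<n])" using assms by simp
  show ?a ?b unfolding rees_gens_def set_append set_map
    using imageI[OF ij, of "\<lambda>(i, j). [:\<lambda>A::'k::field mat. A $$ (i, j):]"] imageI[OF ij, of "\<lambda>(i, j). Polynomial.monom (coord n i j :: 'k::field mat \<Rightarrow> 'k) 1"]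
    unfolding prod.case by (simp_all only: Un_iff simp_thms)
qed

lemma rees_sub_subset: "rees_sub n \<subseteq> (rees n :: ('k::field mat \<Rightarrow> 'k) poly set)"
  unfolding rees_sub_def
proof (rule foldr_adjoin_least[OF is_subring_rees])
  have c: "[:f:] \<in> rees n" if "f \<in> poly_fun n" for f :: "'k mat \<Rightarrow> 'k"
    unfolding rees_def
  proof safe
    fix j show "vanish n j (poly.coeff [:f:] j)"
      using vanish.base[OF that] vanish.zero[of n j] by (cases j) (simp_all add: func_zero)
  qed
  show "const_polys \<subseteq> (rees n :: ('k mat \<Rightarrow> 'k) poly set)" unfolding const_polys_def by (auto intro!: c poly_fun.const)
  have m: "Polynomial.monom (coord n i j) 1 \<in> (rees n :: ('k mat \<Rightarrow> 'k) poly set)" if "i < n" "j < n" for i j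
    unfolding rees_def
  proof safe
    fix l show "vanish n l (poly.coeff (Polynomial.monom (coord n i j :: 'k mat \<Rightarrow> 'k) 1) l)"
    proof (cases "l = 1")
      case True
      then show ?thesis using vanish_coord[OF that] by simp
    next
      case False
      then show ?thesis using vanish.zero[of n l] by (simp add: func_zero)
    qed
  qed
  show "set (rees_gens n) \<subseteq> (rees n :: ('k mat \<Rightarrow> 'k) poly set)"
    using m c[OF poly_fun.entry] by (auto simp: rees_gens_def)
qed

text \<open>The inductive construction of \<open>vanish\<close> is imitated in the subring:
  polynomial functions come from the generators of degree 0, and each coordinate factor is one
  generator of degree 1.\<close>

lemma monom_mem_rees_sub:
  fixes f :: "'k::field mat \<Rightarrow> 'k"
  assumes "vanish n k f"
  shows "Polynomial.monom f k \<in> rees_sub n"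
proof -
  note R = is_subringD[OF rees_sub(1)[of n]]
  note gens = rees_sub(3)[of n]
  have multm: "Polynomial.monom (\<lambda>A. f A * h A) (k + l) \<in> rees_sub n"
    if "Polynomial.monom f k \<in> rees_sub n" "Polynomial.monom h l \<in> rees_sub n" for f h :: "'k mat \<Rightarrow> 'k" and k l
    using R(4)[OF that] by (simp add: mult_monom func_times)
  have addm: "Polynomial.monom (\<lambda>A. f A + h A) k \<in> rees_sub n"
    if "Polynomial.monom f k \<in> rees_sub n" "Polynomial.monom h k \<in> rees_sub n" for f h :: "'k mat \<Rightarrow> 'k" and k
    using R(6)[OF that] by (simp add: add_monom func_plus)
  have poly: "Polynomial.monom f 0 \<in> rees_sub n" if "f \<in> poly_fun n" for f :: "'k mat \<Rightarrow> 'k"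
    using that
  proof induction
    case (const c)
    show ?case using gens by (auto simp: monom_0 const_polys_def)
  next
    case (entry i j)
    then show ?case using gens rees_gens_mem(1)[of i n j] by (auto simp: monom_0)
  next
    case (add f h)
    show ?case by (rule addm[OF add.IH])
  next
    case (mult f h)
    show ?case using multm[OF mult.IH] by simp
  qed
  show ?thesis using assms
  proof induction
    case (gen k f i j)
    have "Polynomial.monom (coord n i j) 1 \<in> rees_sub n"
      using gens rees_gens_mem(2)[OF gen.hyps(2,3)] by auto
    from multm[OF this gen.IH] show ?case by simp
  next
    case (zero k)
    show ?case using R(2) by (simp flip: func_zero)
  next
    case (base f)
    then show ?case by (rule poly)
  next
    case (add k f h)
    show ?case by (rule addm[OF add.IH])
  qed
qed

text \<open>The \<open>k\<close>-th power of the ideal of 1 as seen on \<open>Z\<close>, that is,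
  modulo functions vanishing on \<open>Z\<close>. Off \<open>Z\<close> nothing is asked of
  \<open>f\<close>.\<close>

definition vanish_on :: "nat \<Rightarrow> 'k::field mat set \<Rightarrow> nat \<Rightarrow> ('k mat \<Rightarrow> 'k) \<Rightarrow> bool" where
  "vanish_on n Z k f \<longleftrightarrow> (\<exists>g. vanish n k g \<and> (\<forall>A\<in>Z. f A = g A))"

text \<open>Perdry's proof of Krull's theorem: by noetherianity of the Rees ring, a representative of
  \<open>f\<close> in degree \<open>k\<close> is a combination of those in lower degrees with homogeneous coefficients of
  positive degree.\<close>

lemma krull:
  fixes f :: "'k::field mat \<Rightarrow> 'k"
  assumes "\<And>k. vanish_on n Z k f"
  shows "\<exists>a \<in> poly_fun n. a (1\<^sub>m n) = 0 \<and> (\<forall>A\<in>Z. f A = a A * f A)"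
proof -
  obtain g where g: "\<And>k. vanish n k (g k)" "\<And>k A. A \<in> Z \<Longrightarrow> f A = g k A"
    using assms unfolding vanish_on_def by metis
  define P where "P k = Polynomial.monom (g k) k" for k
  have "range P \<subseteq> rees_sub n" using monom_mem_rees_sub g(1) by (auto simp: P_def)
  then obtain k where k: "P k \<in> gen_ideal (rees_sub n) (P ` {..<k})"
    using rees_sub(2)[of n] unfolding noetherian_def by blast
  \<comment> \<open>Every representative \<open>g i\<close> restricts to \<open>f\<close> on
    \<open>Z\<close>, so the coefficient of degree \<open>k\<close> in a combination of the
    \<open>P i\<close> with \<open>i < k\<close> is a multiple of \<open>f\<close> there. The point
    is that the multiplier vanishes at 1.\<close>
  have "\<exists>a \<in> poly_fun n. a (1\<^sub>m n) = 0 \<and> (\<forall>A\<in>Z. poly.coeff Q k A = a A * f A)"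
    if "Q \<in> gen_ideal (rees_sub n) (P ` {..<k})" for Q
    using that
  proof induction
    case zero
    show ?case by (intro bexI[of _ "\<lambda>_. 0"]) (auto simp: poly_fun.const)
  next
    case (step Q S p)
    then obtain a i where a: "a \<in> poly_fun n" "a (1\<^sub>m n) = 0" "\<And>A. A \<in> Z \<Longrightarrow> poly.coeff Q k A = a A * f A"
      and i: "i < k" "p = P i" by blast
    define b where "b = poly.coeff S (k - i)"
    have "S \<in> rees n" using rees_sub_subset step.hyps(2) by blast
    then have "vanish n (k - i) b" by (simp add: rees_def b_def)
    \<comment> \<open>The multiplier contributed by \<open>P i\<close> is homogeneous of degree
      \<open>k - i\<close>; this is at least 1, so it vanishes at the identity.\<close>
    moreover have "k - i = Suc (k - i - 1)" using i by simp
    ultimately have b: "vanish n (Suc (k - i - 1)) b" by metis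
    have "poly.coeff (S * p) k = b * g i"
      using i coeff_monom_mult[of "g i" i S k] by (simp add: P_def b_def mult.commute[of S] mult.commute[of "g i"])
    then have "poly.coeff (Q + S * p) k A = (a A + b A) * f A" if "A \<in> Z" for A
      using a(3)[OF that] g(2)[OF that, of i] by (simp add: algebra_simps)
    then show ?case using a vanish_poly_fun[OF b] vanish_Suc_at_one[OF b]
      by (intro bexI[of _ "\<lambda>A. a A + b A"]) (auto intro: poly_fun.add)
  qed
  then obtain a where "a \<in> poly_fun n" "a (1\<^sub>m n) = 0" "\<And>A. A \<in> Z \<Longrightarrow> poly.coeff (P k) k A = a A * f A"
    using k by blast
  then show ?thesis using g(2)[of _ k] by (intro bexI[of _ a]) (auto simp: P_def)
qed

section \<open>Matrix groups, the adjoint action and Lie algebras\<close>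

lemma GL_iff: "A \<in> carrier (GL n) \<longleftrightarrow> A \<in> carrier_mat n n \<and> det A \<noteq> 0"
proof
  assume "A \<in> carrier (GL n)"
  then have A: "A \<in> Units (ring_mat TYPE('a) n ())" by (simp add: units_of_carrier)
  then have "A \<in> carrier_mat n n" by (auto simp: Units_def ring_mat_simps)
  then show "A \<in> carrier_mat n n \<and> det A \<noteq> 0" using unit_imp_det_non_zero[OF A] by simp
qed (use det_non_zero_imp_unit[of A n "()"] in \<open>simp add: units_of_carrier\<close>)

lemma GL_simps: "mult (GL n) = (*)" "one (GL n) = 1\<^sub>m n"
  by (auto simp: units_of_mult units_of_one ring_mat_simps)

lemma group_GL: "group (GL n :: 'k::field mat monoid)"
proof -
  interpret ring "ring_mat TYPE('k) n ()" by (rule ring_mat)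
  show ?thesis by (rule units_group)
qed

abbreviation GL_inv :: "nat \<Rightarrow> 'k::field mat \<Rightarrow> 'k mat" where
  "GL_inv n a \<equiv> inv\<^bsub>GL n\<^esub> a"

lemma GL_inv:
  assumes "a \<in> carrier (GL n)"
  shows "GL_inv n a \<in> carrier (GL n)" "GL_inv n a \<in> carrier_mat n n" "a * GL_inv n a = 1\<^sub>m n" "GL_inv n a * a = 1\<^sub>m n"
    "det a \<cdot>\<^sub>m GL_inv n a = adj_mat a"
proof -
  interpret group "GL n :: 'a mat monoid" by (rule group_GL)
  show 1: "GL_inv n a \<in> carrier (GL n)" using assms by simp
  then show 2: "GL_inv n a \<in> carrier_mat n n" by (simp add: GL_iff)
  show 3: "a * GL_inv n a = 1\<^sub>m n" "GL_inv n a * a = 1\<^sub>m n"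
    using r_inv[OF assms] l_inv[OF assms] by (simp_all add: GL_simps)
  have a: "a \<in> carrier_mat n n" using assms by (simp add: GL_iff)
  have "GL_inv n a * (a * adj_mat a) = GL_inv n a * (det a \<cdot>\<^sub>m 1\<^sub>m n)" using adj_mat[OF a] by simp
  then have "(GL_inv n a * a) * adj_mat a = det a \<cdot>\<^sub>m GL_inv n a"
    using a 2 adj_mat(1)[OF a] by (simp add: mult_smult_distrib[of _ n n _ n])
  then show "det a \<cdot>\<^sub>m GL_inv n a = adj_mat a" using adj_mat(1)[OF a] by (simp add: 3)
qed

lemma GL_carrier: "a \<in> carrier (GL n) \<Longrightarrow> a \<in> carrier_mat n n"
  by (simp add: GL_iff)

lemma mat_assoc4:
  assumes "a \<in> carrier_mat n n" "b \<in> carrier_mat n n" "c \<in> carrier_mat n n" "d \<in> carrier_mat n n"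
  shows "a * b * (c * d) = a * (b * c) * d"
  using assms by (simp add: assoc_mult_mat[of _ n n _ n _ n])

context
  fixes n :: nat and a :: "'k::field mat"
  assumes a: "a \<in> carrier (GL n)"
begin

lemma Ad_carrier: "x \<in> carrier_mat n n \<Longrightarrow> Ad n a x \<in> carrier_mat n n"
  using GL_carrier[OF a] GL_inv(2)[OF a] by (simp add: Ad_def)

lemma Ad_add: "x \<in> carrier_mat n n \<Longrightarrow> y \<in> carrier_mat n n \<Longrightarrow> Ad n a (x + y) = Ad n a x + Ad n a y"
  using GL_carrier[OF a] GL_inv(2)[OF a]
  by (simp add: Ad_def mult_add_distrib_mat[of _ n n] add_mult_distrib_mat[of _ n n _ _ n])

lemma Ad_smult: "x \<in> carrier_mat n n \<Longrightarrow> Ad n a (c \<cdot>\<^sub>m x) = c \<cdot>\<^sub>m Ad n a x"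
  using GL_carrier[OF a] GL_inv(2)[OF a]
  by (simp add: Ad_def mult_smult_distrib[of _ n n _ n] mult_smult_assoc_mat[of _ n n _ n])

lemma Ad_mult:
  assumes "x \<in> carrier_mat n n" "y \<in> carrier_mat n n"
  shows "Ad n a (x * y) = Ad n a x * Ad n a y"
proof -
  note c = GL_carrier[OF a] GL_inv(2)[OF a] assms
  have "Ad n a x * Ad n a y = a * x * (GL_inv n a * a) * (y * GL_inv n a)"
    unfolding Ad_def using c by (simp add: assoc_mult_mat[of _ n n _ n _ n])
  also have "\<dots> = Ad n a (x * y)"
    unfolding Ad_def GL_inv(4)[OF a] using c by (simp add: assoc_mult_mat[of _ n n _ n _ n])
  finally show ?thesis by simp
qed

lemma Ad_minus:
  assumes "x \<in> carrier_mat n n" "y \<in> carrier_mat n n"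
  shows "Ad n a (x - y) = Ad n a x - Ad n a y"
  using GL_carrier[OF a] GL_inv(2)[OF a] assms
  by (simp add: Ad_def mult_minus_distrib_mat[of _ n n] minus_mult_distrib_mat[of _ n n _ _ n])

lemma Ad_bracket:
  assumes "x \<in> carrier_mat n n" "y \<in> carrier_mat n n"
  shows "Ad n a (bracket x y) = bracket (Ad n a x) (Ad n a y)"
  using assms by (simp add: bracket_def Ad_minus Ad_mult)

lemma Ad_zero: "Ad n a (0\<^sub>m n n) = 0\<^sub>m n n"
  using GL_carrier[OF a] GL_inv(2)[OF a] by (simp add: Ad_def)

text \<open>Clears the denominator of conjugation: the left side is polynomial in the entries of
  \<open>a\<close>.\<close>

lemma Ad_adj: "x \<in> carrier_mat n n \<Longrightarrow> a * x * adj_mat a = det a \<cdot>\<^sub>m Ad n a x"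
  using GL_carrier[OF a] GL_inv(2)[OF a] GL_inv(5)[OF a, symmetric]
  by (simp add: Ad_def mult_smult_distrib[of _ n n _ n])

lemma Ad_comp:
  assumes b: "b \<in> carrier (GL n)" and x: "x \<in> carrier_mat n n"
  shows "Ad n (a * b) x = Ad n a (Ad n b x)"
proof -
  interpret group "GL n :: 'k mat monoid" by (rule group_GL)
  have "GL_inv n (a * b) = GL_inv n b * GL_inv n a" using inv_mult_group[OF a b] by (simp add: GL_simps)
  then show ?thesis using GL_carrier[OF a] GL_inv(2)[OF a] GL_carrier[OF b] GL_inv(2)[OF b] x
    by (simp add: Ad_def assoc_mult_mat[of _ n n _ n _ n])
qed

end

lemma Ad_inverse:
  fixes a :: "'k::field mat"
  assumes a: "a \<in> carrier (GL n)" and x: "x \<in> carrier_mat n n"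
  shows "Ad n (GL_inv n a) (Ad n a x) = x" "Ad n a (Ad n (GL_inv n a) x) = x"
proof -
  interpret group "GL n :: 'k mat monoid" by (rule group_GL)
  have "Ad n (1\<^sub>m n) x = x" using x inv_one by (simp add: Ad_def GL_simps)
  then show "Ad n (GL_inv n a) (Ad n a x) = x" "Ad n a (Ad n (GL_inv n a) x) = x"
    using Ad_comp[OF a GL_inv(1)[OF a] x] Ad_comp[OF GL_inv(1)[OF a] a x] GL_inv[OF a] by simp_all
qed

context
  fixes n :: nat and G :: "'k::field mat set"
  assumes G: "subgroup G (GL n)"
begin

lemma subgroup_GL:
  shows "a \<in> G \<Longrightarrow> a \<in> carrier (GL n)" "1\<^sub>m n \<in> G" "a \<in> G \<Longrightarrow> b \<in> G \<Longrightarrow> a * b \<in> G" "a \<in> G \<Longrightarrow> GL_inv n a \<in> G"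
proof -
  interpret group "GL n :: 'k mat monoid" by (rule group_GL)
  show "a \<in> G \<Longrightarrow> a \<in> carrier (GL n)" using subgroup.mem_carrier[OF G] .
  show "1\<^sub>m n \<in> G" "a \<in> G \<Longrightarrow> b \<in> G \<Longrightarrow> a * b \<in> G" "a \<in> G \<Longrightarrow> GL_inv n a \<in> G"
    using subgroup.one_closed[OF G] subgroup.m_closed[OF G, of a b] subgroup.m_inv_closed[OF G, of a]
    by (simp_all add: GL_simps)
qed

end

section \<open>Tangent vectors and first-order expansions at the identity\<close>

lemma Lie_iff:
  fixes G :: "'k::field_char_0 mat set"
  shows "X \<in> Lie n G \<longleftrightarrow> X \<in> carrier_mat n n \<and> (\<forall>f \<in> poly_fun n. (\<forall>a\<in>G. f a = 0) \<longrightarrow> ddir f (1\<^sub>m n) X = 0)"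
proof (cases "X \<in> carrier_mat n n")
  case True
  have "(\<exists>q. (\<forall>s. f (1\<^sub>m n + s \<cdot>\<^sub>m X) = poly q s) \<and> poly.coeff q 1 = 0) \<longleftrightarrow> ddir f (1\<^sub>m n) X = 0"
    if "f \<in> poly_fun n" for f
    using poly_fun_along_line[OF that one_carrier_mat True] ddirI[of f "1\<^sub>m n" X] by metis
  then show ?thesis using True by (auto simp: Lie_def)
qed (auto simp: Lie_def)

lemma Lie_carrier: "X \<in> Lie n G \<Longrightarrow> X \<in> carrier_mat n n"
  by (simp add: Lie_def)

lemma Lie_mono: "G \<subseteq> H \<Longrightarrow> Lie n G \<subseteq> Lie n H"
  unfolding Lie_def by blast

lemma sum_linear_combination:
  fixes u w :: "'a::comm_ring_1"
  shows "(\<Sum>x\<in>I. (d x * w + u * e x) * F x) = (\<Sum>x\<in>I. d x * F x) * w + u * (\<Sum>x\<in>I. e x * F x)"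
  by (induction I rule: infinite_finite_induct) (simp_all add: algebra_simps)

text \<open>The first-order Taylor remainder of a product: \<open>u\<close>, \<open>w\<close> are
  the values at the identity and \<open>l\<close>, \<open>m\<close> the linear parts of the factors
  \<open>x\<close>, \<open>y\<close>.\<close>

lemma product_expansion:
  fixes x y u w l m :: "'a::comm_ring_1"
  shows "(x - u - l) * y + u * (y - w - m) + l * (y - w) = x * y - u * w - (l * w + u * m)"
  by (simp add: algebra_simps)

text \<open>First-order Taylor expansion at 1, following the construction of \<open>f\<close>. One
  array \<open>d\<close> is both the gradient, giving the derivative in every direction, and the
  linear part, leaving a remainder of order 2. Its support condition fits
  \<open>annihilator_of_functionals\<close>.\<close>

lemma ddir_pairing_ex:
  fixes f :: "'k::field_char_0 mat \<Rightarrow> 'k"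
  assumes "f \<in> poly_fun n"
  shows "\<exists>d. (\<forall>ij. ij \<notin> {..<n}\<times>{..<n} \<longrightarrow> d ij = 0) \<and>
     (\<forall>X\<in>carrier_mat n n. ddir f (1\<^sub>m n) X = pairing n d X) \<and>
     vanish n 2 (\<lambda>A. f A - f (1\<^sub>m n) - (\<Sum>ij\<in>{..<n}\<times>{..<n}. d ij * coord n (fst ij) (snd ij) A))"
    (is "\<exists>d. ?P f d")
proof -
  have lin: "vanish n 1 (\<lambda>A. \<Sum>ij\<in>{..<n}\<times>{..<n}. d ij * coord n (fst ij) (snd ij) A)" for d :: "nat \<times> nat \<Rightarrow> 'k"
    by (intro vanish_sum vanish_cmult vanish_coord) auto
  show ?thesis using assms
  proof induction
    case (const c)
    show ?case by (rule exI[of _ "\<lambda>_. 0"]) (simp add: pairing_def vanish.zero)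
  next
    case (entry i j)
    let ?d = "\<lambda>ij. if ij = (i, j) then 1 else 0 :: 'k"
    have "(\<Sum>ij\<in>{..<n}\<times>{..<n}. ?d ij * F ij) = F (i, j)" for F
      using entry by (simp add: sum.delta if_distrib[of "\<lambda>x. x * _"] cong: if_cong)
    then show ?case using entry
      by (intro exI[of _ ?d]) (auto simp: pairing_def ddir_entry[OF one_carrier_mat] coord_def vanish.zero)
  next
    case (add f h)
    from add.IH(1) obtain d where d: "?P f d" by (elim exE)
    from add.IH(2) obtain e where e: "?P h e" by (elim exE)
    have P: "?P (\<lambda>A. f A + h A) (\<lambda>ij. d ij + e ij)"
    proof (intro conjI)
      show "\<forall>X\<in>carrier_mat n n. ddir (\<lambda>A. f A + h A) (1\<^sub>m n) X = pairing n (\<lambda>ij. d ij + e ij) X"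
        using d e add.hyps by (auto simp: ddir_add[OF one_carrier_mat] pairing_def sum.distrib distrib_right)
      show "vanish n 2 (\<lambda>A. f A + h A - (f (1\<^sub>m n) + h (1\<^sub>m n)) -
          (\<Sum>ij\<in>{..<n}\<times>{..<n}. (d ij + e ij) * coord n (fst ij) (snd ij) A))"
        using vanish.add[OF d[THEN conjunct2, THEN conjunct2] e[THEN conjunct2, THEN conjunct2]]
        by (simp add: sum.distrib algebra_simps)
    qed (use d e in auto)
    show ?case by (rule exI[of _ "\<lambda>ij. d ij + e ij"]) (rule P)
  next
    case (mult f h)
    from mult.IH(1) obtain d where d: "?P f d" by (elim exE)
    from mult.IH(2) obtain e where e: "?P h e" by (elim exE)
    let ?L = "\<lambda>d A. \<Sum>ij\<in>{..<n}\<times>{..<n}. d ij * coord n (fst ij) (snd ij) A"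
    let ?u = "f (1\<^sub>m n)" and ?w = "h (1\<^sub>m n)"
    let ?g = "\<lambda>ij. d ij * ?w + ?u * e ij"
    have mix: "(\<Sum>ij\<in>I. ?g ij * F ij) = (\<Sum>ij\<in>I. d ij * F ij) * ?w + ?u * (\<Sum>ij\<in>I. e ij * F ij)"
      for I :: "(nat \<times> nat) set" and F :: "nat \<times> nat \<Rightarrow> 'k"
      by (rule sum_linear_combination)
    have L: "?L ?g A = ?L d A * ?w + ?u * ?L e A" for A by (rule mix)
    have P: "?P (\<lambda>A. f A * h A) ?g"
    proof (intro conjI)
      show "\<forall>X\<in>carrier_mat n n. ddir (\<lambda>A. f A * h A) (1\<^sub>m n) X = pairing n ?g X"
      proof
        fix X :: "'k mat" assume X: "X \<in> carrier_mat n n"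
        have "ddir f (1\<^sub>m n) X = pairing n d X" "ddir h (1\<^sub>m n) X = pairing n e X" using d e X by blast+
        then show "ddir (\<lambda>A. f A * h A) (1\<^sub>m n) X = pairing n ?g X"
          using ddir_mult[OF one_carrier_mat X mult.hyps] unfolding pairing_def mix by simp
      qed
      have "vanish n 2 (\<lambda>A. (f A - ?u - ?L d A) * h A + ?u * (h A - ?w - ?L e A))"
        using d e mult.hyps by (intro vanish.add vanish_mult_poly vanish_cmult) auto
      moreover have "vanish n 2 (\<lambda>A. ?L d A * (h A - ?w))"
        using vanish_mult[OF lin vanish_one[OF mult.hyps(2)]] by (simp add: numeral_2_eq_2)
      ultimately have "vanish n 2 (\<lambda>A. (f A - ?u - ?L d A) * h A + ?u * (h A - ?w - ?L e A) + ?L d A * (h A - ?w))"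
        by (rule vanish.add)
      moreover have "(f A - ?u - ?L d A) * h A + ?u * (h A - ?w - ?L e A) + ?L d A * (h A - ?w)
          = f A * h A - ?u * ?w - ?L ?g A" for A
        unfolding L by (rule product_expansion)
      ultimately show "vanish n 2 (\<lambda>A. f A * h A - ?u * ?w - ?L ?g A)" by (simp only:)
    qed (use d e in auto)
    show ?case by (rule exI[of _ ?g]) (rule P)
  qed
qed

lemma mat_subspace_Lie:
  fixes G :: "'k::field_char_0 mat set"
  shows "mat_subspace n (Lie n G)"
proof -
  have lin: "ddir f (1\<^sub>m n) (0\<^sub>m n n) = 0"
    "\<And>X Y. X \<in> carrier_mat n n \<Longrightarrow> Y \<in> carrier_mat n n \<Longrightarrow> ddir f (1\<^sub>m n) (X + Y) = ddir f (1\<^sub>m n) X + ddir f (1\<^sub>m n) Y"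
    "\<And>X c. X \<in> carrier_mat n n \<Longrightarrow> ddir f (1\<^sub>m n) (c \<cdot>\<^sub>m X) = c * ddir f (1\<^sub>m n) X"
    if f: "f \<in> poly_fun n" for f :: "'k mat \<Rightarrow> 'k"
  proof -
    obtain d where d: "\<And>X. X \<in> carrier_mat n n \<Longrightarrow> ddir f (1\<^sub>m n) X = pairing n d X"
      using ddir_pairing_ex[OF f] by blast
    have "pairing n d (0\<^sub>m n n) = 0" unfolding pairing_def by (intro sum.neutral) auto
    then show "ddir f (1\<^sub>m n) (0\<^sub>m n n) = 0" using d by simp
    show "ddir f (1\<^sub>m n) (X + Y) = ddir f (1\<^sub>m n) X + ddir f (1\<^sub>m n) Y"
      if "X \<in> carrier_mat n n" "Y \<in> carrier_mat n n" for X Y using d that by (simp add: pairing_add)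
    show "ddir f (1\<^sub>m n) (c \<cdot>\<^sub>m X) = c * ddir f (1\<^sub>m n) X"
      if "X \<in> carrier_mat n n" for X c using d that by (simp add: pairing_smult)
  qed
  show ?thesis unfolding mat_subspace_def by (auto simp: Lie_iff lin)
qed

lemma poly_fun_translate:
  assumes "f \<in> poly_fun n" "a \<in> carrier_mat n n"
  shows "(\<lambda>A. f (a * cut n A)) \<in> poly_fun n"
  by (rule poly_fun_compose[OF assms(1) poly_mat_mult[OF poly_mat_const[OF assms(2)] poly_mat_cut]])

text \<open>Left translation by \<open>a\<close> maps equations of \<open>G\<close> to equations of
  \<open>G\<close>, so the tangency condition at 1 in direction \<open>X\<close> moves to
  \<open>a\<close> in direction \<open>a * X\<close>.\<close>

lemma ddir_left_invariant:
  fixes G :: "'k::field_char_0 mat set"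
  assumes G: "subgroup G (GL n)" and X: "X \<in> Lie n G" and f: "f \<in> poly_fun n" "\<And>A. A \<in> G \<Longrightarrow> f A = 0"
    and a: "a \<in> G"
  shows "ddir f a (a * X) = 0"
proof -
  have ac: "a \<in> carrier_mat n n" using GL_carrier[OF subgroup_GL(1)[OF G a]] .
  have Xc: "X \<in> carrier_mat n n" using Lie_carrier[OF X] .
  let ?F = "\<lambda>A. f (a * cut n A)"
  have "?F A = 0" if "A \<in> G" for A
    using f(2)[OF subgroup_GL(3)[OF G a that]] GL_carrier[OF subgroup_GL(1)[OF G that]] by simp
  then have z: "ddir ?F (1\<^sub>m n) X = 0" using X poly_fun_translate[OF f(1) ac] by (simp add: Lie_iff)
  obtain q where q: "\<And>s. f (a + s \<cdot>\<^sub>m (a * X)) = poly q s" "poly.coeff q 1 = ddir f a (a * X)"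
    using poly_fun_along_line[OF f(1) ac, of "a * X"] ac Xc by auto
  have "?F (1\<^sub>m n + s \<cdot>\<^sub>m X) = poly q s" for s
  proof -
    have "a * (1\<^sub>m n + s \<cdot>\<^sub>m X) = a + s \<cdot>\<^sub>m (a * X)"
      using ac Xc by (subst mult_add_distrib_mat[of _ n n]) (auto simp: mult_smult_distrib[of _ n n _ n])
    then show ?thesis using q(1)[of s] ac Xc by simp
  qed
  from ddirI[of ?F, OF this] show ?thesis using z q(2) by simp
qed

text \<open>The left invariant vector field of \<open>X\<close> has coefficients linear in
  \<open>A\<close>, so it acts on polynomial functions.\<close>

lemma poly_fun_derivation:
  fixes f :: "'k::field_char_0 mat \<Rightarrow> 'k"
  assumes "f \<in> poly_fun n" and X: "X \<in> carrier_mat n n"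
  shows "(\<lambda>A. ddir f (cut n A) (cut n A * X)) \<in> poly_fun n"
  using assms(1)
proof induction
  case (const c)
  show ?case by (simp add: poly_fun.const)
next
  case (entry i j)
  have "(\<lambda>A. (cut n A * X) $$ (i, j)) \<in> poly_fun n"
    by (rule poly_matD(2)[OF poly_mat_mult[OF poly_mat_cut poly_mat_const[OF X]] entry])
  moreover have "ddir (\<lambda>A. A $$ (i, j)) (cut n A) (cut n A * X) = (cut n A * X) $$ (i, j)" for A
    using X by (intro ddir_entry[OF _ _ entry]) auto
  ultimately show ?case by (simp only:)
next
  case (add f h)
  then have "(\<lambda>A. ddir f (cut n A) (cut n A * X) + ddir h (cut n A) (cut n A * X)) \<in> poly_fun n"
    by (intro poly_fun.add)
  moreover have "ddir (\<lambda>A. f A + h A) (cut n A) (cut n A * X) = ddir f (cut n A) (cut n A * X) + ddir h (cut n A) (cut n A * X)" for A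
    using X by (intro ddir_add[OF _ _ add.hyps]) auto
  ultimately show ?case by (simp only:)
next
  case (mult f h)
  have "(\<lambda>A. ddir f (cut n A) (cut n A * X) * h A + f A * ddir h (cut n A) (cut n A * X)) \<in> poly_fun n"
    using mult by (intro poly_fun.add poly_fun.mult)
  moreover have "ddir (\<lambda>A. f A * h A) (cut n A) (cut n A * X)
      = ddir f (cut n A) (cut n A * X) * h A + f A * ddir h (cut n A) (cut n A * X)" for A
    using ddir_mult[OF cut_carrier(1) mult_carrier_mat[OF cut_carrier(1) X] mult.hyps, of A] by (simp add: poly_fun_cut[OF mult.hyps(1)] poly_fun_cut[OF mult.hyps(2)])
  ultimately show ?case by (simp only:)
qed

lemma vanish_onI: "vanish n k f \<Longrightarrow> vanish_on n Z k f"
  unfolding vanish_on_def by blast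

lemma vanish_on_cong: "vanish_on n Z k f \<Longrightarrow> (\<And>A. A \<in> Z \<Longrightarrow> f A = g A) \<Longrightarrow> vanish_on n Z k g"
  unfolding vanish_on_def by auto

lemma vanish_on_add:
  assumes "vanish_on n Z k f" "vanish_on n Z k h"
  shows "vanish_on n Z k (\<lambda>A. f A + h A)"
proof -
  obtain a b where "vanish n k a" "\<And>A. A \<in> Z \<Longrightarrow> f A = a A" "vanish n k b" "\<And>A. A \<in> Z \<Longrightarrow> h A = b A"
    using assms unfolding vanish_on_def by blast
  then show ?thesis using vanish_on_cong[OF vanish_onI[OF vanish.add, of n k a b Z]] by simp
qed

lemma vanish_on_mult:
  assumes "vanish_on n Z k f" "vanish_on n Z l h"
  shows "vanish_on n Z (k + l) (\<lambda>A. f A * h A)"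
proof -
  obtain a b where "vanish n k a" "\<And>A. A \<in> Z \<Longrightarrow> f A = a A" "vanish n l b" "\<And>A. A \<in> Z \<Longrightarrow> h A = b A"
    using assms unfolding vanish_on_def by blast
  then show ?thesis using vanish_on_cong[OF vanish_onI[OF vanish_mult, of n k a l b Z]] by simp
qed

lemma vanish_on_cmult: "vanish_on n Z k f \<Longrightarrow> vanish_on n Z k (\<lambda>A. c * f A)"
  using vanish_on_mult[OF vanish_onI[OF vanish.base[OF poly_fun.const[of c]]]] by simp

lemma vanish_on_sum: "(\<And>x. x \<in> I \<Longrightarrow> vanish_on n Z k (f x)) \<Longrightarrow> vanish_on n Z k (\<lambda>A. \<Sum>x\<in>I. f x A)"
  by (induction I rule: infinite_finite_induct) (auto intro: vanish_onI vanish.zero vanish_on_add)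

text \<open>The functional \<open>d\<close> evaluated at \<open>A - 1\<close>: the function
  counterpart of \<open>pairing\<close>.\<close>

definition lincoord :: "nat \<Rightarrow> (nat \<times> nat \<Rightarrow> 'k) \<Rightarrow> 'k::field mat \<Rightarrow> 'k" where
  "lincoord n d A = (\<Sum>ij\<in>{..<n}\<times>{..<n}. d ij * coord n (fst ij) (snd ij) A)"

lemma vanish_lincoord: "vanish n 1 (lincoord n d)"
  unfolding lincoord_def[abs_def] by (intro vanish_sum vanish_cmult vanish_coord) auto

section \<open>Connected groups are determined by their derivations\<close>

text \<open>A vector field meant for \<open>B\<close> spanning the Lie algebra and
  \<open>\<phi>\<close> giving coefficients in \<open>B\<close>: the left invariant derivation of
  \<open>b\<close> is weighted with \<open>\<phi> b (A - 1)\<close>. On tangent directions at 1 this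
  agrees to first order with the radial field \<open>A - 1\<close>.\<close>

definition euler :: "nat \<Rightarrow> (nat \<times> nat \<Rightarrow> 'k) set \<Rightarrow> ((nat \<times> nat \<Rightarrow> 'k) \<Rightarrow> nat \<times> nat \<Rightarrow> 'k) \<Rightarrow>
    ('k::field mat \<Rightarrow> 'k) \<Rightarrow> 'k mat \<Rightarrow> 'k" where
  "euler n B \<phi> f A = (\<Sum>b\<in>B. lincoord n (\<phi> b) A * ddir f (cut n A) (cut n A * mat n n b))"

lemma euler_add:
  fixes f :: "'k::field_char_0 mat \<Rightarrow> 'k"
  assumes "f \<in> poly_fun n" "h \<in> poly_fun n"
  shows "euler n B \<phi> (\<lambda>A. f A + h A) A = euler n B \<phi> f A + euler n B \<phi> h A"
proof -
  have "ddir (\<lambda>A. f A + h A) (cut n A) (cut n A * mat n n b)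
     = ddir f (cut n A) (cut n A * mat n n b) + ddir h (cut n A) (cut n A * mat n n b)" for b
    by (rule ddir_add[OF _ _ assms]) auto
  then show ?thesis by (simp add: euler_def distrib_left sum.distrib)
qed

lemma euler_cmult:
  fixes f :: "'k::field_char_0 mat \<Rightarrow> 'k"
  assumes "f \<in> poly_fun n"
  shows "euler n B \<phi> (\<lambda>A. c * f A) A = c * euler n B \<phi> f A"
proof -
  have "ddir (\<lambda>A. c * f A) (cut n A) (cut n A * mat n n b)
     = c * ddir f (cut n A) (cut n A * mat n n b)" for b
    by (rule ddir_cmult[OF _ _ assms]) auto
  then show ?thesis by (simp add: euler_def sum_distrib_left mult.left_commute)
qed

lemma euler_mult:
  fixes f :: "'k::field_char_0 mat \<Rightarrow> 'k"
  assumes "f \<in> poly_fun n" "h \<in> poly_fun n"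
  shows "euler n B \<phi> (\<lambda>A. f A * h A) A = euler n B \<phi> f A * h A + f A * euler n B \<phi> h A"
proof -
  have "ddir (\<lambda>A. f A * h A) (cut n A) (cut n A * mat n n b)
     = ddir f (cut n A) (cut n A * mat n n b) * h A + f A * ddir h (cut n A) (cut n A * mat n n b)" for b
    using ddir_mult[OF cut_carrier(1)[of n A] mult_carrier_mat[OF cut_carrier(1)[of n A] mat_carrier[of n n b]] assms]
    by (simp add: poly_fun_cut[OF assms(1)] poly_fun_cut[OF assms(2)])
  then show ?thesis by (simp add: euler_def sum.distrib sum_distrib_left sum_distrib_right algebra_simps)
qed

lemma euler_vanish_one:
  fixes f :: "'k::field_char_0 mat \<Rightarrow> 'k"
  assumes "f \<in> poly_fun n"
  shows "vanish n 1 (euler n B \<phi> f)"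
  unfolding euler_def[abs_def]
  by (intro vanish_sum vanish_mult_poly vanish_lincoord poly_fun_derivation[OF assms]) auto

lemma ddir_coord:
  fixes A X :: "'k::field_char_0 mat"
  assumes "A \<in> carrier_mat n n" "X \<in> carrier_mat n n" "p < n" "q < n"
  shows "ddir (coord n p q) A X = X $$ (p, q)"
proof -
  have "coord n p q = (\<lambda>A. A $$ (p, q) + (- (1\<^sub>m n $$ (p, q) :: 'k)))"
    by (simp add: coord_def[abs_def])
  then show ?thesis
    using ddir_add[OF assms(1,2) poly_fun.entry[OF assms(3,4)] poly_fun.const[of "- (1\<^sub>m n $$ (p, q))"]]
      ddir_entry[OF assms] by simp
qed

lemma lincoord_add: "lincoord n (d + e) A = lincoord n d A + lincoord n e A"
  by (simp add: lincoord_def distrib_right sum.distrib)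

lemma lincoord_cmult: "lincoord n (\<lambda>ij. c * d ij) A = c * lincoord n d A"
  by (simp add: lincoord_def sum_distrib_left mult.assoc)

lemma pairing_fun_add: "pairing n (d + e) X = pairing n d X + pairing n e X"
  by (simp add: pairing_def distrib_right sum.distrib)

lemma pairing_fun_cmult: "pairing n (\<lambda>ij. c * d ij) X = c * pairing n d X"
  by (simp add: pairing_def sum_distrib_left mult.assoc)

text \<open>The functionals vanishing on the Lie algebra are the linear parts at the identity of the
  equations of the group.\<close>

lemma lincoord_vanish_on:
  fixes G :: "'k::field_char_0 mat set"
  assumes G: "1\<^sub>m n \<in> G" and \<mu>: "\<And>ij. ij \<notin> {..<n} \<times> {..<n} \<Longrightarrow> \<mu> ij = 0"
    and ann: "\<And>X. X \<in> Lie n G \<Longrightarrow> pairing n \<mu> X = 0"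
  shows "vanish_on n G 2 (lincoord n \<mu>)"
proof -
  let ?P = "\<lambda>d f. f \<in> poly_fun n \<and> (\<forall>A\<in>G. f A = 0) \<and>
     (\<forall>X\<in>carrier_mat n n. ddir f (1\<^sub>m n) X = pairing n d X) \<and> vanish n 2 (\<lambda>A. f A - lincoord n d A)"
  \<comment> \<open>The functionals that occur as linear part of an equation of \<open>G\<close>.
    They form a subspace whose common zeros are tangent vectors, so the double annihilator theorem
    puts \<open>\<mu>\<close> into it.\<close>
  define W where "W = {d. (\<forall>ij. ij \<notin> {..<n} \<times> {..<n} \<longrightarrow> d ij = 0) \<and> (\<exists>f. ?P d f)}"
  have "\<mu> \<in> W"
  proof (rule annihilator_of_functionals[of W n \<mu>])
    show "f ij = 0" if "f \<in> W" "ij \<notin> {..<n} \<times> {..<n}" for f ij using that unfolding W_def by blast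
    have "?P 0 (\<lambda>_. 0)" by (simp add: poly_fun.const pairing_def lincoord_def vanish.zero)
    then show "0 \<in> W" unfolding W_def by auto
    show "d + e \<in> W" if "d \<in> W" "e \<in> W" for d e
    proof -
      from that(1) have "\<exists>f. ?P d f" unfolding W_def by blast
      then obtain f where f: "?P d f" by (elim exE)
      from that(2) have "\<exists>f. ?P e f" unfolding W_def by blast
      then obtain h where h: "?P e h" by (elim exE)
      have "vanish n 2 (\<lambda>A. (f A - lincoord n d A) + (h A - lincoord n e A))"
        using f h by (intro vanish.add) auto
      then have "vanish n 2 (\<lambda>A. (f A + h A) - lincoord n (d + e) A)"
        by (simp add: lincoord_add algebra_simps)
      moreover have "ddir (\<lambda>A. f A + h A) (1\<^sub>m n) X = pairing n (d + e) X" if "X \<in> carrier_mat n n" for X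
        using ddir_add[OF one_carrier_mat that, of f h] f h that by (simp add: pairing_fun_add)
      ultimately have "?P (d + e) (\<lambda>A. f A + h A)" using f h by (simp add: poly_fun.add)
      then show ?thesis using that unfolding W_def by auto
    qed
    show "(\<lambda>ij. c * d ij) \<in> W" if "d \<in> W" for d c
    proof -
      from that have "\<exists>f. ?P d f" unfolding W_def by blast
      then obtain f where f: "?P d f" by (elim exE)
      have "vanish n 2 (\<lambda>A. c * (f A - lincoord n d A))" using f by (intro vanish_cmult) auto
      then have "vanish n 2 (\<lambda>A. c * f A - lincoord n (\<lambda>ij. c * d ij) A)"
        by (simp add: lincoord_cmult algebra_simps)
      moreover have "ddir (\<lambda>A. c * f A) (1\<^sub>m n) X = pairing n (\<lambda>ij. c * d ij) X" if "X \<in> carrier_mat n n" for X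
        using ddir_cmult[OF one_carrier_mat that, of f] f that by (simp add: pairing_fun_cmult)
      ultimately have "?P (\<lambda>ij. c * d ij) (\<lambda>A. c * f A)" using f by (simp add: poly_fun_cmult)
      then show ?thesis using that unfolding W_def by auto
    qed
    show "\<mu> ij = 0" if "ij \<notin> {..<n} \<times> {..<n}" for ij using \<mu>[OF that] .
    show "pairing n \<mu> X = 0" if X: "X \<in> carrier_mat n n" and 0: "\<And>f. f \<in> W \<Longrightarrow> pairing n f X = 0" for X
    proof (rule ann)
      have "ddir f (1\<^sub>m n) X = 0" if f: "f \<in> poly_fun n" "\<forall>A\<in>G. f A = 0" for f
      proof -
        obtain d where d: "\<forall>ij. ij \<notin> {..<n}\<times>{..<n} \<longrightarrow> d ij = 0" "\<forall>X\<in>carrier_mat n n. ddir f (1\<^sub>m n) X = pairing n d X"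
          "vanish n 2 (\<lambda>A. f A - f (1\<^sub>m n) - (\<Sum>ij\<in>{..<n}\<times>{..<n}. d ij * coord n (fst ij) (snd ij) A))"
          using ddir_pairing_ex[OF f(1)] by blast
        have "?P d f" using f d G unfolding lincoord_def by auto
        then have "d \<in> W" using d(1) unfolding W_def by blast
        then show ?thesis using 0 d(2) X by simp
      qed
      then show "X \<in> Lie n G" using X by (simp add: Lie_iff)
    qed
  qed
  then obtain f where f: "\<forall>A\<in>G. f A = 0" "vanish n 2 (\<lambda>A. f A - lincoord n \<mu> A)" by (auto simp: W_def)
  \<comment> \<open>The equation \<open>f\<close> is zero on \<open>G\<close>, so there
    \<open>lincoord n \<mu>\<close> equals minus the remainder \<open>f - lincoord n \<mu>\<close>,
    which has order 2.\<close>
  then show ?thesis using vanish_cmult[OF f(2), of "-1"] unfolding vanish_on_def by auto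
qed

context
  fixes n :: nat and G :: "'k::field_char_0 mat set" and B \<phi>
  assumes G: "subgroup G (GL n)"
    and B: "finite B" "B \<subseteq> entries n ` Lie n G"
    and expansion: "\<And>X. X \<in> Lie n G \<Longrightarrow> entries n X = (\<Sum>b\<in>B. (\<lambda>ij. pairing n (\<phi> b) X * b ij))"
begin

lemma frame_mat:
  assumes "b \<in> B"
  shows "mat n n b \<in> Lie n G"
proof -
  obtain X where X: "X \<in> Lie n G" "b = entries n X" using B(2) assms by blast
  then show ?thesis using mat_entries[OF Lie_carrier[OF X(1)]] by simp
qed

text \<open>To first order, the field applied to the entry \<open>(p, q)\<close> of
  \<open>A - 1\<close> is the sum of \<open>b (p, q) * \<phi> b (A - 1)\<close>. At a tangent vector
  in place of \<open>A - 1\<close> this sum is the entry itself; the difference is therefore a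
  functional killing the Lie algebra, hence of order 2 on \<open>G\<close>.\<close>

lemma euler_coord:
  assumes pq: "p < n" "q < n"
  shows "vanish_on n G 2 (\<lambda>A. euler n B \<phi> (coord n p q) A - coord n p q A)"
proof -
  let ?I = "{..<n} \<times> {..<n}"
  \<comment> \<open>The coordinate functional at \<open>(p, q)\<close> minus its expansion through
    the frame, cut off outside the index square.\<close>
  define \<mu> where "\<mu> ij = (if ij \<in> ?I then (if ij = (p, q) then 1 else 0) - (\<Sum>b\<in>B. b (p, q) * \<phi> b ij) else 0)" for ij
  have mu: "(\<Sum>ij\<in>?I. \<mu> ij * F ij) = F (p, q) - (\<Sum>b\<in>B. b (p, q) * (\<Sum>ij\<in>?I. \<phi> b ij * F ij))" for F :: "nat \<times> nat \<Rightarrow> 'k"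
  proof -
    have "(\<Sum>ij\<in>?I. \<mu> ij * F ij) = (\<Sum>ij\<in>?I. (if ij = (p, q) then F (p, q) else 0) - (\<Sum>b\<in>B. b (p, q) * (\<phi> b ij * F ij)))"
      by (intro sum.cong refl) (simp add: \<mu>_def left_diff_distrib sum_distrib_right mult.assoc)
    also have "\<dots> = F (p, q) - (\<Sum>ij\<in>?I. \<Sum>b\<in>B. b (p, q) * (\<phi> b ij * F ij))"
      using pq by (simp add: sum_subtractf)
    also have "(\<Sum>ij\<in>?I. \<Sum>b\<in>B. b (p, q) * (\<phi> b ij * F ij)) = (\<Sum>b\<in>B. \<Sum>ij\<in>?I. b (p, q) * (\<phi> b ij * F ij))"
      by (rule sum.swap)
    finally show ?thesis by (simp add: sum_distrib_left)
  qed
  have "vanish_on n G 2 (lincoord n \<mu>)"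
  proof (rule lincoord_vanish_on)
    show "1\<^sub>m n \<in> G" using subgroup_GL(2)[OF G] .
    show "\<mu> ij = 0" if "ij \<notin> ?I" for ij using that by (simp add: \<mu>_def)
    fix X assume X: "X \<in> Lie n G"
    have "(\<Sum>b\<in>B. (\<lambda>ij. pairing n (\<phi> b) X * b ij)) (p, q) = (\<Sum>b\<in>B. pairing n (\<phi> b) X * b (p, q))"
      by (induction B rule: infinite_finite_induct) auto
    then have "X $$ (p, q) = (\<Sum>b\<in>B. pairing n (\<phi> b) X * b (p, q))"
      using fun_cong[OF expansion[OF X], of "(p, q)"] pq by simp
    then show "pairing n \<mu> X = 0" unfolding pairing_def mu by (simp add: mult.commute)
  qed
  then have 1: "vanish_on n G 2 (\<lambda>A. (-1) * lincoord n \<mu> A)" by (rule vanish_on_cmult)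
  have "vanish n (1 + 1) (\<lambda>A. \<Sum>b\<in>B. lincoord n (\<phi> b) A * (\<Sum>k<n. coord n p k A * b (k, q)))"
    using pq by (intro vanish_sum vanish_mult vanish_lincoord vanish_mult_poly vanish_coord poly_fun.const) auto
  then have 2: "vanish_on n G 2 (\<lambda>A. \<Sum>b\<in>B. lincoord n (\<phi> b) A * (\<Sum>k<n. coord n p k A * b (k, q)))"
    by (intro vanish_onI) (simp add: numeral_2_eq_2)
  show ?thesis
  proof (rule vanish_on_cong[OF vanish_on_add[OF 1 2]])
    fix A assume "A \<in> G"
    then have A: "A \<in> carrier_mat n n" using subgroup_GL(1)[OF G] GL_carrier by blast
    \<comment> \<open>Splits \<open>A * b\<close> as \<open>b + (A - 1) * b\<close>. The second
      summand has order 1 and is multiplied by \<open>lincoord\<close>, so it contributes only in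
      order 2.\<close>
    have d: "ddir (coord n p q) (cut n A) (cut n A * mat n n b) = b (p, q) + (\<Sum>k<n. coord n p k A * b (k, q))" for b
    proof -
      have "ddir (coord n p q) (cut n A) (cut n A * mat n n b) = (A * mat n n b) $$ (p, q)"
        using A pq ddir_coord[of A n "A * mat n n b"] by simp
      also have "\<dots> = (\<Sum>k<n. A $$ (p, k) * b (k, q))"
        using A pq by (simp add: scalar_prod_def lessThan_atLeast0)
      also have "\<dots> = (\<Sum>k<n. (if k = p then b (p, q) else 0) + coord n p k A * b (k, q))"
        using pq by (intro sum.cong refl) (auto simp: coord_def algebra_simps)
      also have "\<dots> = b (p, q) + (\<Sum>k<n. coord n p k A * b (k, q))"
        using pq by (simp add: sum.distrib)
      finally show ?thesis .
    qed
    have "lincoord n \<mu> A = coord n p q A - (\<Sum>b\<in>B. b (p, q) * lincoord n (\<phi> b) A)"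
      using mu[of "\<lambda>ij. coord n (fst ij) (snd ij) A"] by (simp add: lincoord_def)
    then show "(-1) * lincoord n \<mu> A + (\<Sum>b\<in>B. lincoord n (\<phi> b) A * (\<Sum>k<n. coord n p k A * b (k, q)))
        = euler n B \<phi> (coord n p q) A - coord n p q A"
      unfolding euler_def d by (simp add: distrib_left sum.distrib mult.commute)
  qed
qed

text \<open>By the Leibniz rule each of the \<open>k\<close> coordinate factors is reproduced up to
  higher order, giving \<open>k\<close> copies of \<open>f\<close>, while a factor of degree 0 is
  sent to order 1.\<close>

lemma euler_vanish:
  assumes "vanish n k f"
  shows "vanish_on n G (Suc k) (\<lambda>A. euler n B \<phi> f A - of_nat k * f A)"
  using assms
proof induction
  case (base f)
  then show ?case using vanish_onI[OF euler_vanish_one[OF base]] by simp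
next
  case (zero k)
  show ?case by (simp add: euler_def vanish_onI vanish.zero)
next
  case (gen k f i j)
  note c = poly_fun_coord[OF gen.hyps(2,3)] and f = vanish_poly_fun[OF gen.hyps(1)]
  have "vanish_on n G (2 + k) (\<lambda>A. (euler n B \<phi> (coord n i j) A - coord n i j A) * f A)"
    by (intro vanish_on_mult euler_coord gen vanish_onI)
  moreover have "vanish_on n G (1 + Suc k) (\<lambda>A. coord n i j A * (euler n B \<phi> f A - of_nat k * f A))"
    by (intro vanish_on_mult gen.IH vanish_onI vanish_coord gen.hyps)
  ultimately have "vanish_on n G (Suc (Suc k)) (\<lambda>A. (euler n B \<phi> (coord n i j) A - coord n i j A) * f A
      + coord n i j A * (euler n B \<phi> f A - of_nat k * f A))"
    by (intro vanish_on_add) simp_all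
  then show ?case by (rule vanish_on_cong) (simp only: euler_mult[OF c f], simp add: algebra_simps)
next
  case (add k f h)
  show ?case using vanish_on_add[OF add.IH]
    by (rule vanish_on_cong) (simp add: euler_add vanish_poly_fun[OF add.hyps(1)] vanish_poly_fun[OF add.hyps(2)] algebra_simps)
qed

text \<open>The derivations in the field are tangent to \<open>G\<close>, so its action depends on
  restrictions to \<open>G\<close> alone. This allows a function to be replaced by a representative
  that vanishes to high order on all matrices.\<close>

lemma euler_cong:
  assumes f: "f \<in> poly_fun n" and g: "g \<in> poly_fun n" and eq: "\<And>A. A \<in> G \<Longrightarrow> f A = g A" and A: "A \<in> G"
  shows "euler n B \<phi> f A = euler n B \<phi> g A"
proof -
  have g': "(\<lambda>A. (-1) * g A) \<in> poly_fun n" using g by (rule poly_fun_cmult)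
  have Ac: "cut n A = A" using A subgroup_GL(1)[OF G] GL_carrier by (blast intro: cut_id)
  have "euler n B \<phi> (\<lambda>A. f A + (-1) * g A) A = 0"
    unfolding euler_def Ac
    by (intro sum.neutral ballI mult_eq_0_iff[THEN iffD2] disjI2
       ddir_left_invariant[OF G frame_mat _ _ A] poly_fun.add f g') (simp_all add: eq)
  then show ?thesis using euler_add[OF f g', of B \<phi> A] euler_cmult[OF g, of B \<phi> "-1" A] by simp
qed

text \<open>Two estimates of the Euler field on \<open>f\<close> are compared at order
  \<open>k\<close>. The summand \<open>c * f\<close> allowed in \<open>step\<close> does no harm,
  since \<open>f\<close> itself has order \<open>k\<close> by induction.\<close>

lemma family_vanish_frame:
  assumes W: "W \<subseteq> poly_fun n" "\<And>f. f \<in> W \<Longrightarrow> f (1\<^sub>m n) = 0"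
    and step: "\<And>f X. f \<in> W \<Longrightarrow> X \<in> Lie n G \<Longrightarrow> \<exists>h\<in>W. \<exists>c. \<forall>A\<in>G. ddir f A (A * X) = h A + c * f A"
    and f: "f \<in> W"
  shows "vanish_on n G k f"
  using f
proof (induction k arbitrary: f)
  case 0
  then show ?case using W(1) by (intro vanish_onI vanish.base) auto
next
  case (Suc k)
  have fp: "f \<in> poly_fun n" using W(1) Suc.prems by auto
  show ?case
  proof (cases "k = 0")
    \<comment> \<open>Order 1 comes from the value at the identity; for \<open>k = 0\<close> the
      comparison below would only concern \<open>0 * f\<close>.\<close>
    case True
    then show ?thesis using vanish_onI[OF vanish_one[OF fp]] W(2)[OF Suc.prems] by simp
  next
    case False
    obtain g where g: "vanish n k g" "\<And>A. A \<in> G \<Longrightarrow> f A = g A"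
      using Suc.IH[OF Suc.prems] unfolding vanish_on_def by blast
    have 1: "vanish_on n G (Suc k) (\<lambda>A. euler n B \<phi> f A - of_nat k * f A)"
      by (rule vanish_on_cong[OF euler_vanish[OF g(1)]])
         (simp add: euler_cong[OF fp vanish_poly_fun[OF g(1)] g(2)] g(2))
    \<comment> \<open>On \<open>G\<close> the derivative is a member of the family plus a multiple
      of \<open>f\<close>, so it has order \<open>k\<close>; the coefficient \<open>lincoord\<close>
      raises this by one.\<close>
    have "vanish_on n G (1 + k) (\<lambda>A. lincoord n (\<phi> b) A * ddir f (cut n A) (cut n A * mat n n b))" if "b \<in> B" for b
    proof (intro vanish_on_mult vanish_onI[OF vanish_lincoord])
      obtain h c where h: "h \<in> W" "\<And>A. A \<in> G \<Longrightarrow> ddir f A (A * mat n n b) = h A + c * f A"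
        using step[OF Suc.prems frame_mat] \<open>b \<in> B\<close> by blast
      have "vanish_on n G k (\<lambda>A. h A + c * f A)"
        using Suc.IH h(1) Suc.prems by (intro vanish_on_add vanish_on_cmult)
      then show "vanish_on n G k (\<lambda>A. ddir f (cut n A) (cut n A * mat n n b))"
      proof (rule vanish_on_cong)
        fix A assume "A \<in> G"
        then show "h A + c * f A = ddir f (cut n A) (cut n A * mat n n b)"
          using h(2) GL_carrier[OF subgroup_GL(1)[OF G \<open>A \<in> G\<close>]] by simp
      qed
    qed
    then have "vanish_on n G (Suc k) (euler n B \<phi> f)"
      unfolding euler_def[abs_def] by (intro vanish_on_sum) simp
    from vanish_on_add[OF this vanish_on_cmult[OF 1, of "-1"]]
    have "vanish_on n G (Suc k) (\<lambda>A. of_nat k * f A)" by simp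
    from vanish_on_cmult[OF this, of "inverse (of_nat k)"] show ?thesis using False by (simp add: mult.assoc[symmetric])
  qed
qed

end

text \<open>In other words \<open>(1 - a) f = 0\<close> on \<open>G\<close> with
  \<open>1 - a\<close> equal to 1 at the identity, so \<open>f\<close> vanishes on the open part of
  \<open>G\<close> where \<open>a\<close> is not 1. That neighbourhood may depend on
  \<open>f\<close>.\<close>

lemma family_vanish_near_one:
  fixes G :: "'k::field_char_0 mat set"
  assumes G: "subgroup G (GL n)"
    and W: "W \<subseteq> poly_fun n" "\<And>f. f \<in> W \<Longrightarrow> f (1\<^sub>m n) = 0"
    and step: "\<And>f X. f \<in> W \<Longrightarrow> X \<in> Lie n G \<Longrightarrow> \<exists>h\<in>W. \<exists>c. \<forall>A\<in>G. ddir f A (A * X) = h A + c * f A"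
    and f: "f \<in> W"
  shows "\<exists>a \<in> poly_fun n. a (1\<^sub>m n) = 0 \<and> (\<forall>A\<in>G. f A = a A * f A)"
proof -
  obtain B \<phi> where "finite B" "B \<subseteq> entries n ` Lie n G"
    "\<And>X. X \<in> Lie n G \<Longrightarrow> entries n X = (\<Sum>b\<in>B. (\<lambda>ij. pairing n (\<phi> b) X * b ij))"
    by (rule dual_frame[OF mat_subspace_Lie, of n G]) blast
  note frame = this
  have "vanish_on n G k f" for k
    by (rule family_vanish_frame[where W=W]) (fact G frame W step f)+
  then show ?thesis by (rule krull)
qed

section \<open>The adjoint action preserves subspaces stable under the Lie algebra\<close>

lemma bracket_carrier [simp]: "x \<in> carrier_mat n n \<Longrightarrow> y \<in> carrier_mat n n \<Longrightarrow> bracket x y \<in> carrier_mat n n"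
  unfolding bracket_def by (intro minus_carrier_mat mult_carrier_mat)

lemma entries_zero [simp]: "entries n (0\<^sub>m n n) = 0"
  by (auto simp: entries_def fun_eq_iff)

lemma pairing_zero [simp]: "pairing n d (0\<^sub>m n n) = 0"
  by (simp add: pairing_entries)

text \<open>Finite dimension expressed without spans: a condition that defines a subspace need only
  be tested on the finite set \<open>S\<close>.\<close>

lemma subspace_finitely_generated:
  assumes L: "mat_subspace n L"
  obtains S where "finite S" "S \<subseteq> L" "\<And>U. mat_subspace n U \<Longrightarrow> S \<subseteq> U \<Longrightarrow> L \<subseteq> U"
proof -
  obtain B \<phi> where B: "finite B" "B \<subseteq> entries n ` L"
    "\<And>X. X \<in> L \<Longrightarrow> entries n X = (\<Sum>b\<in>B. (\<lambda>ij. pairing n (\<phi> b) X * b ij))"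
    by (rule dual_frame[OF L]) blast
  define S where "S = mat n n ` B"
  have "mat n n b \<in> L \<and> entries n (mat n n b) = b" if b: "b \<in> B" for b
  proof -
    obtain X where X: "X \<in> L" "b = entries n X" using B(2) b by blast
    then show ?thesis using mat_entries[OF mat_subspaceD(1)[OF L X(1)]] by simp
  qed
  then have S: "S \<subseteq> L" "entries n ` S = B" unfolding S_def by (auto simp: image_image)
  show thesis
  proof (rule that[of S])
    show "finite S" "S \<subseteq> L" using B(1) S by (auto simp: S_def)
    fix U assume U: "mat_subspace n U" and SU: "S \<subseteq> U"
    have BU: "B \<subseteq> entries n ` U" using S(2) SU by blast
    have "(\<Sum>b\<in>C. (\<lambda>ij. u b * b ij)) \<in> entries n ` U" if "finite C" "C \<subseteq> B" for C u
      using that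
    proof (induction C)
      case empty
      show ?case using mat_subspaceD(2)[OF U] by (intro image_eqI[of _ _ "0\<^sub>m n n"]) simp_all
    next
      case (insert b C)
      then have IH: "(\<Sum>b\<in>C. (\<lambda>ij. u b * b ij)) \<in> entries n ` U" by simp
      obtain x where x: "x \<in> U" "b = entries n x" using BU insert.prems by blast
      obtain y where y: "y \<in> U" "(\<Sum>b\<in>C. (\<lambda>ij. u b * b ij)) = entries n y" using IH by blast
      have "(\<Sum>b\<in>insert b C. (\<lambda>ij. u b * b ij)) = entries n (u b \<cdot>\<^sub>m x + y)"
        using insert.hyps x y(2) mat_subspaceD(1)[OF U x(1)] mat_subspaceD(1)[OF U y(1)]
        by (simp add: entries_add entries_smult)
      then show ?case using x y mat_subspaceD(3,4)[OF U] by blast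
    qed
    from this[OF B(1) subset_refl] have "entries n X \<in> entries n ` U" if "X \<in> L" for X
      unfolding B(3)[OF that] .
    then show "L \<subseteq> U" using entries_inject mat_subspaceD(1)[OF L] mat_subspaceD(1)[OF U] by blast
  qed
qed

lemma ddir_pairing:
  fixes A X :: "'k::field_char_0 mat"
  assumes A: "A \<in> carrier_mat n n" and X: "X \<in> carrier_mat n n" and M: "poly_mat n n n M"
  shows "ddir (\<lambda>A. pairing n d (M A)) A X = pairing n d (mddir A X n n M)"
proof -
  have e: "(\<lambda>A. M A $$ ij) \<in> poly_fun n" if "ij \<in> {..<n}\<times>{..<n}" for ij
    using poly_matD(2)[OF M] that by (cases ij) auto
  have "ddir (\<lambda>A. pairing n d (M A)) A X = (\<Sum>ij\<in>{..<n}\<times>{..<n}. d ij * ddir (\<lambda>A. M A $$ ij) A X)"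
    unfolding pairing_def using e
    by (subst ddir_sum[OF A X]) (auto intro!: poly_fun_cmult sum.cong ddir_cmult[OF A X])
  also have "\<dots> = pairing n d (mddir A X n n M)"
    unfolding pairing_def by (intro sum.cong) (auto simp: mddir_def[OF A X])
  finally show ?thesis .
qed

text \<open>A matrix coefficient of the adjoint action multiplied by \<open>det A\<close>, which
  makes it a polynomial function.\<close>

definition adf :: "nat \<Rightarrow> (nat \<times> nat \<Rightarrow> 'k) \<Rightarrow> 'k mat \<Rightarrow> 'k::field mat \<Rightarrow> 'k" where
  "adf n d v A = pairing n d (cut n A * v * adj_mat (cut n A))"

lemma poly_mat_conj: "v \<in> carrier_mat n n \<Longrightarrow> poly_mat n n n (\<lambda>A. cut n A * v * adj_mat (cut n A))"
  by (rule poly_mat_mult[OF poly_mat_mult[OF poly_mat_cut poly_mat_const] poly_mat_adj[OF poly_mat_cut]])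

lemma adf_poly_fun:
  assumes "v \<in> carrier_mat n n"
  shows "adf n d v \<in> poly_fun n"
proof -
  have "(\<lambda>A. \<Sum>ij\<in>{..<n}\<times>{..<n}. d ij * (cut n A * v * adj_mat (cut n A)) $$ ij) \<in> poly_fun n"
  proof (intro poly_fun_sum poly_fun_cmult)
    fix ij assume "ij \<in> {..<n}\<times>{..<n}"
    then show "(\<lambda>A. (cut n A * v * adj_mat (cut n A)) $$ ij) \<in> poly_fun n"
      using poly_matD(2)[OF poly_mat_conj[OF assms]] by (cases ij) blast
  qed
  then show ?thesis by (simp only: adf_def[abs_def] pairing_def)
qed

lemma adf_GL: "A \<in> carrier (GL n) \<Longrightarrow> v \<in> carrier_mat n n \<Longrightarrow> adf n d v A = det A * pairing n d (Ad n A v)"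
  by (simp add: adf_def GL_carrier Ad_adj pairing_smult Ad_carrier)

lemma Ad_one: "x \<in> carrier_mat n n \<Longrightarrow> Ad n (1\<^sub>m n) x = (x :: 'k::field mat)"
proof -
  interpret group "GL n :: 'k mat monoid" by (rule group_GL)
  show "x \<in> carrier_mat n n \<Longrightarrow> Ad n (1\<^sub>m n) x = x" using inv_one by (simp add: Ad_def GL_simps)
qed

lemma adf_one: "v \<in> carrier_mat n n \<Longrightarrow> adf n d v (1\<^sub>m n) = pairing n d v"
  by (simp add: adf_GL GL_iff Ad_one)

text \<open>Differentiating \<open>A v adj(A)\<close> along \<open>A X\<close> yields
  \<open>X v\<close> from the first factor and \<open>- v X\<close> from the last, together the
  bracket. The remaining term is the derivative of the determinant hidden in
  \<open>adj(A)\<close>.\<close>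

lemma ddir_adf:
  fixes A X v :: "'k::field_char_0 mat"
  assumes A: "A \<in> carrier_mat n n" "det A \<noteq> 0" and X: "X \<in> carrier_mat n n" and v: "v \<in> carrier_mat n n"
  defines "c \<equiv> ddir (\<lambda>A. det (cut n A)) (1\<^sub>m n) X"
  shows "ddir (adf n d v) A (A * X) = adf n d (bracket X v) A + c * adf n d v A"
proof -
  note AX = mult_carrier_mat[OF A(1) X]
  note adj = adj_mat(1)[OF A(1)]
  have "mddir A (A * X) n n (\<lambda>A. cut n A * v) = A * X * v + A * 0\<^sub>m n n"
    using mddir_mult[OF A(1) AX poly_mat_cut poly_mat_const[OF v]] A(1)
    by (simp add: mddir_cut[OF A(1) AX] mddir_const[OF A(1) AX v])
  also have "\<dots> = A * X * v" using A X v by simp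
  finally have 1: "mddir A (A * X) n n (\<lambda>A. cut n A * v) = A * X * v" .
  have "mddir A (A * X) n n (\<lambda>A. cut n A * v * adj_mat (cut n A))
      = A * X * v * adj_mat A + A * v * (c \<cdot>\<^sub>m adj_mat A - X * adj_mat A)"
    using mddir_mult[OF A(1) AX poly_mat_mult[OF poly_mat_cut poly_mat_const[OF v]] poly_mat_adj[OF poly_mat_cut]] A(1)
    by (simp add: 1 mddir_adj[OF A(1) X A(2)] c_def)
  also have "\<dots> = A * bracket X v * adj_mat A + c \<cdot>\<^sub>m (A * v * adj_mat A)"
  proof -
    have e1: "A * v * (c \<cdot>\<^sub>m adj_mat A - X * adj_mat A) = c \<cdot>\<^sub>m (A * v * adj_mat A) - A * v * (X * adj_mat A)"
    proof -
      have "A * v * (c \<cdot>\<^sub>m adj_mat A - X * adj_mat A) = A * v * (c \<cdot>\<^sub>m adj_mat A) - A * v * (X * adj_mat A)"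
        by (rule mult_minus_distrib_mat[of _ n n _ n]) (use A X v adj in auto)
      also have "A * v * (c \<cdot>\<^sub>m adj_mat A) = c \<cdot>\<^sub>m (A * v * adj_mat A)"
        by (rule mult_smult_distrib[of _ n n _ n]) (use A v adj in auto)
      finally show ?thesis .
    qed
    have e2: "A * bracket X v * adj_mat A = A * X * v * adj_mat A - A * v * (X * adj_mat A)"
    proof -
      have "A * bracket X v = A * (X * v) - A * (v * X)"
        unfolding bracket_def by (rule mult_minus_distrib_mat[of _ n n _ n]) (use A X v in auto)
      then have "A * bracket X v * adj_mat A = A * (X * v) * adj_mat A - A * (v * X) * adj_mat A"
        using A X v adj by (simp only:) (rule minus_mult_distrib_mat[of _ n n _ _ n], auto)
      then show ?thesis using A X v adj by (simp add: assoc_mult_mat[of _ n n _ n _ n])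
    qed
    have e3: "P + (Q - R) = P - R + Q" if "P \<in> carrier_mat n n" "Q \<in> carrier_mat n n" "R \<in> carrier_mat n n" for P Q R :: "'k mat"
      using that by (intro eq_matI) auto
    show ?thesis unfolding e1 e2 by (rule e3) (use A X v adj in auto)
  qed
  finally have 2: "mddir A (A * X) n n (\<lambda>A. cut n A * v * adj_mat (cut n A))
     = A * bracket X v * adj_mat A + c \<cdot>\<^sub>m (A * v * adj_mat A)" .
  show ?thesis
    unfolding adf_def[abs_def] ddir_pairing[OF A(1) AX poly_mat_conj[OF v]] 2
    using mult_carrier_mat[OF mult_carrier_mat[OF A(1) bracket_carrier[OF X v]] adj]
      mult_carrier_mat[OF mult_carrier_mat[OF A(1) v] adj] A(1)
    by (simp only: pairing_add pairing_smult smult_carrier_mat cut_id)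
qed

text \<open>Equations of \<open>G\<close> composed with conjugation by \<open>g\<close> are again
  equations of \<open>G\<close>, and conjugation maps the line \<open>1 + s X\<close> to
  \<open>1 + s (Ad g X)\<close>.\<close>

lemma Ad_Lie:
  fixes G :: "'k::field_char_0 mat set"
  assumes G: "subgroup G (GL n)" and g: "g \<in> G" and X: "X \<in> Lie n G"
  shows "Ad n g X \<in> Lie n G"
  unfolding Lie_iff
proof (intro conjI ballI impI)
  note gG = subgroup_GL(1)[OF G g]
  note gc = GL_carrier[OF gG] GL_inv(2)[OF gG] and Xc = Lie_carrier[OF X]
  show A: "Ad n g X \<in> carrier_mat n n" using Ad_carrier[OF gG Xc] .
  fix f :: "'k mat \<Rightarrow> 'k" assume f: "f \<in> poly_fun n" "\<forall>a\<in>G. f a = 0"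
  let ?F = "\<lambda>A. f (g * cut n A * GL_inv n g)"
  have F: "?F \<in> poly_fun n"
    by (rule poly_fun_compose[OF f(1) poly_mat_mult[OF poly_mat_mult[OF poly_mat_const[OF gc(1)] poly_mat_cut] poly_mat_const[OF gc(2)]]])
  have "?F a = 0" if "a \<in> G" for a
    using f(2) subgroup_GL(3)[OF G subgroup_GL(3)[OF G g that] subgroup_GL(4)[OF G g]]
      GL_carrier[OF subgroup_GL(1)[OF G that]] by simp
  then have z: "ddir ?F (1\<^sub>m n) X = 0" using X F by (simp add: Lie_iff)
  obtain q where q: "\<And>s. f (1\<^sub>m n + s \<cdot>\<^sub>m Ad n g X) = poly q s" "poly.coeff q 1 = ddir f (1\<^sub>m n) (Ad n g X)"
    using poly_fun_along_line[OF f(1) one_carrier_mat A] by blast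
  have "?F (1\<^sub>m n + s \<cdot>\<^sub>m X) = poly q s" for s
  proof -
    have "g * (1\<^sub>m n + s \<cdot>\<^sub>m X) * GL_inv n g = 1\<^sub>m n + s \<cdot>\<^sub>m Ad n g X"
    proof -
      have "Ad n g (1\<^sub>m n + s \<cdot>\<^sub>m X) = Ad n g (1\<^sub>m n) + s \<cdot>\<^sub>m Ad n g X"
        using Xc by (simp add: Ad_add[OF gG] Ad_smult[OF gG])
      moreover have "Ad n g (1\<^sub>m n) = 1\<^sub>m n" using gc GL_inv(3)[OF gG] by (simp add: Ad_def)
      ultimately show ?thesis by (simp add: Ad_def)
    qed
    then show ?thesis using q(1)[of s] Xc by simp
  qed
  from ddirI[of ?F, OF this] show "ddir f (1\<^sub>m n) (Ad n g X) = 0" using z q(2) by simp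
qed

text \<open>For a functional \<open>d\<close> killing the Lie algebra, \<open>adf n d Y\<close>
  vanishes on \<open>G\<close> because \<open>Ad\<close> preserves the Lie algebra. Its derivative
  at 1 along \<open>X\<close> is \<open>d\<close> at the bracket, plus a multiple of
  \<open>d\<close> at \<open>Y\<close>, which is zero.\<close>

lemma Lie_bracket:
  fixes G :: "'k::field_char_0 mat set"
  assumes G: "subgroup G (GL n)" and X: "X \<in> Lie n G" and Y: "Y \<in> Lie n G"
  shows "bracket X Y \<in> Lie n G"
proof (rule ccontr)
  note c = Lie_carrier[OF X] Lie_carrier[OF Y]
  assume "bracket X Y \<notin> Lie n G"
  then obtain d where d: "\<And>u. u \<in> Lie n G \<Longrightarrow> pairing n d u = 0" "pairing n d (bracket X Y) \<noteq> 0"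
    by (rule subspace_separation[OF mat_subspace_Lie bracket_carrier[OF c]]) blast
  have "adf n d Y A = 0" if "A \<in> G" for A
    using adf_GL[OF subgroup_GL(1)[OF G that] c(2)] d(1)[OF Ad_Lie[OF G that Y]] by simp
  then have "ddir (adf n d Y) (1\<^sub>m n) X = 0" using X adf_poly_fun[OF c(2)] by (simp add: Lie_iff)
  moreover have "ddir (adf n d Y) (1\<^sub>m n) X = pairing n d (bracket X Y) 
      + ddir (\<lambda>A. det (cut n A)) (1\<^sub>m n) X * pairing n d Y"
    using ddir_adf[OF one_carrier_mat _ c, of d] c by (simp add: adf_one)
  ultimately show False using d Y by simp
qed

text \<open>Each matrix coefficient that ought to vanish does so on a neighbourhood of 1 of its own,
  and only finitely many of these can be intersected. Hence \<open>V\<close> and its annihilator are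
  replaced by finite generating sets; the common neighbourhood is then moved about by left
  translation.\<close>

theorem connected_Ad_stable:
  fixes G :: "'k::field_char_0 mat set"
  assumes conn: "connected_alg_group n G" and V: "mat_subspace n V"
    and stable: "\<And>X v. X \<in> Lie n G \<Longrightarrow> v \<in> V \<Longrightarrow> bracket X v \<in> V"
    and g: "g \<in> G" and v: "v \<in> V"
  shows "Ad n g v \<in> V"
proof -
  have G: "subgroup G (GL n)" and cl: "zariski_closed n G" and zc: "zariski_connected n G"
    using conn by (auto simp: connected_alg_group_def alg_group_def)
  note Vc = mat_subspaceD(1)[OF V]
  \<comment> \<open>The common zeros in \<open>G\<close> of these functions are the elements that
    map \<open>V\<close> into itself, by separation of points from the subspace
    \<open>V\<close>.\<close>
  define W where "W = {adf n d v | d v. v \<in> V \<and> (\<forall>u\<in>V. pairing n d u = 0)}"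
  have Wp: "W \<subseteq> poly_fun n" using adf_poly_fun Vc by (auto simp: W_def)
  have W1: "f (1\<^sub>m n) = 0" if "f \<in> W" for f using that Vc by (auto simp: W_def adf_one)
  have Wstep: "\<exists>h\<in>W. \<exists>c. \<forall>A\<in>G. ddir f A (A * X) = h A + c * f A" if "f \<in> W" and X: "X \<in> Lie n G" for f X
  proof -
    obtain d v where f: "f = adf n d v" "v \<in> V" "\<forall>u\<in>V. pairing n d u = 0" using \<open>f \<in> W\<close> by (auto simp: W_def)
    have "adf n d (bracket X v) \<in> W" using f stable[OF X] by (auto simp: W_def)
    moreover have "ddir f A (A * X) = adf n d (bracket X v) A + ddir (\<lambda>A. det (cut n A)) (1\<^sub>m n) X * f A" if "A \<in> G" for A
      using ddir_adf[OF _ _ Lie_carrier[OF X] Vc[OF f(2)], of A d] subgroup_GL(1)[OF G that] f(1) by (simp add: GL_iff)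
    ultimately show ?thesis by blast
  qed
  have near: "\<exists>a \<in> poly_fun n. a (1\<^sub>m n) = 0 \<and> (\<forall>A\<in>G. f A = a A * f A)" if "f \<in> W" for f
    by (rule family_vanish_near_one[where W=W]) (fact G Wp W1 Wstep that)+
  define H where "H = {A \<in> G. \<forall>f\<in>W. f A = 0}"
  have H_iff: "A \<in> H \<longleftrightarrow> A \<in> G \<and> (\<forall>v\<in>V. Ad n A v \<in> V)" for A
  proof (cases "A \<in> G")
    case True
    note A = subgroup_GL(1)[OF G True]
    have d0: "det A \<noteq> 0" using A by (simp add: GL_iff)
    show ?thesis
    proof
      assume AH: "A \<in> H"
      have "Ad n A v \<in> V" if v: "v \<in> V" for v
      proof (rule ccontr)
        assume "Ad n A v \<notin> V"
        then obtain d where d: "\<And>u. u \<in> V \<Longrightarrow> pairing n d u = 0" "pairing n d (Ad n A v) \<noteq> 0"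
          by (rule subspace_separation[OF V Ad_carrier[OF A Vc[OF v]]]) blast
        then have "adf n d v \<in> W" using v by (auto simp: W_def)
        then have "adf n d v A = 0" using AH by (simp add: H_def)
        then show False using d(2) d0 by (simp add: adf_GL[OF A Vc[OF v]])
      qed
      then show "A \<in> G \<and> (\<forall>v\<in>V. Ad n A v \<in> V)" using True by blast
    next
      assume "A \<in> G \<and> (\<forall>v\<in>V. Ad n A v \<in> V)"
      then show "A \<in> H" using True A Vc by (auto simp: H_def W_def adf_GL)
    qed
  qed (simp add: H_def)
  \<comment> \<open>The annihilator of \<open>V\<close>, encoded as a space of matrices so that it
    too has a finite generating set.\<close>
  define D where "D = {Y \<in> carrier_mat n n. \<forall>u\<in>V. pairing n (entries n Y) u = 0}"
  have Dsub: "mat_subspace n {Y \<in> carrier_mat n n. \<forall>u\<in>Z. pairing n (entries n Y) u = 0}" for Z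
    unfolding mat_subspace_def
  proof (intro conjI ballI allI)
    show "0\<^sub>m n n \<in> {Y \<in> carrier_mat n n. \<forall>u\<in>Z. pairing n (entries n Y) u = 0}" by (simp add: pairing_def)
  qed (auto simp: entries_add entries_smult pairing_fun_add pairing_fun_cmult)
  have DW: "adf n (entries n Y) v \<in> W" if "Y \<in> D" "v \<in> V" for Y v using that by (auto simp: W_def D_def)
  obtain SV where SV: "finite SV" "SV \<subseteq> V" "\<And>U. mat_subspace n U \<Longrightarrow> SV \<subseteq> U \<Longrightarrow> V \<subseteq> U"
    by (rule subspace_finitely_generated[OF V]) blast
  obtain SD where SD: "finite SD" "SD \<subseteq> D" "\<And>U. mat_subspace n U \<Longrightarrow> SD \<subseteq> U \<Longrightarrow> D \<subseteq> U"
    by (rule subspace_finitely_generated[OF Dsub[of V, folded D_def]]) blast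
  \<comment> \<open>\<open>adf\<close> is linear in the vector and in the functional, so vanishing
    on pairs of generators extends to all pairs, one argument at a time.\<close>
  have reduce: "A \<in> H" if A: "A \<in> G" and 0: "\<And>Y v. Y \<in> SD \<Longrightarrow> v \<in> SV \<Longrightarrow> adf n (entries n Y) v A = 0" for A
  proof -
    have Ac: "A \<in> carrier_mat n n" and adj: "adj_mat A \<in> carrier_mat n n"
      using GL_carrier[OF subgroup_GL(1)[OF G A]] adj_mat(1) by auto
    have V0: "adf n (entries n Y) v A = 0" if Y: "Y \<in> SD" and "v \<in> V" for Y v
    proof -
      have "mat_subspace n {v \<in> carrier_mat n n. adf n (entries n Y) v A = 0}"
        unfolding mat_subspace_def
      proof (intro conjI ballI allI)
        show "0\<^sub>m n n \<in> {v \<in> carrier_mat n n. adf n (entries n Y) v A = 0}"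
          using Ac adj by (simp add: adf_def)
      qed (use Ac adj in \<open>auto simp: adf_def mult_add_distrib_mat[of _ n n] add_mult_distrib_mat[of _ n n _ _ n]
          mult_smult_distrib[of _ n n _ n] mult_smult_assoc_mat[of _ n n _ n] pairing_add pairing_smult\<close>)
      then have "V \<subseteq> {v \<in> carrier_mat n n. adf n (entries n Y) v A = 0}"
        by (rule SV(3)) (use 0[OF Y] SV(2) Vc in auto)
      then show ?thesis using \<open>v \<in> V\<close> by auto
    qed
    let ?Z = "{A * v * adj_mat A | v. v \<in> V}"
    have "SD \<subseteq> {Y \<in> carrier_mat n n. \<forall>u\<in>?Z. pairing n (entries n Y) u = 0}"
      using V0 SD(2) Ac by (auto simp: D_def adf_def)
    from SD(3)[OF Dsub this] have D0: "pairing n (entries n Y) (A * v * adj_mat A) = 0" if "Y \<in> D" "v \<in> V" for Y v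
      using that by blast
    show ?thesis unfolding H_def
    proof (intro CollectI conjI A ballI)
      fix f assume "f \<in> W"
      then obtain d v where f: "f = adf n d v" "v \<in> V" "\<forall>u\<in>V. pairing n d u = 0" by (auto simp: W_def)
      have e: "pairing n (entries n (mat n n d)) u = pairing n d u" for u
        unfolding pairing_def by (intro sum.cong) auto
      have "mat n n d \<in> D" using f(3) by (simp add: D_def e)
      from D0[OF this f(2)] show "f A = 0" using Ac f(1) by (simp add: adf_def e)
    qed
  qed
  have "\<exists>a. \<forall>Y\<in>SD. \<forall>v\<in>SV. a (Y, v) \<in> poly_fun n \<and> a (Y, v) (1\<^sub>m n) = 0 \<and>
      (\<forall>A\<in>G. adf n (entries n Y) v A = a (Y, v) A * adf n (entries n Y) v A)"
  proof -
    have "\<forall>Yv. \<exists>a. Yv \<in> SD \<times> SV \<longrightarrow> a \<in> poly_fun n \<and> a (1\<^sub>m n) = 0 \<and>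
       (\<forall>A\<in>G. adf n (entries n (fst Yv)) (snd Yv) A = a A * adf n (entries n (fst Yv)) (snd Yv) A)"
    proof
      fix Yv
      show "\<exists>a. Yv \<in> SD \<times> SV \<longrightarrow> a \<in> poly_fun n \<and> a (1\<^sub>m n) = 0 \<and>
         (\<forall>A\<in>G. adf n (entries n (fst Yv)) (snd Yv) A = a A * adf n (entries n (fst Yv)) (snd Yv) A)"
      proof (cases "Yv \<in> SD \<times> SV")
        case True
        then have "fst Yv \<in> D" "snd Yv \<in> V" using SD(2) SV(2) by auto
        from near[OF DW[OF this]] show ?thesis by blast
      qed simp
    qed
    from choice[OF this] show ?thesis by auto
  qed
  then obtain a where a: "\<And>Y v. Y \<in> SD \<Longrightarrow> v \<in> SV \<Longrightarrow> a (Y, v) \<in> poly_fun n"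
    "\<And>Y v. Y \<in> SD \<Longrightarrow> v \<in> SV \<Longrightarrow> a (Y, v) (1\<^sub>m n) = 0"
    "\<And>Y v A. Y \<in> SD \<Longrightarrow> v \<in> SV \<Longrightarrow> A \<in> G \<Longrightarrow> adf n (entries n Y) v A = a (Y, v) A * adf n (entries n Y) v A"
    by blast
  \<comment> \<open>On \<open>G\<close> the factor \<open>1 - a\<close> annihilates its coefficient.
    Where the product of these factors is nonzero, all generating coefficients vanish.\<close>
  define b where "b A = (\<Prod>Yv\<in>SD \<times> SV. 1 - a Yv A)" for A
  have bp: "b \<in> poly_fun n" unfolding b_def[abs_def]
    by (intro poly_fun_prod poly_fun_diff poly_fun.const) (use a(1) in auto)
  have b1: "b (1\<^sub>m n) = 1" unfolding b_def using a(2) by (intro prod.neutral) auto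
  have bH: "A \<in> H" if "A \<in> G" "b A \<noteq> 0" for A
  proof (rule reduce[OF that(1)])
    fix Y v assume Yv: "Y \<in> SD" "v \<in> SV"
    have "1 - a (Y, v) A \<noteq> 0" using that(2) Yv SD(1) SV(1) by (auto simp: b_def)
    moreover have "(1 - a (Y, v) A) * adf n (entries n Y) v A = 0"
      using a(3)[OF Yv that(1)] by (simp add: left_diff_distrib)
    ultimately show "adf n (entries n Y) v A = 0" by simp
  qed
  obtain P where P: "P \<subseteq> poly_fun n" "G = {a \<in> carrier (GL n). \<forall>f\<in>P. f a = 0}"
    using cl unfolding zariski_closed_def by blast
  have Hcl: "zariski_closed n H"
    unfolding zariski_closed_def by (rule exI[of _ "P \<union> W"]) (use P Wp in \<open>auto simp: H_def\<close>)
  have HG: "H \<subseteq> G" by (auto simp: H_def)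
  have H1: "1\<^sub>m n \<in> H" using W1 subgroup_GL(2)[OF G] by (simp add: H_def)
  \<comment> \<open>If \<open>b\<close> is nonzero at \<open>h^{-1} A\<close>, then
    \<open>h^{-1} A\<close> is in \<open>H\<close>, and so is \<open>A\<close>. The left translates
    of \<open>b\<close> by elements of \<open>H\<close> are therefore equations for the complement
    of \<open>H\<close>.\<close>
  let ?t = "\<lambda>h A. b (GL_inv n h * cut n A)"
  have compl: "G - H = {A \<in> carrier (GL n). \<forall>f\<in>P \<union> ?t ` H. f A = 0}"
  proof (intro equalityI subsetI)
    fix A assume A: "A \<in> G - H"
    have Ac: "cut n A = A" using GL_carrier[OF subgroup_GL(1)[OF G]] A by simp
    have "?t h A = 0" if h: "h \<in> H" for h
    proof (rule ccontr)
      assume nz: "?t h A \<noteq> 0"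
      have hG: "h \<in> G" using h HG by blast
      have "GL_inv n h * A \<in> G" using subgroup_GL(3,4)[OF G] hG A by blast
      then have mem: "GL_inv n h * A \<in> H" using bH nz Ac by simp
      have "A = h * (GL_inv n h * A)"
        using GL_carrier[OF subgroup_GL(1)[OF G hG]] GL_inv[OF subgroup_GL(1)[OF G hG]] GL_carrier[OF subgroup_GL(1)[OF G DiffD1[OF A]]]
        by (simp flip: assoc_mult_mat[of _ n n _ n _ n])
      moreover have "h * (GL_inv n h * A) \<in> H"
      proof -
        have kG: "GL_inv n h * A \<in> G" using mem HG by blast
        show ?thesis using h mem subgroup_GL(3)[OF G hG kG] Vc
          unfolding H_iff by (simp add: Ad_comp[OF subgroup_GL(1)[OF G hG] subgroup_GL(1)[OF G kG]])
      qed
      ultimately show False using A by simp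
    qed
    then show "A \<in> {A \<in> carrier (GL n). \<forall>f\<in>P \<union> ?t ` H. f A = 0}" using A P(2) by auto
  next
    fix A assume A: "A \<in> {A \<in> carrier (GL n). \<forall>f\<in>P \<union> ?t ` H. f A = 0}"
    then have AG: "A \<in> G" using P(2) by auto
    have "A \<notin> H"
    proof
      assume "A \<in> H"
      \<comment> \<open>Translating by \<open>A\<close> itself evaluates \<open>b\<close> at the
        identity, where it is 1.\<close>
      then have "?t A \<in> P \<union> ?t ` H" by (intro UnI2 imageI)
      moreover have "\<forall>f\<in>P \<union> ?t ` H. f A = 0" using A unfolding mem_Collect_eq by (rule conjunct2)
      ultimately have "?t A A = 0" by (rule bspec[rotated])
      then show False using b1 GL_inv(4)[OF subgroup_GL(1)[OF G AG]] GL_carrier[OF subgroup_GL(1)[OF G AG]] by simp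
    qed
    then show "A \<in> G - H" using AG by blast
  qed
  have "?t h \<in> poly_fun n" if "h \<in> H" for h
    by (rule poly_fun_translate[OF bp GL_inv(2)[OF subgroup_GL(1)[OF G subsetD[OF HG that]]]])
  then have "P \<union> ?t ` H \<subseteq> poly_fun n" using P(1) by (intro Un_least image_subsetI)
  then have Ccl: "zariski_closed n (G - H)"
    unfolding zariski_closed_def using compl by (intro exI[of _ "P \<union> ?t ` H"] conjI)
  have "G - H = {}"
  proof (rule ccontr)
    assume "G - H \<noteq> {}"
    moreover have "H \<noteq> {}" "H \<inter> (G - H) = {}" "H \<union> (G - H) = G" using H1 HG by auto
    ultimately show False using zc Hcl Ccl unfolding zariski_connected_def by meson
  qed
  then show ?thesis using g v H_iff by blast
qed

section \<open>Semisimple and nilpotent matrices\<close>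

lemma semisimple_elemE:
  assumes "semisimple_elem x" "x \<in> carrier_mat n n"
  obtains P P' D where "P \<in> carrier_mat n n" "P' \<in> carrier_mat n n" "D \<in> carrier_mat n n" "diagonal_mat D"
    "P * P' = 1\<^sub>m n" "P' * P = 1\<^sub>m n" "x = P * D * P'"
proof -
  obtain D where D: "diagonal_mat D" "similar_mat x D" using assms(1) by (auto simp: semisimple_elem_def)
  then obtain P P' where "similar_mat_wit x D P P'" by (auto simp: similar_mat_def)
  then show thesis using that[of P P' D] D(1) assms(2) by (auto simp: similar_mat_wit_def Let_def)
qed

lemma semisimple_elemI:
  assumes "x \<in> carrier_mat n n" "P \<in> carrier_mat n n" "P' \<in> carrier_mat n n" "D \<in> carrier_mat n n" "diagonal_mat D"
    "P * P' = 1\<^sub>m n" "P' * P = 1\<^sub>m n" "x = P * D * P'"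
  shows "semisimple_elem x"
  unfolding semisimple_elem_def similar_mat_def similar_mat_wit_def Let_def
  using assms by (intro exI[of _ D] conjI exI[of _ P] exI[of _ P']) auto

lemma diagonal_mult_left:
  assumes "D \<in> carrier_mat n n" "diagonal_mat D" "M \<in> carrier_mat n n" "i < n" "j < n"
  shows "(D * M) $$ (i, j) = D $$ (i, i) * M $$ (i, j)"
proof -
  have "(D * M) $$ (i, j) = (\<Sum>k<n. D $$ (i, k) * M $$ (k, j))"
    using assms by (simp add: scalar_prod_def lessThan_atLeast0)
  also have "\<dots> = (\<Sum>k<n. if k = i then D $$ (i, i) * M $$ (i, j) else 0)"
    using assms by (intro sum.cong) (auto simp: diagonal_mat_def)
  finally show ?thesis using assms by simp
qed

lemma diagonal_mult_right:
  assumes "D \<in> carrier_mat n n" "diagonal_mat D" "M \<in> carrier_mat n n" "i < n" "j < n"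
  shows "(M * D) $$ (i, j) = M $$ (i, j) * D $$ (j, j)"
proof -
  have "(M * D) $$ (i, j) = (\<Sum>k<n. M $$ (i, k) * D $$ (k, j))"
    using assms by (simp add: scalar_prod_def lessThan_atLeast0)
  also have "\<dots> = (\<Sum>k<n. if k = j then M $$ (i, j) * D $$ (j, j) else 0)"
    using assms by (intro sum.cong) (auto simp: diagonal_mat_def)
  finally show ?thesis using assms by simp
qed

text \<open>In eigenbases of \<open>x\<close> and \<open>y\<close> the operator sending
  \<open>Z\<close> to \<open>x Z - Z y\<close> multiplies the entry \<open>(i, j)\<close> by a
  difference of eigenvalues. It is thus diagonalizable, and its square has the same kernel.\<close>

lemma semisimple_sylvester:
  fixes x y Z :: "'k::field mat"
  assumes x: "semisimple_elem x" "x \<in> carrier_mat n n" and y: "semisimple_elem y" "y \<in> carrier_mat n n"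
    and Z: "Z \<in> carrier_mat n n"
    and 0: "x * (x * Z - Z * y) - (x * Z - Z * y) * y = 0\<^sub>m n n"
  shows "x * Z - Z * y = 0\<^sub>m n n"
proof -
  obtain P P' D where P: "P \<in> carrier_mat n n" "P' \<in> carrier_mat n n" "D \<in> carrier_mat n n" "diagonal_mat D"
    "P * P' = 1\<^sub>m n" "P' * P = 1\<^sub>m n" "x = P * D * P'" by (rule semisimple_elemE[OF x])
  obtain Q Q' E where Q: "Q \<in> carrier_mat n n" "Q' \<in> carrier_mat n n" "E \<in> carrier_mat n n" "diagonal_mat E"
    "Q * Q' = 1\<^sub>m n" "Q' * Q = 1\<^sub>m n" "y = Q * E * Q'" by (rule semisimple_elemE[OF y])
  have cancelP: "P' * (P * A) = A" "P * (P' * A) = A" if "A \<in> carrier_mat n n" for A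
    using assoc_mult_mat[OF P(2,1) that] assoc_mult_mat[OF P(1,2) that] that
    unfolding P(5,6) by simp_all
  have conj: "P' * (x * A - A * y) * Q = D * (P' * A * Q) - (P' * A * Q) * E" if A: "A \<in> carrier_mat n n" for A
  proof -
    have xA: "x * A \<in> carrier_mat n n" and Ay: "A * y \<in> carrier_mat n n" using A x(2) y(2) by auto
    have "P' * (x * A - A * y) * Q = (P' * (x * A) - P' * (A * y)) * Q"
      using mult_minus_distrib_mat[OF P(2) xA Ay] by simp
    also have "\<dots> = P' * (x * A) * Q - P' * (A * y) * Q"
      by (rule minus_mult_distrib_mat[of _ n n _ _ n]) (use P(2) Q(1) xA Ay in auto)
    also have "P' * (x * A) * Q = D * (P' * A * Q)"
      unfolding P(7) using A P(1-3) Q(1) cancelP(1) by (simp add: assoc_mult_mat[of _ n n _ n _ n])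
    also have "P' * (A * y) * Q = (P' * A * Q) * E"
      unfolding Q(7) using A P(1-3) Q(1-3) Q(6) by (simp add: assoc_mult_mat[of _ n n _ n _ n])
    finally show ?thesis .
  qed
  define W where "W = x * Z - Z * y"
  have Wc: "W \<in> carrier_mat n n" using x(2) y(2) Z by (simp add: W_def minus_carrier_mat)
  define V where "V = P' * W * Q"
  have Vc: "V \<in> carrier_mat n n" using P Q Wc by (simp add: V_def)
  have PZ: "P' * Z * Q \<in> carrier_mat n n" using P Q Z by simp
  have V: "V = D * (P' * Z * Q) - (P' * Z * Q) * E" unfolding V_def W_def using conj[OF Z] .
  have "D * V - V * E = P' * 0\<^sub>m n n * Q" using conj[OF Wc] 0 by (simp add: V_def W_def)
  also have "\<dots> = 0\<^sub>m n n" using P Q by simp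
  finally have DV: "D * V - V * E = 0\<^sub>m n n" .
  have "V $$ (i, j) = 0" if ij: "i < n" "j < n" for i j
  proof -
    have "(D * V - V * E) $$ (i, j) = 0" using DV ij by simp
    then have "(D $$ (i, i) - E $$ (j, j)) * V $$ (i, j) = 0"
      using ij P Q Vc diagonal_mult_left[OF P(3,4) Vc ij] diagonal_mult_right[OF Q(3,4) Vc ij]
      by (simp add: left_diff_distrib mult.commute del: index_mult_mat(1))
    moreover have "V $$ (i, j) = (D $$ (i, i) - E $$ (j, j)) * (P' * Z * Q) $$ (i, j)"
      using ij P Q PZ diagonal_mult_left[OF P(3,4) PZ ij] diagonal_mult_right[OF Q(3,4) PZ ij]
      unfolding V by (simp add: algebra_simps del: index_mult_mat(1))
    ultimately show ?thesis by auto
  qed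
  then have "V = 0\<^sub>m n n" using Vc by (intro eq_matI) auto
  then have "P * V * Q' = 0\<^sub>m n n" using P Q by simp
  moreover have "P * V * Q' = W"
    unfolding V_def using P Q Wc cancelP(2) by (simp add: assoc_mult_mat[of _ n n _ n _ n])
  ultimately show ?thesis by (simp add: W_def)
qed

text \<open>The operators \<open>S Z = y Z - Z y'\<close>, which is diagonalizable, and \<open>N Z = e Z - Z e'\<close>, which is nilpotent,
  commute, and \<open>S 1 = - N 1\<close>.\<close>

lemma jordan_unique:
  fixes y e y' e' :: "'k::field mat"
  assumes y: "semisimple_elem y" "y \<in> carrier_mat n n" and y': "semisimple_elem y'" "y' \<in> carrier_mat n n"
    and e: "nilpotent_elem n e" "e \<in> carrier_mat n n" and e': "nilpotent_elem n e'" "e' \<in> carrier_mat n n"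
    and c: "y * e = e * y" "y' * e' = e' * y'" and eq: "y + e = y' + e'"
  shows "y = y'" "e = e'"
proof -
  define S where "S Z = y * Z - Z * y'" for Z
  define N where "N Z = e * Z - Z * e'" for Z
  have Sc: "S Z \<in> carrier_mat n n" and Nc: "N Z \<in> carrier_mat n n" if "Z \<in> carrier_mat n n" for Z
    using that y(2) y'(2) e(2) e'(2) by (auto simp: S_def N_def intro!: minus_carrier_mat)
  have S1: "S (1\<^sub>m n) = y - y'" using y(2) y'(2) by (simp add: S_def)
  have N1: "N (1\<^sub>m n) = e - e'" using e(2) e'(2) by (simp add: N_def)
  have neg: "S (1\<^sub>m n) = (-1) \<cdot>\<^sub>m N (1\<^sub>m n)"
  proof (unfold S1 N1, intro eq_matI)
    fix i j assume ij: "i < dim_row ((-1) \<cdot>\<^sub>m (e - e'))" "j < dim_col ((-1) \<cdot>\<^sub>m (e - e'))"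
    have "(y + e) $$ (i, j) = (y' + e') $$ (i, j)" using eq by simp
    then show "(y - y') $$ (i, j) = ((-1) \<cdot>\<^sub>m (e - e')) $$ (i, j)"
      using ij y y' e e' by (simp add: algebra_simps)
  qed (use y y' e e' in auto)
  have dist: "a * (b - d) = a * b - a * d" "(b - d) * a = b * a - d * a"
    if "a \<in> carrier_mat n n" "b \<in> carrier_mat n n" "d \<in> carrier_mat n n" for a b d :: "'k mat"
    using mult_minus_distrib_mat[OF that(1,2,3)] minus_mult_distrib_mat[OF that(2,3,1)] by auto
  have SN: "S (N Z) = N (S Z)" if Z: "Z \<in> carrier_mat n n" for Z
  proof -
    have a1: "S (N Z) = (y * (e * Z) - y * (Z * e')) - (e * Z * y' - Z * e' * y')"
      unfolding S_def N_def using Z y(2) y'(2) e(2) e'(2) by (simp add: dist)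
    have a2: "N (S Z) = (e * (y * Z) - e * (Z * y')) - (y * Z * e' - Z * y' * e')"
      unfolding S_def N_def using Z y(2) y'(2) e(2) e'(2) by (simp add: dist)
    have b: "y * (e * Z) = e * (y * Z)" "Z * e' * y' = Z * y' * e'"
      using assoc_mult_mat[OF y(2) e(2) Z] assoc_mult_mat[OF e(2) y(2) Z]
        assoc_mult_mat[OF Z y'(2) e'(2)] assoc_mult_mat[OF Z e'(2) y'(2)] c by simp_all
    have c': "y * (Z * e') = y * Z * e'" "e * (Z * y') = e * Z * y'"
      using Z y(2) y'(2) e(2) e'(2) by simp_all
    have sw: "(p - q) - (r - s) = (p - r) - (q - s)"
      if "p \<in> carrier_mat n n" "q \<in> carrier_mat n n" "r \<in> carrier_mat n n" "s \<in> carrier_mat n n" for p q r s :: "'k mat"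
      using that by (intro eq_matI) auto
    show ?thesis unfolding a1 a2 b c' by (rule sw) (use Z y(2) y'(2) e(2) e'(2) in auto)
  qed
  have Ssm: "S (a \<cdot>\<^sub>m Z) = a \<cdot>\<^sub>m S Z" if Z: "Z \<in> carrier_mat n n" for a Z
  proof -
    have "y * (a \<cdot>\<^sub>m Z) = a \<cdot>\<^sub>m (y * Z)" "(a \<cdot>\<^sub>m Z) * y' = a \<cdot>\<^sub>m (Z * y')"
      using mult_smult_distrib[OF y(2) Z] mult_smult_assoc_mat[OF Z y'(2)] by auto
    then show ?thesis unfolding S_def using Z y(2) y'(2) by (intro eq_matI) (auto simp: algebra_simps simp del: index_mult_mat(1))
  qed
  have Npow: "(N ^^ r) (1\<^sub>m n) \<in> carrier_mat n n" for r by (induction r) (auto intro: Nc)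
  have SNr: "S ((N ^^ r) Z) = (N ^^ r) (S Z) \<and> (N ^^ r) Z \<in> carrier_mat n n" if "Z \<in> carrier_mat n n" for r Z
    using that by (induction r) (auto simp: SN Nc)
  have Nsm: "N (a \<cdot>\<^sub>m Z) = a \<cdot>\<^sub>m N Z" if Z: "Z \<in> carrier_mat n n" for a Z
  proof -
    have "e * (a \<cdot>\<^sub>m Z) = a \<cdot>\<^sub>m (e * Z)" "(a \<cdot>\<^sub>m Z) * e' = a \<cdot>\<^sub>m (Z * e')"
      using mult_smult_distrib[OF e(2) Z] mult_smult_assoc_mat[OF Z e'(2)] by auto
    then show ?thesis unfolding N_def using Z e(2) e'(2) by (intro eq_matI) (auto simp: algebra_simps simp del: index_mult_mat(1))
  qed
  have Nrsm: "(N ^^ r) (a \<cdot>\<^sub>m Z) = a \<cdot>\<^sub>m (N ^^ r) Z" if "Z \<in> carrier_mat n n" for r a Z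
    using that by (induction r) (auto simp: Nsm SNr)
  \<comment> \<open>\<open>S\<close> commutes with the powers of \<open>N\<close> and agrees with
    \<open>- N\<close> at 1, so powers of the two at 1 differ by a sign.\<close>
  have Spow: "\<exists>a. (S ^^ r) (1\<^sub>m n) = a \<cdot>\<^sub>m (N ^^ r) (1\<^sub>m n)" for r
  proof (induction r)
    case 0
    show ?case by (rule exI[of _ 1]) (intro eq_matI, auto)
  next
    case (Suc r)
    then obtain a where a: "(S ^^ r) (1\<^sub>m n) = a \<cdot>\<^sub>m (N ^^ r) (1\<^sub>m n)" by blast
    have "(S ^^ Suc r) (1\<^sub>m n) = a \<cdot>\<^sub>m (N ^^ r) (S (1\<^sub>m n))"
      using a Ssm[OF Npow] SNr[OF one_carrier_mat] by simp
    also have "\<dots> = a \<cdot>\<^sub>m ((-1) \<cdot>\<^sub>m (N ^^ r) (N (1\<^sub>m n)))"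
      unfolding neg using Nrsm[OF Nc[OF one_carrier_mat]] by simp
    also have "\<dots> = (- a) \<cdot>\<^sub>m (N ^^ Suc r) (1\<^sub>m n)"
      by (simp add: funpow_swap1) (intro eq_matI, auto)
    finally show ?case by blast
  qed
  obtain k where k: "e ^\<^sub>m k = 0\<^sub>m n n" using e(1) by (auto simp: nilpotent_elem_def)
  obtain l where l: "e' ^\<^sub>m l = 0\<^sub>m n n" using e'(1) by (auto simp: nilpotent_elem_def)
  have pow0: "x ^\<^sub>m i = 0\<^sub>m n n" if "x ^\<^sub>m k = 0\<^sub>m n n" "k \<le> i" "x \<in> carrier_mat n n" for x :: "'k mat" and i k
    using that(2) by (induction i rule: dec_induct) (use that in auto)
  have pc: "e ^\<^sub>m i \<in> carrier_mat n n" "e' ^\<^sub>m i \<in> carrier_mat n n" for i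
    using e(2) e'(2) by (auto intro: pow_carrier_mat)
  have ee: "e ^\<^sub>m i * e = e ^\<^sub>m Suc i" "e' * e' ^\<^sub>m i = e' ^\<^sub>m Suc i" for i
  proof -
    show "e ^\<^sub>m i * e = e ^\<^sub>m Suc i" by simp
    show "e' * e' ^\<^sub>m i = e' ^\<^sub>m Suc i"
    proof (induction i)
      case (Suc i)
      have "e' * e' ^\<^sub>m Suc i = e' * e' ^\<^sub>m i * e'"
        using assoc_mult_mat[OF e'(2) pc(2) e'(2)] by simp
      then show ?case unfolding Suc.IH by simp
    qed (use e'(2) in simp)
  qed
  \<comment> \<open>Each application of \<open>N\<close> puts a factor \<open>e\<close> on the left
    or \<open>e'\<close> on the right. Carrying both accumulated powers makes the induction close:
    when \<open>r\<close> is used up, \<open>k + l \<le> i + j\<close> forces one of the two powers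
    to vanish.\<close>
  have "e ^\<^sub>m i * (N ^^ r) (1\<^sub>m n) * e' ^\<^sub>m j = 0\<^sub>m n n" if "k + l \<le> i + j + r" for i j r
    using that
  proof (induction r arbitrary: i j)
    case 0
    then have "k \<le> i \<or> l \<le> j" by linarith
    then have "e ^\<^sub>m i = 0\<^sub>m n n \<or> e' ^\<^sub>m j = 0\<^sub>m n n" using pow0[OF k _ e(2)] pow0[OF l _ e'(2)] by blast
    then show ?case
      using right_mult_one_mat[OF pc(1)[of i]] left_mult_zero_mat[OF pc(2)[of j]] right_mult_zero_mat[OF pc(1)[of i]] by auto
  next
    case (Suc r)
    let ?Z = "(N ^^ r) (1\<^sub>m n)"
    note Z = Npow[of r]
    have "e ^\<^sub>m i * (N ^^ Suc r) (1\<^sub>m n) * e' ^\<^sub>m j = e ^\<^sub>m i * (e * ?Z - ?Z * e') * e' ^\<^sub>m j"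
      by (simp add: N_def)
    also have "\<dots> = e ^\<^sub>m i * (e * ?Z) * e' ^\<^sub>m j - e ^\<^sub>m i * (?Z * e') * e' ^\<^sub>m j"
    proof -
      have m: "e * ?Z \<in> carrier_mat n n" "?Z * e' \<in> carrier_mat n n" using Z e(2) e'(2) by auto
      show ?thesis unfolding dist(1)[OF pc(1) m]
        by (rule dist(2)[OF pc(2) mult_carrier_mat[OF pc(1) m(1)] mult_carrier_mat[OF pc(1) m(2)]])
    qed
    also have "e ^\<^sub>m i * (e * ?Z) * e' ^\<^sub>m j = e ^\<^sub>m Suc i * ?Z * e' ^\<^sub>m j"
      using Z pc e(2) unfolding ee(1)[symmetric] by (simp add: assoc_mult_mat[of _ n n _ n _ n])
    also have "\<dots> = 0\<^sub>m n n" using Suc.IH[of "Suc i" j] Suc.prems by simp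
    also have "e ^\<^sub>m i * (?Z * e') * e' ^\<^sub>m j = e ^\<^sub>m i * ?Z * e' ^\<^sub>m Suc j"
      using Z pc e'(2) unfolding ee(2)[symmetric] by (simp add: assoc_mult_mat[of _ n n _ n _ n])
    also have "\<dots> = 0\<^sub>m n n" using Suc.IH[of i "Suc j"] Suc.prems by simp
    finally show ?case by simp
  qed
  from this[of 0 0 "k + l"] have "(N ^^ (k + l)) (1\<^sub>m n) = 0\<^sub>m n n"
    using left_mult_one_mat[OF Npow[of "k + l"]] right_mult_one_mat[OF Npow[of "k + l"]] e(2) e'(2) by simp
  then have S0: "(S ^^ (k + l)) (1\<^sub>m n) = 0\<^sub>m n n" using Spow[of "k + l"] by auto
  have syl: "S W = 0\<^sub>m n n" if "W \<in> carrier_mat n n" "S (S W) = 0\<^sub>m n n" for W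
    using semisimple_sylvester[OF y y' that(1)] that(2) unfolding S_def by blast
  \<comment> \<open>\<open>S\<close> and its square have the same kernel, so a vanishing power at 1
    descends to the first power. Power 0 can vanish only if 1 and 0 coincide.\<close>
  have red: "(S ^^ r) (1\<^sub>m n) = 0\<^sub>m n n \<Longrightarrow> S (1\<^sub>m n) = 0\<^sub>m n n" for r
  proof (induction r)
    case 0
    then have "S (1\<^sub>m n) = S (0\<^sub>m n n)" by simp
    then show ?case using y(2) y'(2) by (simp add: S_def)
  next
    case (Suc r)
    show ?case
    proof (cases r)
      case 0
      show ?thesis using Suc.prems unfolding 0 funpow.simps o_apply id_apply .
    next
      case s: (Suc s)
      have "(S ^^ s) (1\<^sub>m n) \<in> carrier_mat n n" by (induction s) (auto intro: Sc)
      moreover have "S (S ((S ^^ s) (1\<^sub>m n))) = 0\<^sub>m n n"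
        using Suc.prems unfolding s funpow.simps o_apply .
      ultimately have "S ((S ^^ s) (1\<^sub>m n)) = 0\<^sub>m n n" by (rule syl)
      then have "(S ^^ r) (1\<^sub>m n) = 0\<^sub>m n n" unfolding s funpow.simps o_apply .
      then show ?thesis by (rule Suc.IH)
    qed
  qed
  have z: "y - y' = 0\<^sub>m n n" using red[OF S0] unfolding S1 .
  show yy: "y = y'"
  proof (intro eq_matI)
    fix i j assume "i < dim_row y'" "j < dim_col y'"
    then show "y $$ (i, j) = y' $$ (i, j)" using arg_cong[OF z, of "\<lambda>M. M $$ (i, j)"] y y' by simp
  qed (use y y' in auto)
  show "e = e'"
  proof (intro eq_matI)
    fix i j assume "i < dim_row e'" "j < dim_col e'"
    then show "e $$ (i, j) = e' $$ (i, j)" using arg_cong[OF eq, of "\<lambda>M. M $$ (i, j)"] yy y' e e' by simp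
  qed (use e e' in auto)
qed

section \<open>Sums of commuting semisimple matrices\<close>

lemma diagonal_mat_mk: "diagonal_mat (mat n n (\<lambda>(i, j). if i = j then f i else 0))"
  by (auto simp: diagonal_mat_def)

lemma mult_diagonal_columns:
  assumes "M \<in> carrier_mat n n"
  shows "M * mat n n (\<lambda>(i, j). if i = j then f i else 0) = mat n n (\<lambda>(i, j). M $$ (i, j) * f j)"
proof (intro eq_matI)
  fix i j assume ij: "i < dim_row (mat n n (\<lambda>(i, j). M $$ (i, j) * f j))" "j < dim_col (mat n n (\<lambda>(i, j). M $$ (i, j) * f j))"
  then show "(M * mat n n (\<lambda>(i, j). if i = j then f i else 0)) $$ (i, j) = mat n n (\<lambda>(i, j). M $$ (i, j) * f j) $$ (i, j)"
    using diagonal_mult_right[OF mat_carrier diagonal_mat_mk[of n f] assms, of i j] by simp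
qed (use assms in auto)

text \<open>Replacing a column by its components in the eigenspaces of \<open>D\<close>, one of the resulting
  determinants must be nonzero because the determinant is additive in that column.\<close>

lemma eigencolumns_step:
  fixes M D Z :: "'k::field mat"
  assumes M: "M \<in> carrier_mat n n" "det M \<noteq> 0" and k: "k < n"
    and Z: "Z \<in> carrier_mat n n" and ZM: "\<And>i j. i < n \<Longrightarrow> j < n \<Longrightarrow> (\<Sum>l<n. Z $$ (i, l) * M $$ (l, j)) = M $$ (i, j) * \<epsilon> j"
    and comm: "\<And>i j. i < n \<Longrightarrow> j < n \<Longrightarrow> \<delta> i \<noteq> \<delta> j \<Longrightarrow> Z $$ (i, j) = 0"
  shows "\<exists>M' \<nu>. M' \<in> carrier_mat n n \<and> det M' \<noteq> 0 \<and>
     (\<forall>i<n. \<forall>j<n. (\<Sum>l<n. Z $$ (i, l) * M' $$ (l, j)) = M' $$ (i, j) * \<epsilon> j) \<and>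
     (\<forall>i<n. \<forall>j<n. j \<noteq> k \<longrightarrow> M' $$ (i, j) = M $$ (i, j)) \<and>
     (\<forall>i<n. \<delta> i * M' $$ (i, k) = \<nu> * M' $$ (i, k))"
proof -
  define C where "C \<nu> = mat n n (\<lambda>(i, j). if j = k \<and> \<delta> i \<noteq> \<nu> then 0 else M $$ (i, j))" for \<nu>
  have Cc: "C \<nu> \<in> carrier_mat n n" for \<nu> by (simp add: C_def)
  have cof: "cofactor (C \<nu>) i k = cofactor M i k" if "i < n" for i \<nu>
  proof -
    have "mat_delete (C \<nu>) i k = mat_delete M i k"
      using M(1) k that by (intro eq_matI) (auto simp: mat_delete_def C_def)
    then show ?thesis by (simp add: cofactor_def)
  qed
  have "det M = (\<Sum>i<n. M $$ (i, k) * cofactor M i k)" by (rule laplace_expansion_column[OF M(1) k])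
  also have "\<dots> = (\<Sum>i<n. \<Sum>\<nu>\<in>\<delta> ` {..<n}. C \<nu> $$ (i, k) * cofactor M i k)"
  proof (intro sum.cong refl)
    fix i assume "i \<in> {..<n}"
    then have "(\<Sum>\<nu>\<in>\<delta> ` {..<n}. C \<nu> $$ (i, k) * cofactor M i k)
        = (\<Sum>\<nu>\<in>\<delta> ` {..<n}. if \<nu> = \<delta> i then M $$ (i, k) * cofactor M i k else 0)"
      using k by (intro sum.cong refl) (auto simp: C_def)
    also have "\<dots> = M $$ (i, k) * cofactor M i k" using \<open>i \<in> {..<n}\<close> by simp
    finally show "M $$ (i, k) * cofactor M i k = (\<Sum>\<nu>\<in>\<delta> ` {..<n}. C \<nu> $$ (i, k) * cofactor M i k)" by simp
  qed
  also have "\<dots> = (\<Sum>\<nu>\<in>\<delta> ` {..<n}. \<Sum>i<n. C \<nu> $$ (i, k) * cofactor M i k)" by (rule sum.swap)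
  also have "\<dots> = (\<Sum>\<nu>\<in>\<delta> ` {..<n}. det (C \<nu>))"
    by (intro sum.cong refl) (simp add: laplace_expansion_column[OF Cc k] cof)
  finally have "(\<Sum>\<nu>\<in>\<delta> ` {..<n}. det (C \<nu>)) \<noteq> 0" using M(2) by simp
  then obtain \<nu> where \<nu>: "det (C \<nu>) \<noteq> 0" by (meson sum.neutral)
  have "(\<Sum>l<n. Z $$ (i, l) * C \<nu> $$ (l, j)) = C \<nu> $$ (i, j) * \<epsilon> j" if ij: "i < n" "j < n" for i j
  proof (cases "j = k")
    case False
    then show ?thesis using ZM[OF ij] ij by (simp add: C_def)
  next
    case True
    \<comment> \<open>Entries of \<open>Z\<close> between different values of
      \<open>\<delta>\<close> vanish, so \<open>Z\<close> preserves the chosen component and the new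
      column keeps its eigenvalue \<open>\<epsilon> k\<close>.\<close>
    show ?thesis
    proof (cases "\<delta> i = \<nu>")
      case l: True
      have "(\<Sum>l<n. Z $$ (i, l) * C \<nu> $$ (l, j)) = (\<Sum>l<n. Z $$ (i, l) * M $$ (l, j))"
        using ij comm[OF ij(1)] l by (intro sum.cong refl) (auto simp: C_def)
      then show ?thesis using ZM[OF ij] ij l by (simp add: C_def)
    next
      case l: False
      have "(\<Sum>l<n. Z $$ (i, l) * C \<nu> $$ (l, j)) = 0"
        using ij comm[OF ij(1)] l True by (intro sum.neutral) (auto simp: C_def)
      then show ?thesis using ij l True by (simp add: C_def)
    qed
  qed
  then show ?thesis using \<nu> k by (intro exI[of _ "C \<nu>"] exI[of _ \<nu>]) (auto simp: C_def)
qed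

text \<open>Simultaneous diagonalization without invariant subspaces: in coordinates where
  \<open>x\<close> is diagonal, an eigenbasis of \<open>y\<close> is changed column by column into a
  common eigenbasis.\<close>

lemma semisimple_add:
  fixes x y :: "'k::field mat"
  assumes x: "semisimple_elem x" "x \<in> carrier_mat n n" and y: "semisimple_elem y" "y \<in> carrier_mat n n"
    and comm: "x * y = y * x"
  shows "semisimple_elem (x + y)"
proof -
  obtain P P' D where P: "P \<in> carrier_mat n n" "P' \<in> carrier_mat n n" "D \<in> carrier_mat n n" "diagonal_mat D"
    "P * P' = 1\<^sub>m n" "P' * P = 1\<^sub>m n" "x = P * D * P'" by (rule semisimple_elemE[OF x])
  obtain Q Q' E where Q: "Q \<in> carrier_mat n n" "Q' \<in> carrier_mat n n" "E \<in> carrier_mat n n" "diagonal_mat E"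
    "Q * Q' = 1\<^sub>m n" "Q' * Q = 1\<^sub>m n" "y = Q * E * Q'" by (rule semisimple_elemE[OF y])
  have cancelP: "P' * (P * A) = A" "P * (P' * A) = A" if "A \<in> carrier_mat n n" for A
    using assoc_mult_mat[OF P(2,1) that] assoc_mult_mat[OF P(1,2) that] that unfolding P(5,6) by simp_all
  have cancelQ: "Q' * (Q * A) = A" if "A \<in> carrier_mat n n" for A
    using assoc_mult_mat[OF Q(2,1) that] that unfolding Q(6) by simp
  define Z where "Z = P' * y * P"
  have Zc: "Z \<in> carrier_mat n n" using P(1,2) y(2) by (simp add: Z_def)
  have DZ: "D * Z = Z * D"
  proof -
    have D: "D = P' * x * P" unfolding P(7) using P(1-3) cancelP by (simp add: P(6))
    have "D * Z = P' * (x * y) * P"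
      unfolding D Z_def using P(1,2) x(2) y(2) cancelP(2) by (simp add: assoc_mult_mat[of _ n n _ n _ n])
    also have "\<dots> = Z * D"
      unfolding D Z_def comm using P(1,2) x(2) y(2) cancelP(2) by (simp add: assoc_mult_mat[of _ n n _ n _ n])
    finally show ?thesis .
  qed
  let ?\<delta> = "\<lambda>i. D $$ (i, i)" and ?\<epsilon> = "\<lambda>j. E $$ (j, j)"
  have comm0: "Z $$ (i, j) = 0" if "i < n" "j < n" "?\<delta> i \<noteq> ?\<delta> j" for i j
  proof -
    have "(D * Z) $$ (i, j) = (Z * D) $$ (i, j)" using DZ by simp
    then show ?thesis
      using diagonal_mult_left[OF P(3,4) Zc that(1,2)] diagonal_mult_right[OF P(3,4) Zc that(1,2)] that(3) by simp
  qed
  have entry: "(A * B) $$ (i, j) = (\<Sum>l<n. A $$ (i, l) * B $$ (l, j))"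
    if "A \<in> carrier_mat n n" "B \<in> carrier_mat n n" "i < n" "j < n" for A B :: "'k mat" and i j
    using that by (simp add: scalar_prod_def lessThan_atLeast0)
  \<comment> \<open>The columns of \<open>M\<close> are a basis of eigenvectors of \<open>Z\<close>,
    the first \<open>k\<close> of which are eigenvectors of \<open>D\<close> too. For
    \<open>k = 0\<close> it is the eigenbasis of \<open>y\<close> written in the eigenbasis of
    \<open>x\<close>.\<close>
  have "\<exists>M. M \<in> carrier_mat n n \<and> det M \<noteq> 0 \<and>
     (\<forall>i<n. \<forall>j<n. (\<Sum>l<n. Z $$ (i, l) * M $$ (l, j)) = M $$ (i, j) * ?\<epsilon> j) \<and>
     (\<forall>j<k. \<exists>\<nu>. \<forall>i<n. ?\<delta> i * M $$ (i, j) = \<nu> * M $$ (i, j))" if "k \<le> n" for k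
    using that
  proof (induction k)
    case 0
    let ?M = "P' * Q"
    have Mc: "?M \<in> carrier_mat n n" using P Q by simp
    have "det P' * det P = 1" "det Q' * det Q = 1"
      using det_mult[OF P(2,1)] det_mult[OF Q(2,1)] P(6) Q(6) by simp_all
    then have "det ?M \<noteq> 0" using det_mult[OF P(2) Q(1)] by auto
    moreover have ZE: "Z * ?M = ?M * E"
      unfolding Z_def Q(7) using P(1,2) Q(1-3) cancelP cancelQ Q(6) by (simp add: assoc_mult_mat[of _ n n _ n _ n])
    have "(\<Sum>l<n. Z $$ (i, l) * ?M $$ (l, j)) = ?M $$ (i, j) * ?\<epsilon> j" if "i < n" "j < n" for i j
      using entry[OF Zc Mc that] diagonal_mult_right[OF Q(3,4) Mc that] ZE by simp
    ultimately show ?case using Mc by blast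
  next
    case (Suc k)
    then obtain M where M: "M \<in> carrier_mat n n" "det M \<noteq> 0"
      "\<And>i j. i < n \<Longrightarrow> j < n \<Longrightarrow> (\<Sum>l<n. Z $$ (i, l) * M $$ (l, j)) = M $$ (i, j) * ?\<epsilon> j"
      "\<And>j. j < k \<Longrightarrow> \<exists>\<nu>. \<forall>i<n. ?\<delta> i * M $$ (i, j) = \<nu> * M $$ (i, j)" by auto
    obtain M' \<nu> where M': "M' \<in> carrier_mat n n" "det M' \<noteq> 0"
      "\<forall>i<n. \<forall>j<n. (\<Sum>l<n. Z $$ (i, l) * M' $$ (l, j)) = M' $$ (i, j) * ?\<epsilon> j"
      "\<forall>i<n. \<forall>j<n. j \<noteq> k \<longrightarrow> M' $$ (i, j) = M $$ (i, j)"
      "\<forall>i<n. ?\<delta> i * M' $$ (i, k) = \<nu> * M' $$ (i, k)"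
      using eigencolumns_step[where \<delta>="?\<delta>" and \<epsilon>="?\<epsilon>", OF M(1,2) _ Zc M(3) comm0, of k] Suc.prems by auto
    have "\<exists>\<nu>. \<forall>i<n. ?\<delta> i * M' $$ (i, j) = \<nu> * M' $$ (i, j)" if "j < Suc k" for j
    proof (cases "j = k")
      case True
      then show ?thesis using M'(5) by blast
    next
      case False
      then show ?thesis using M(4)[of j] M'(4) that Suc.prems by auto
    qed
    then show ?case using M'(1-3) by blast
  qed
  from this[of n] obtain M where M: "M \<in> carrier_mat n n" "det M \<noteq> 0"
    "\<And>i j. i < n \<Longrightarrow> j < n \<Longrightarrow> (\<Sum>l<n. Z $$ (i, l) * M $$ (l, j)) = M $$ (i, j) * ?\<epsilon> j"
    "\<forall>j. \<exists>\<nu>. j < n \<longrightarrow> (\<forall>i<n. ?\<delta> i * M $$ (i, j) = \<nu> * M $$ (i, j))" by auto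
  from choice[OF M(4)] obtain \<mu> where \<mu>: "\<And>i j. i < n \<Longrightarrow> j < n \<Longrightarrow> ?\<delta> i * M $$ (i, j) = \<mu> j * M $$ (i, j)" by auto
  have MG: "M \<in> carrier (GL n)" using M by (simp add: GL_iff)
  let ?M' = "GL_inv n M" and ?F = "mat n n (\<lambda>(i, j). if i = j then \<mu> i + ?\<epsilon> i else 0)"
  note M' = GL_inv(2-4)[OF MG]
  have DZM: "(D + Z) * M = M * ?F"
    unfolding mult_diagonal_columns[OF M(1)]
  proof (intro eq_matI)
    fix i j assume "i < dim_row (mat n n (\<lambda>(i, j). M $$ (i, j) * (\<mu> j + ?\<epsilon> j)))" "j < dim_col (mat n n (\<lambda>(i, j). M $$ (i, j) * (\<mu> j + ?\<epsilon> j)))"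
    then have ij: "i < n" "j < n" by auto
    have "((D + Z) * M) $$ (i, j) = (D * M) $$ (i, j) + (Z * M) $$ (i, j)"
      using add_mult_distrib_mat[OF P(3) Zc M(1)] ij P(3) Zc M(1) by (simp del: index_mult_mat(1))
    also have "\<dots> = M $$ (i, j) * (\<mu> j + ?\<epsilon> j)"
      using diagonal_mult_left[OF P(3,4) M(1) ij] \<mu>[OF ij] entry[OF Zc M(1) ij] M(3)[OF ij]
      by (simp add: algebra_simps del: index_mult_mat(1))
    finally show "((D + Z) * M) $$ (i, j) = mat n n (\<lambda>(i, j). M $$ (i, j) * (\<mu> j + ?\<epsilon> j)) $$ (i, j)" using ij by simp
  qed (use P(3) Zc M(1) in auto)
  have Fc: "?F \<in> carrier_mat n n" by simp
  have DZc: "D + Z \<in> carrier_mat n n" using P(3) Zc by simp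
  have "D + Z = (D + Z) * (M * ?M')" using right_mult_one_mat[OF DZc] M'(2) by simp
  also have "\<dots> = M * ?F * ?M'" unfolding assoc_mult_mat[OF DZc M(1) M'(1), symmetric] DZM ..
  finally have DZ': "D + Z = M * ?F * ?M'" .
  have xy: "x + y = P * (D + Z) * P'"
  proof -
    have "P * (D + Z) * P' = (P * D + P * Z) * P'" using mult_add_distrib_mat[OF P(1,3) Zc] by simp
    also have "\<dots> = P * D * P' + P * Z * P'"
      by (rule add_mult_distrib_mat[of _ n n _ _ n]) (use P Zc in auto)
    also have "P * Z * P' = y"
      unfolding Z_def using P(1,2) y(2) cancelP P(5) by simp
    finally show ?thesis using P(7) by simp
  qed
  show ?thesis
  proof (rule semisimple_elemI[of _ n "P * M" "?M' * P'" ?F])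
    show "P * M * (?M' * P') = 1\<^sub>m n"
      using mat_assoc4[OF P(1) M(1) M'(1) P(2)] M'(2) P(1,2,5) by simp
    show "?M' * P' * (P * M) = 1\<^sub>m n"
      using mat_assoc4[OF M'(1) P(2,1) M(1)] M'(1,3) P(6) by simp
    have "P * (M * F * ?M') * P' = P * M * F * (?M' * P')" if "F \<in> carrier_mat n n" for F
      using P(1,2) M(1) M'(1) that by (simp add: assoc_mult_mat[of _ n n _ n _ n])
    then show "x + y = P * M * ?F * (?M' * P')" unfolding xy DZ' using Fc .
    show "diagonal_mat ?F" by (rule diagonal_mat_mk)
  qed (use P(1,2) M(1) M'(1) x(2) y(2) in auto)
qed

section \<open>Common eigenvectors and roots\<close>

text \<open>One step of Horner's scheme for \<open>p(f) u\<close>. \<open>fold_coeffs\<close>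
  performs no step at \<open>pCons 0 0\<close>, and there \<open>f0\<close> is what makes both sides
  agree.\<close>

lemma fold_coeffs_operator:
  fixes u :: "'k::field mat"
  assumes "u \<in> carrier_mat n n" and f0: "f (0\<^sub>m n n) = 0\<^sub>m n n"
  shows "fold_coeffs (\<lambda>a w. a \<cdot>\<^sub>m u + f w) (pCons a p) (0\<^sub>m n n)
    = a \<cdot>\<^sub>m u + f (fold_coeffs (\<lambda>a w. a \<cdot>\<^sub>m u + f w) p (0\<^sub>m n n))"
proof (cases "a = 0 \<and> p = 0")
  case True
  have "(0::'k) \<cdot>\<^sub>m u + 0\<^sub>m n n = 0\<^sub>m n n" using assms(1) by (intro eq_matI) auto
  then show ?thesis using True f0 by simp
next
  case False
  then show ?thesis by (cases "p = 0") auto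
qed

text \<open>The values \<open>p(f) u\<close> form a finitely generated space, so some nonzero
  polynomial annihilates \<open>u\<close>. For \<open>q\<close> of least degree with root
  \<open>x\<close>, write \<open>q = (X - x) r\<close>: then \<open>r(f) u\<close> is nonzero by
  minimality and is an eigenvector.\<close>

lemma eigenvector_exists:
  fixes U :: "'k::alg_closed_field mat set"
  assumes U: "mat_subspace n U" and u: "u \<in> U" "u \<noteq> 0\<^sub>m n n"
    and fU: "\<And>w. w \<in> U \<Longrightarrow> f w \<in> U"
    and add: "\<And>v w. v \<in> U \<Longrightarrow> w \<in> U \<Longrightarrow> f (v + w) = f v + f w"
    and smult: "\<And>c w. w \<in> U \<Longrightarrow> f (c \<cdot>\<^sub>m w) = c \<cdot>\<^sub>m f w"
  shows "\<exists>w\<in>U. \<exists>c. w \<noteq> 0\<^sub>m n n \<and> f w = c \<cdot>\<^sub>m w"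
proof -
  note Uc = mat_subspaceD(1)[OF U] and Us = mat_subspaceD(2-4)[OF U]
  have z: "0 \<cdot>\<^sub>m w = 0\<^sub>m n n" if "w \<in> U" for w using Uc[OF that] by (intro eq_matI) auto
  have f0: "f (0\<^sub>m n n) = 0\<^sub>m n n" using smult[OF u(1), of 0] z[OF u(1)] z[OF fU[OF u(1)]] by simp
  define ev where "ev p = fold_coeffs (\<lambda>a w. a \<cdot>\<^sub>m u + f w) p (0\<^sub>m n n)" for p
  have ev0: "ev 0 = 0\<^sub>m n n" by (simp add: ev_def)
  have ev1: "ev (pCons a p) = a \<cdot>\<^sub>m u + f (ev p)" for a p
    unfolding ev_def by (rule fold_coeffs_operator[where f=f, OF Uc[OF u(1)] f0])
  have evU: "ev p \<in> U" for p
    by (induction p) (auto simp: ev0 ev1 intro!: Us fU u)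
  have ev_add: "ev (p + q) = ev p + ev q" for p q
  proof (induction p q rule: poly_induct2)
    case 0
    show ?case by (simp add: ev0)
  next
    case (pCons a p b q)
    have "ev (pCons a p + pCons b q) = (a + b) \<cdot>\<^sub>m u + (f (ev p) + f (ev q))"
      by (simp add: ev1 pCons.IH add[OF evU evU])
    also have "\<dots> = ev (pCons a p) + ev (pCons b q)"
      unfolding ev1 using Uc[OF u(1)] Uc[OF fU[OF evU[of p]]] Uc[OF fU[OF evU[of q]]]
      by (intro eq_matI) (auto simp: algebra_simps)
    finally show ?case .
  qed
  have ev_smult: "ev (Polynomial.smult c p) = c \<cdot>\<^sub>m ev p" for c p
  proof (induction p)
    case 0
    show ?case by (simp add: ev0)
  next
    case (pCons a p)
    have "ev (Polynomial.smult c (pCons a p)) = (c * a) \<cdot>\<^sub>m u + c \<cdot>\<^sub>m f (ev p)"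
      by (simp add: ev1 pCons.IH smult[OF evU])
    also have "\<dots> = c \<cdot>\<^sub>m ev (pCons a p)"
      unfolding ev1 using Uc[OF u(1)] Uc[OF fU[OF evU[of p]]] by (intro eq_matI) (auto simp: algebra_simps)
    finally show ?case .
  qed
  have sub: "mat_subspace n (ev ` Q)" if "0 \<in> Q" "\<And>p q. p \<in> Q \<Longrightarrow> q \<in> Q \<Longrightarrow> p + q \<in> Q"
    "\<And>c p. p \<in> Q \<Longrightarrow> Polynomial.smult c p \<in> Q" for Q
    unfolding mat_subspace_def
  proof (intro conjI ballI allI)
    show "ev ` Q \<subseteq> carrier_mat n n" using Uc evU by blast
    show "0\<^sub>m n n \<in> ev ` Q" using that(1) ev0 by (metis imageI)
    show "x + y \<in> ev ` Q" if "x \<in> ev ` Q" "y \<in> ev ` Q" for x y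
      using that \<open>\<And>p q. p \<in> Q \<Longrightarrow> q \<in> Q \<Longrightarrow> p + q \<in> Q\<close> by (auto simp flip: ev_add)
    show "c \<cdot>\<^sub>m x \<in> ev ` Q" if "x \<in> ev ` Q" for c x
      using that \<open>\<And>c p. p \<in> Q \<Longrightarrow> Polynomial.smult c p \<in> Q\<close> by (auto simp flip: ev_smult)
  qed
  have "mat_subspace n (range ev)" by (rule sub) auto
  then obtain S where S: "finite S" "S \<subseteq> range ev" "\<And>W. mat_subspace n W \<Longrightarrow> S \<subseteq> W \<Longrightarrow> range ev \<subseteq> W"
    by (rule subspace_finitely_generated) blast
  \<comment> \<open>One degree bound serves all generators. Hence the value at \<open>X^K\<close> is
    also the value at a polynomial of degree below \<open>K\<close>, and the difference is a monic
    annihilating polynomial.\<close>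
  have "\<exists>K::nat. S \<subseteq> ev ` {p. \<forall>i\<ge>K. poly.coeff p i = 0}"
    using S(1,2)
  proof (induction S)
    case (insert s S)
    then obtain K p where K: "S \<subseteq> ev ` {p. \<forall>i\<ge>K. poly.coeff p i = 0}" and p: "s = ev p" by auto
    let ?K = "max K (Suc (Polynomial.degree p))"
    have "ev ` {p. \<forall>i\<ge>K. poly.coeff p i = 0} \<subseteq> ev ` {p. \<forall>i\<ge>?K. poly.coeff p i = 0}" by auto
    moreover have "p \<in> {p. \<forall>i\<ge>?K. poly.coeff p i = 0}" by (auto intro: coeff_eq_0)
    ultimately have "insert s S \<subseteq> ev ` {p. \<forall>i\<ge>?K. poly.coeff p i = 0}" using K p by blast
    then show ?case by blast
  qed simp
  then obtain K where K: "S \<subseteq> ev ` {p. \<forall>i\<ge>K. poly.coeff p i = 0}" by blast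
  have "range ev \<subseteq> ev ` {p. \<forall>i\<ge>K. poly.coeff p i = 0}"
    by (rule S(3)[OF sub K]) auto
  then obtain p where p: "\<forall>i\<ge>K. poly.coeff p i = 0" "ev (Polynomial.monom 1 K) = ev p" by blast
  let ?q = "Polynomial.monom 1 K + Polynomial.smult (-1) p"
  have "poly.coeff ?q K = 1" using p(1) by simp
  then have "?q \<noteq> 0" by (metis coeff_0 zero_neq_one)
  moreover have "ev ?q = 0\<^sub>m n n"
    unfolding ev_add ev_smult p(2) using Uc[OF evU[of p]] by (intro eq_matI) auto
  ultimately have ex: "?q \<noteq> 0 \<and> ev ?q = 0\<^sub>m n n" by blast
  obtain q where q: "q \<noteq> 0" "ev q = 0\<^sub>m n n"
    and least: "\<And>r. r \<noteq> 0 \<Longrightarrow> ev r = 0\<^sub>m n n \<Longrightarrow> Polynomial.degree q \<le> Polynomial.degree r"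
    using ex_has_least_nat[of "\<lambda>q. q \<noteq> 0 \<and> ev q = 0\<^sub>m n n", OF ex, of Polynomial.degree] by blast
  have "Polynomial.degree q > 0"
  proof (rule ccontr)
    assume "\<not> Polynomial.degree q > 0"
    then obtain a where a: "q = [:a:]" using degree_eq_zeroE by auto
    then have "a \<cdot>\<^sub>m u + 0\<^sub>m n n = 0\<^sub>m n n" "a \<noteq> 0" using q ev1[of a 0] by (auto simp: ev0 f0)
    then have "a \<cdot>\<^sub>m u = 0\<^sub>m n n" using Uc[OF u(1)] by simp
    then have "inverse a \<cdot>\<^sub>m (a \<cdot>\<^sub>m u) = 0\<^sub>m n n" by simp
    moreover have "inverse a \<cdot>\<^sub>m (a \<cdot>\<^sub>m u) = u" using \<open>a \<noteq> 0\<close> by (intro eq_matI) auto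
    ultimately show False using u(2) by simp
  qed
  then obtain x where "poly q x = 0" using alg_closed_imp_poly_has_root by blast
  then obtain r where r: "q = [:-x, 1:] * r" by (auto simp: poly_eq_0_iff_dvd)
  have r0: "r \<noteq> 0" using q(1) r by auto
  then have "Polynomial.degree q = Suc (Polynomial.degree r)" unfolding r by (subst degree_mult_eq) auto
  then have w0: "ev r \<noteq> 0\<^sub>m n n" using least[OF r0] by auto
  \<comment> \<open>\<open>pCons 0\<close> is multiplication by the variable, which
    \<open>ev\<close> turns into an application of \<open>f\<close>.\<close>
  have "q = pCons 0 r + Polynomial.smult (-x) r" unfolding r by simp
  then have "0\<^sub>m n n = ev (pCons 0 r) + (-x) \<cdot>\<^sub>m ev r" using q(2) ev_add ev_smult by metis
  then have e: "0\<^sub>m n n = 0 \<cdot>\<^sub>m u + f (ev r) + (-x) \<cdot>\<^sub>m ev r" unfolding ev1 .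
  have "f (ev r) = x \<cdot>\<^sub>m ev r"
  proof (intro eq_matI)
    fix i j assume "i < dim_row (x \<cdot>\<^sub>m ev r)" "j < dim_col (x \<cdot>\<^sub>m ev r)"
    then show "f (ev r) $$ (i, j) = (x \<cdot>\<^sub>m ev r) $$ (i, j)"
      using arg_cong[OF e, of "\<lambda>M. M $$ (i, j)"] Uc[OF evU[of r]] Uc[OF fU[OF evU[of r]]] Uc[OF u(1)]
      by (simp add: algebra_simps)
  qed (use Uc[OF evU[of r]] Uc[OF fU[OF evU[of r]]] in auto)
  then show ?thesis using w0 evU by blast
qed

section \<open>Bilinearity of the bracket and commuting adjoint operators\<close>

lemma bracket_add_right:
  assumes "h \<in> carrier_mat n n" "x \<in> carrier_mat n n" "y \<in> carrier_mat n n"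
  shows "bracket h (x + y) = bracket h x + bracket (h :: 'k::field mat) y"
proof -
  have "bracket h (x + y) = (h * x + h * y) - (x * h + y * h)"
    unfolding bracket_def using mult_add_distrib_mat[OF assms] add_mult_distrib_mat[OF assms(2,3,1)] by simp
  also have "\<dots> = bracket h x + bracket h y"
    unfolding bracket_def using assms by (intro eq_matI) (auto simp: algebra_simps simp del: index_mult_mat(1))
  finally show ?thesis .
qed

lemma bracket_smult_right:
  assumes "h \<in> carrier_mat n n" "x \<in> carrier_mat n n"
  shows "bracket h (c \<cdot>\<^sub>m x) = c \<cdot>\<^sub>m bracket (h :: 'k::field mat) x"
proof -
  have "bracket h (c \<cdot>\<^sub>m x) = c \<cdot>\<^sub>m (h * x) - c \<cdot>\<^sub>m (x * h)"
    unfolding bracket_def using mult_smult_distrib[OF assms] mult_smult_assoc_mat[OF assms(2,1)] by simp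
  also have "\<dots> = c \<cdot>\<^sub>m bracket h x"
    unfolding bracket_def using assms by (intro eq_matI) (auto simp: algebra_simps simp del: index_mult_mat(1))
  finally show ?thesis .
qed

lemma bracket_swap:
  assumes "h \<in> carrier_mat n n" "x \<in> carrier_mat n n"
  shows "bracket h x = (-1) \<cdot>\<^sub>m bracket x (h :: 'k::field mat)"
  unfolding bracket_def using assms by (intro eq_matI) (auto simp del: index_mult_mat(1))

lemma bracket_add_left:
  assumes "h \<in> carrier_mat n n" "k \<in> carrier_mat n n" "x \<in> carrier_mat n n"
  shows "bracket (h + k) x = bracket h x + bracket (k :: 'k::field mat) x"
proof -
  have "bracket (h + k) x = (-1) \<cdot>\<^sub>m (bracket x h + bracket x k)"
    using bracket_swap[of "h + k" n x] bracket_add_right[OF assms(3,1,2)] assms by simp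
  also have "\<dots> = bracket h x + bracket k x"
    unfolding bracket_swap[OF assms(1,3)] bracket_swap[OF assms(2,3)]
    using add_smult_distrib_left_mat[OF bracket_carrier[OF assms(3,1)] bracket_carrier[OF assms(3,2)]] .
  finally show ?thesis .
qed

lemma bracket_smult_left:
  assumes "h \<in> carrier_mat n n" "x \<in> carrier_mat n n"
  shows "bracket (c \<cdot>\<^sub>m h) x = c \<cdot>\<^sub>m bracket (h :: 'k::field mat) x"
proof -
  have "bracket (c \<cdot>\<^sub>m h) x = c \<cdot>\<^sub>m (h * x) - c \<cdot>\<^sub>m (x * h)"
    unfolding bracket_def using mult_smult_distrib[OF assms(2,1)] mult_smult_assoc_mat[OF assms] by simp
  also have "\<dots> = c \<cdot>\<^sub>m bracket h x"
    unfolding bracket_def using assms by (intro eq_matI) (auto simp: algebra_simps simp del: index_mult_mat(1))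
  finally show ?thesis .
qed

lemma bracket_eq_zero_iff:
  assumes "x \<in> carrier_mat n n" "y \<in> carrier_mat n n"
  shows "bracket x y = 0\<^sub>m n n \<longleftrightarrow> x * y = y * (x :: 'k::field mat)"
proof
  assume b: "bracket x y = 0\<^sub>m n n"
  show "x * y = y * x"
  proof (intro eq_matI)
    fix i j assume "i < dim_row (y * x)" "j < dim_col (y * x)"
    then show "(x * y) $$ (i, j) = (y * x) $$ (i, j)"
      using arg_cong[OF b, of "\<lambda>M. M $$ (i, j)"] assms by (simp add: bracket_def del: index_mult_mat(1))
  qed (use assms in auto)
next
  assume "x * y = y * x"
  then show "bracket x y = 0\<^sub>m n n" unfolding bracket_def using assms by (intro eq_matI) auto
qed

lemma bracket_commute_zero:
  assumes "x \<in> carrier_mat n n" "y \<in> carrier_mat n n" "bracket x y = 0\<^sub>m n n"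
  shows "bracket y x = 0\<^sub>m n n"
  using assms by (metis bracket_eq_zero_iff)

lemma bracket_zero_right: "h \<in> carrier_mat n n \<Longrightarrow> bracket h (0\<^sub>m n n) = 0\<^sub>m n n"
  unfolding bracket_def by (intro eq_matI) auto

lemma bracket_zero_left: "h \<in> carrier_mat n n \<Longrightarrow> bracket (0\<^sub>m n n) h = 0\<^sub>m n n"
  unfolding bracket_def by (intro eq_matI) auto

text \<open>The Jacobi identity when \<open>h\<close> and \<open>k\<close> commute: the operators
  \<open>ad h\<close> and \<open>ad k\<close> commute.\<close>

lemma bracket_left_commute:
  fixes h k u :: "'k::field mat"
  assumes h: "h \<in> carrier_mat n n" and k: "k \<in> carrier_mat n n" and u: "u \<in> carrier_mat n n"
    and c: "bracket h k = 0\<^sub>m n n"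
  shows "bracket h (bracket k u) = bracket k (bracket h u)"
proof -
  have hk: "h * k = k * h" using bracket_eq_zero_iff[OF h k] c by simp
  have exp: "bracket a (bracket b u) = (a * b * u - a * u * b) - (b * u * a - u * (b * a))"
    if a: "a \<in> carrier_mat n n" and b: "b \<in> carrier_mat n n" for a b
  proof -
    have bu: "b * u \<in> carrier_mat n n" "u * b \<in> carrier_mat n n" using b u by auto
    show ?thesis
      unfolding bracket_def mult_minus_distrib_mat[OF a bu] minus_mult_distrib_mat[OF bu a]
      using a b u by (simp add: assoc_mult_mat[of _ n n _ n _ n])
  qed
  have sw: "(p - q) - (r - s) = (p - r) - (q - s)"
    if "p \<in> carrier_mat n n" "q \<in> carrier_mat n n" "r \<in> carrier_mat n n" "s \<in> carrier_mat n n" for p q r s :: "'k mat"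
    using that by (intro eq_matI) auto
  show ?thesis unfolding exp[OF h k] exp[OF k h] hk by (rule sw) (use h k u in auto)
qed

text \<open>Induction over generators of \<open>t\<close>: a simultaneous eigenspace of those
  treated so far is stable under the next one and contains an eigenvector of it. The elements having
  the final vector as eigenvector form a subspace, hence include all of \<open>t\<close>.\<close>

lemma common_eigenvector:
  fixes U t :: "'k::alg_closed_field mat set"
  assumes U: "mat_subspace n U" "U \<noteq> {0\<^sub>m n n}" and t: "mat_subspace n t"
    and stable: "\<And>h u. h \<in> t \<Longrightarrow> u \<in> U \<Longrightarrow> bracket h u \<in> U"
    and comm: "\<And>h k. h \<in> t \<Longrightarrow> k \<in> t \<Longrightarrow> bracket h k = 0\<^sub>m n n"
  shows "\<exists>w\<in>U. w \<noteq> 0\<^sub>m n n \<and> (\<forall>h\<in>t. \<exists>c. bracket h w = c \<cdot>\<^sub>m w)"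
proof -
  note Uc = mat_subspaceD(1)[OF U(1)] and tc = mat_subspaceD(1)[OF t]
  obtain S where S: "finite S" "S \<subseteq> t" "\<And>W. mat_subspace n W \<Longrightarrow> S \<subseteq> W \<Longrightarrow> t \<subseteq> W"
    by (rule subspace_finitely_generated[OF t]) blast
  have "\<exists>c. \<exists>w\<in>U. w \<noteq> 0\<^sub>m n n \<and> (\<forall>h\<in>S. bracket h w = c h \<cdot>\<^sub>m w)"
    using S(1,2)
  proof (induction S)
    case empty
    show ?case using U mat_subspaceD(2)[OF U(1)] by auto
  next
    case (insert h S)
    then obtain c w where w: "w \<in> U" "w \<noteq> 0\<^sub>m n n" "\<forall>k\<in>S. bracket k w = c k \<cdot>\<^sub>m w" by auto
    have ht: "h \<in> t" and St: "S \<subseteq> t" using insert.prems by auto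
    let ?U = "{u \<in> U. \<forall>k\<in>S. bracket k u = c k \<cdot>\<^sub>m u}"
    have sub: "mat_subspace n ?U"
      unfolding mat_subspace_def
    proof (intro conjI ballI allI)
      show "?U \<subseteq> carrier_mat n n" using Uc by auto
      have "bracket k (0\<^sub>m n n) = c k \<cdot>\<^sub>m 0\<^sub>m n n" if "k \<in> S" for k
        using bracket_zero_right[OF tc, of k] St that by auto
      then show "0\<^sub>m n n \<in> ?U" using mat_subspaceD(2)[OF U(1)] by auto
      show "x + y \<in> ?U" if "x \<in> ?U" "y \<in> ?U" for x y
      proof -
        have "bracket k (x + y) = c k \<cdot>\<^sub>m (x + y)" if "k \<in> S" for k
          using bracket_add_right[OF tc[of k] Uc[of x] Uc[of y]] add_smult_distrib_left_mat[OF Uc[of x] Uc[of y], of "c k"]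
            \<open>x \<in> ?U\<close> \<open>y \<in> ?U\<close> St that by auto
        then show ?thesis using that mat_subspaceD(3)[OF U(1)] by auto
      qed
      show "a \<cdot>\<^sub>m x \<in> ?U" if "x \<in> ?U" for a x
      proof -
        have "bracket k (a \<cdot>\<^sub>m x) = c k \<cdot>\<^sub>m (a \<cdot>\<^sub>m x)" if "k \<in> S" for k
        proof -
          have "a \<cdot>\<^sub>m (c k \<cdot>\<^sub>m x) = c k \<cdot>\<^sub>m (a \<cdot>\<^sub>m x)" by (intro eq_matI) auto
          then show ?thesis using bracket_smult_right[OF tc[of k] Uc[of x], of a] \<open>x \<in> ?U\<close> St that by auto
        qed
        then show ?thesis using that mat_subspaceD(4)[OF U(1)] by auto
      qed
    qed
    have hU: "bracket h u \<in> ?U" if u: "u \<in> ?U" for u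
    proof -
      have "bracket k (bracket h u) = c k \<cdot>\<^sub>m bracket h u" if k: "k \<in> S" for k
      proof -
        have "k \<in> t" using k St by blast
        have "bracket k (bracket h u) = bracket h (bracket k u)"
          using bracket_left_commute[OF tc[OF \<open>k \<in> t\<close>] tc[OF ht] Uc comm[OF \<open>k \<in> t\<close> ht]] u by auto
        also have "\<dots> = c k \<cdot>\<^sub>m bracket h u"
          using bracket_smult_right[OF tc[OF ht] Uc[of u]] u k by auto
        finally show ?thesis .
      qed
      then show ?thesis using stable[OF ht] u by auto
    qed
    have "\<exists>v\<in>?U. \<exists>a. v \<noteq> 0\<^sub>m n n \<and> bracket h v = a \<cdot>\<^sub>m v"
    proof (rule eigenvector_exists[OF sub])
      show "w \<in> ?U" using w by auto
      show "bracket h (v + v') = bracket h v + bracket h v'" if "v \<in> ?U" "v' \<in> ?U" for v v'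
        using bracket_add_right[OF tc[OF ht] Uc Uc] that by auto
      show "bracket h (a \<cdot>\<^sub>m v) = a \<cdot>\<^sub>m bracket h v" if "v \<in> ?U" for a v
        using bracket_smult_right[OF tc[OF ht] Uc] that by auto
    qed (fact w(2) hU)+
    then obtain v a where v: "v \<in> ?U" "v \<noteq> 0\<^sub>m n n" "bracket h v = a \<cdot>\<^sub>m v" by blast
    show ?case
    proof (intro exI[of _ "c(h := a)"] bexI[of _ v] conjI ballI)
      show "bracket k v = (c(h := a)) k \<cdot>\<^sub>m v" if "k \<in> insert h S" for k using v that by (cases "k = h") auto
    qed (use v in auto)
  qed
  then obtain c w where w: "w \<in> U" "w \<noteq> 0\<^sub>m n n" "\<And>h. h \<in> S \<Longrightarrow> bracket h w = c h \<cdot>\<^sub>m w" by blast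
  note wc = Uc[OF w(1)]
  let ?W = "{h \<in> carrier_mat n n. \<exists>c. bracket h w = c \<cdot>\<^sub>m w}"
  have "mat_subspace n ?W"
    unfolding mat_subspace_def
  proof (intro conjI ballI allI)
    have "0 \<cdot>\<^sub>m w = 0\<^sub>m n n" using wc by (intro eq_matI) auto
    then have "bracket (0\<^sub>m n n) w = 0 \<cdot>\<^sub>m w" using bracket_zero_left[OF wc] by simp
    then have "\<exists>c. bracket (0\<^sub>m n n) w = c \<cdot>\<^sub>m w" by (rule exI)
    then show "0\<^sub>m n n \<in> ?W" by simp
    show "x + y \<in> ?W" if xy: "x \<in> ?W" "y \<in> ?W" for x y
    proof -
      obtain a b where "bracket x w = a \<cdot>\<^sub>m w" "bracket y w = b \<cdot>\<^sub>m w" using xy by auto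
      then have "bracket (x + y) w = (a + b) \<cdot>\<^sub>m w"
        using bracket_add_left[of x n y w] add_smult_distrib_right_mat[OF wc, of a b] xy wc by auto
      then have "\<exists>c. bracket (x + y) w = c \<cdot>\<^sub>m w" by (rule exI)
      moreover have "x + y \<in> carrier_mat n n" using xy by simp
      ultimately show ?thesis unfolding mem_Collect_eq by (rule conjI[rotated])
    qed
    show "a \<cdot>\<^sub>m x \<in> ?W" if x: "x \<in> ?W" for a x
    proof -
      obtain b where "bracket x w = b \<cdot>\<^sub>m w" using x by auto
      moreover have "a \<cdot>\<^sub>m (b \<cdot>\<^sub>m w) = (a * b) \<cdot>\<^sub>m w" by (intro eq_matI) auto
      ultimately have "bracket (a \<cdot>\<^sub>m x) w = (a * b) \<cdot>\<^sub>m w" using bracket_smult_left[of x n w a] x wc by auto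
      then have "\<exists>c. bracket (a \<cdot>\<^sub>m x) w = c \<cdot>\<^sub>m w" by (rule exI)
      moreover have "a \<cdot>\<^sub>m x \<in> carrier_mat n n" using x by simp
      ultimately show ?thesis unfolding mem_Collect_eq by (rule conjI[rotated])
    qed
  qed auto
  then have "t \<subseteq> ?W" by (rule S(3)) (use S(2) tc w(3) in auto)
  then show ?thesis using w(1,2) by blast
qed

section \<open>Cells and packets\<close>

text \<open>The image under \<open>ad y\<close> of the centralizer of \<open>x\<close> would be a
  nonzero \<open>t\<close>-stable subspace of \<open>L\<close>. Working in this image instead of a
  quotient supplies an actual root vector, of weight zero at \<open>x\<close> but not at
  \<open>y\<close>. The condition on roots is one-sided; within a cell it holds both ways.\<close>

lemma centralizer_cell:
  fixes t L :: "'k::alg_closed_field mat set"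
  assumes L: "mat_subspace n L" and t: "mat_subspace n t" and tL: "t \<subseteq> L"
    and comm: "\<And>h k. h \<in> t \<Longrightarrow> k \<in> t \<Longrightarrow> bracket h k = 0\<^sub>m n n"
    and stable: "\<And>h z. h \<in> t \<Longrightarrow> z \<in> L \<Longrightarrow> bracket h z \<in> L"
    and xy: "x \<in> t" "y \<in> t" "\<And>\<alpha>. \<alpha> \<in> roots n L t \<Longrightarrow> \<alpha> x = 0 \<Longrightarrow> \<alpha> y = 0" and ss: "semisimple_elem y"
    and z: "z \<in> L" "bracket x z = 0\<^sub>m n n"
  shows "bracket y z = 0\<^sub>m n n"
proof (rule ccontr)
  assume nz: "bracket y z \<noteq> 0\<^sub>m n n"
  note Lc = mat_subspaceD(1)[OF L] and tc = mat_subspaceD(1)[OF t]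
  note yc = tc[OF xy(2)] and xc = tc[OF xy(1)]
  define K where "K = {bracket y u | u. u \<in> L \<and> bracket x u = 0\<^sub>m n n}"
  have KI: "bracket y u \<in> K" if "u \<in> L" "bracket x u = 0\<^sub>m n n" for u
    unfolding K_def using that by blast
  have KE: "\<exists>u\<in>L. bracket x u = 0\<^sub>m n n \<and> w = bracket y u" if "w \<in> K" for w
    using that unfolding K_def by blast
  have Ksub: "mat_subspace n K"
    unfolding mat_subspace_def
  proof (intro conjI ballI allI subsetI)
    show "w \<in> carrier_mat n n" if "w \<in> K" for w using KE[OF that] yc Lc by auto
    show "0\<^sub>m n n \<in> K"
      using KI[OF mat_subspaceD(2)[OF L] bracket_zero_right[OF xc]] bracket_zero_right[OF yc] by simp
    show "w + w' \<in> K" if ww: "w \<in> K" "w' \<in> K" for w w'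
    proof -
      obtain u u' where u: "u \<in> L" "bracket x u = 0\<^sub>m n n" "w = bracket y u"
        and u': "u' \<in> L" "bracket x u' = 0\<^sub>m n n" "w' = bracket y u'" using KE[OF ww(1)] KE[OF ww(2)] by blast
      have "bracket x (u + u') = 0\<^sub>m n n"
        using bracket_add_right[OF xc Lc[OF u(1)] Lc[OF u'(1)]] u(2) u'(2) by simp
      then show ?thesis
        using KI[OF mat_subspaceD(3)[OF L u(1) u'(1)]] bracket_add_right[OF yc Lc[OF u(1)] Lc[OF u'(1)]] u(3) u'(3) by simp
    qed
    show "a \<cdot>\<^sub>m w \<in> K" if w: "w \<in> K" for a w
    proof -
      obtain u where u: "u \<in> L" "bracket x u = 0\<^sub>m n n" "w = bracket y u" using KE[OF w] by blast
      have "bracket x (a \<cdot>\<^sub>m u) = 0\<^sub>m n n" using bracket_smult_right[OF xc Lc[OF u(1)]] u(2) by simp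
      then show ?thesis
        using KI[OF mat_subspaceD(4)[OF L u(1)]] bracket_smult_right[OF yc Lc[OF u(1)]] u(3) by simp
    qed
  qed
  have "bracket y z \<in> K" using KI z by blast
  then have "K \<noteq> {0\<^sub>m n n}" using nz by auto
  have Kstable: "bracket h w \<in> K" if h: "h \<in> t" and w: "w \<in> K" for h w
  proof -
    obtain u where u: "u \<in> L" "bracket x u = 0\<^sub>m n n" "w = bracket y u" using KE[OF w] by blast
    have "bracket x (bracket h u) = bracket h (bracket x u)"
      by (rule bracket_left_commute[OF xc tc[OF h] Lc[OF u(1)] comm[OF xy(1) h]])
    also have "\<dots> = 0\<^sub>m n n" using u(2) bracket_zero_right[OF tc[OF h]] by simp
    finally have "bracket y (bracket h u) \<in> K" using KI stable[OF h u(1)] by blast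
    moreover have "bracket h (bracket y u) = bracket y (bracket h u)"
      by (rule bracket_left_commute[OF tc[OF h] yc Lc[OF u(1)] comm[OF h xy(2)]])
    ultimately show ?thesis using u(3) by simp
  qed
  obtain w where w: "w \<in> K" "w \<noteq> 0\<^sub>m n n" "\<And>h. h \<in> t \<Longrightarrow> \<exists>c. bracket h w = c \<cdot>\<^sub>m w"
    using common_eigenvector[OF Ksub \<open>K \<noteq> {0\<^sub>m n n}\<close> t Kstable comm] by blast
  then obtain a where a: "\<And>h. h \<in> t \<Longrightarrow> bracket h w = a h \<cdot>\<^sub>m w" by metis
  obtain u where u: "u \<in> L" "bracket x u = 0\<^sub>m n n" "w = bracket y u" using KE[OF w(1)] by blast
  have wL: "w \<in> L" using stable[OF xy(2) u(1)] u(3) by simp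
  note wc = Lc[OF wL] and uc = Lc[OF u(1)]
  have "\<exists>i j. i < n \<and> j < n \<and> w $$ (i, j) \<noteq> 0"
  proof (rule ccontr)
    assume "\<not> ?thesis"
    then have "w = 0\<^sub>m n n" using wc by (intro eq_matI) auto
    then show False using w(2) by simp
  qed
  then obtain i j where ij: "i < n" "j < n" "w $$ (i, j) \<noteq> 0" by blast
  have eqc: "c = d" if "c \<cdot>\<^sub>m w = d \<cdot>\<^sub>m w" for c d
    using arg_cong[OF that, of "\<lambda>M. M $$ (i, j)"] ij wc by simp
  have a_add: "a (h + k) = a h + a k" if hk: "h \<in> t" "k \<in> t" for h k
    using bracket_add_left[OF tc[OF hk(1)] tc[OF hk(2)] wc] a[OF hk(1)] a[OF hk(2)] a[OF mat_subspaceD(3)[OF t hk]]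
      add_smult_distrib_right_mat[OF wc, of "a h" "a k"] by (intro eqc) simp
  have a_smult: "a (c \<cdot>\<^sub>m h) = c * a h" if h: "h \<in> t" for c h
  proof (rule eqc)
    have "c \<cdot>\<^sub>m (a h \<cdot>\<^sub>m w) = (c * a h) \<cdot>\<^sub>m w" by (intro eq_matI) auto
    then show "a (c \<cdot>\<^sub>m h) \<cdot>\<^sub>m w = (c * a h) \<cdot>\<^sub>m w"
      using bracket_smult_left[OF tc[OF h] wc, of c] a[OF h] a[OF mat_subspaceD(4)[OF t h]] by simp
  qed
  have zero: "0 \<cdot>\<^sub>m w = 0\<^sub>m n n" using wc by (intro eq_matI) auto
  \<comment> \<open>Otherwise the square of \<open>ad y\<close> kills \<open>u\<close>; as
    \<open>y\<close> is semisimple, \<open>ad y\<close> itself kills \<open>u\<close>, against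
    \<open>w\<close> being nonzero.\<close>
  have ay: "a y \<noteq> 0"
  proof
    assume "a y = 0"
    then have "bracket y w = 0\<^sub>m n n" using a[OF xy(2)] zero by simp
    then have "y * (y * u - u * y) - (y * u - u * y) * y = 0\<^sub>m n n" unfolding u(3) bracket_def .
    from semisimple_sylvester[OF ss yc ss yc uc this] show False using w(2) u(3) by (simp add: bracket_def)
  qed
  have "bracket x w = 0\<^sub>m n n"
    unfolding u(3) bracket_left_commute[OF xc yc uc comm[OF xy(1,2)]] u(2) using bracket_zero_right[OF yc] .
  then have ax: "a x = 0" using a[OF xy(1)] zero by (intro eqc) simp
  have ds: "restrict a t \<in> dual_space t"
    unfolding dual_space_def using a_add a_smult mat_subspaceD(3,4)[OF t] by auto
  have "restrict a t \<in> roots n L t"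
    unfolding roots_def
  proof (intro CollectI conjI ds)
    show "\<exists>h\<in>t. restrict a t h \<noteq> 0" using xy(2) ay by auto
    show "\<exists>x\<in>L. x \<noteq> 0\<^sub>m n n \<and> (\<forall>h\<in>t. bracket h x = restrict a t h \<cdot>\<^sub>m x)"
      using wL w(2) a by (intro bexI[of _ w]) auto
  qed
  from xy(3)[OF this] show False using ax ay xy(1,2) by simp
qed

text \<open>The disjunction in \<open>cell_rel\<close> only says that the same roots vanish, so any
  member of a cell serves as its representative.\<close>

lemma cell_iff:
  fixes t :: "'k::field mat set"
  assumes c: "c \<in> cells R t" and y: "y \<in> c"
  shows "x \<in> c \<longleftrightarrow> x \<in> t \<and> (\<forall>\<alpha>\<in>R. \<alpha> x = 0 \<longleftrightarrow> \<alpha> y = 0)"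
proof -
  have pq: "(p = 0 \<and> q = 0) \<or> p * q \<noteq> 0 \<longleftrightarrow> (p = 0 \<longleftrightarrow> q = 0)" for p q :: 'k by auto
  have rel: "(u, v) \<in> cell_rel R t \<longleftrightarrow> u \<in> t \<and> v \<in> t \<and> (\<forall>\<alpha>\<in>R. \<alpha> u = 0 \<longleftrightarrow> \<alpha> v = 0)" for u v
    unfolding cell_rel_def by (simp only: pq mem_Collect_eq prod.case)
  obtain u where u: "c = cell_rel R t `` {u}" using c unfolding cells_def by (rule quotientE)
  have x: "x \<in> c \<longleftrightarrow> (u, x) \<in> cell_rel R t" and y': "(u, y) \<in> cell_rel R t" using u y by simp_all
  then have ut: "u \<in> t" and uy: "\<And>\<alpha>. \<alpha> \<in> R \<Longrightarrow> (\<alpha> u = 0) = (\<alpha> y = 0)" unfolding rel by blast+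
  have "(\<forall>\<alpha>\<in>R. (\<alpha> u = 0) = (\<alpha> x = 0)) = (\<forall>\<alpha>\<in>R. (\<alpha> x = 0) = (\<alpha> y = 0))"
    by (rule ball_cong[OF refl]) (subst uy, assumption, rule eq_commute)
  then show ?thesis unfolding x rel using ut by (simp only: simp_thms)
qed

section \<open>Commutativity of the Lie algebra of a torus\<close>

lemma LieD:
  fixes G :: "'k::field_char_0 mat set"
  assumes "X \<in> Lie n G" "f \<in> poly_fun n" "\<And>a. a \<in> G \<Longrightarrow> f a = 0"
  shows "ddir f (1\<^sub>m n) X = 0"
  using assms by (simp add: Lie_iff)

text \<open>Commuting with \<open>B\<close> is a homogeneous linear condition on the entries of
  \<open>A\<close>, and such a condition on a group passes to its tangent vectors.\<close>

lemma Lie_commute_const: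
  fixes T :: "'k::field_char_0 mat set"
  assumes B: "B \<in> carrier_mat n n" and T: "T \<subseteq> carrier_mat n n" and comm: "\<And>A. A \<in> T \<Longrightarrow> B * A = A * B"
    and X: "X \<in> Lie n T"
  shows "bracket B X = 0\<^sub>m n n"
proof (intro eq_matI)
  note Xc = Lie_carrier[OF X]
  fix i j assume "i < dim_row (0\<^sub>m n n)" "j < dim_col (0\<^sub>m n n)"
  then have ij: "i < n" "j < n" by auto
  let ?f = "\<lambda>A. (B * cut n A) $$ (i, j) - (cut n A * B) $$ (i, j)"
  have f: "?f \<in> poly_fun n"
    by (intro poly_fun_diff poly_matD(2)[OF poly_mat_mult[OF poly_mat_const[OF B] poly_mat_cut]]
        poly_matD(2)[OF poly_mat_mult[OF poly_mat_cut poly_mat_const[OF B]]] ij)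
  have "\<forall>A\<in>T. ?f A = 0"
  proof
    fix A assume A: "A \<in> T"
    have "cut n A = A" using T A by auto
    then show "?f A = 0" using comm[OF A] by simp
  qed
  then have z: "ddir ?f (1\<^sub>m n) X = 0" by (intro LieD[OF X f]) (rule bspec)
  have "?f (1\<^sub>m n + s \<cdot>\<^sub>m X) = poly [:0, bracket B X $$ (i, j):] s" for s
  proof -
    have c: "cut n (1\<^sub>m n + s \<cdot>\<^sub>m X) = 1\<^sub>m n + s \<cdot>\<^sub>m X" using Xc by simp
    have sX: "s \<cdot>\<^sub>m X \<in> carrier_mat n n" using Xc by simp
    have "B * (1\<^sub>m n + s \<cdot>\<^sub>m X) = B + s \<cdot>\<^sub>m (B * X)"
      using mult_add_distrib_mat[OF B one_carrier_mat sX] mult_smult_distrib[OF B Xc] right_mult_one_mat[OF B] by simp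
    moreover have "(1\<^sub>m n + s \<cdot>\<^sub>m X) * B = B + s \<cdot>\<^sub>m (X * B)"
      using add_mult_distrib_mat[OF one_carrier_mat sX B] mult_smult_assoc_mat[OF Xc B] left_mult_one_mat[OF B] by simp
    ultimately show ?thesis
      unfolding c using ij B Xc by (simp add: bracket_def algebra_simps del: index_mult_mat(1))
  qed
  from ddirI[of ?f, OF this] z show "bracket B X $$ (i, j) = 0\<^sub>m n n $$ (i, j)" using ij by simp
qed (use carrier_matD[OF bracket_carrier[OF B Lie_carrier[OF X]]] in auto)

lemma torus_commute:
  fixes T :: "'k::field mat set"
  assumes T: "torus n T" and ab: "a \<in> T" "b \<in> T"
  shows "a * b = b * a"
proof -
  obtain r \<phi> where iso: "alg_iso n T r (diag_group r) \<phi>" using T unfolding torus_def by blast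
  have G: "subgroup T (GL n)" using T unfolding torus_def alg_group_def by blast
  have hom: "\<phi> \<in> hom (subgp n T) (subgp r (diag_group r))" and bij: "bij_betw \<phi> T (diag_group r)"
    using iso unfolding alg_iso_def alg_hom_def by auto
  have mult: "\<phi> (u * v) = \<phi> u * \<phi> v" if "u \<in> T" "v \<in> T" for u v
    using hom that by (auto simp: hom_def GL_simps)
  have d: "\<phi> u \<in> carrier_mat r r" "diagonal_mat (\<phi> u)" if "u \<in> T" for u
    using bij_betwE[OF bij] that by (auto simp: diag_group_def GL_iff)
  have "\<phi> a * \<phi> b = \<phi> b * \<phi> a"
  proof (intro eq_matI)
    fix i j assume "i < dim_row (\<phi> b * \<phi> a)" "j < dim_col (\<phi> b * \<phi> a)"
    then have ij: "i < r" "j < r" using d(1)[OF ab(1)] d(1)[OF ab(2)] by auto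
    show "(\<phi> a * \<phi> b) $$ (i, j) = (\<phi> b * \<phi> a) $$ (i, j)"
      using diagonal_mult_left[OF d[OF ab(1)] d(1)[OF ab(2)] ij] diagonal_mult_right[OF d[OF ab(1)] d(1)[OF ab(2)] ij]
        d(2)[OF ab(2)] d(1)[OF ab(2)] ij
      by (cases "i = j") (auto simp: diagonal_mat_def mult.commute simp del: index_mult_mat(1))
  qed (use d(1)[OF ab(1)] d(1)[OF ab(2)] in auto)
  then have "\<phi> (a * b) = \<phi> (b * a)" using mult ab by simp
  then show ?thesis
    using inj_onD[OF bij_betw_imp_inj_on[OF bij]] subgroup_GL(3)[OF G] ab by blast
qed

text \<open>Commutation is differentiated in one argument at a time: group elements commute with
  \<open>X\<close>, and then \<open>X\<close> takes the part of the constant matrix.\<close>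

lemma Lie_torus_commute:
  fixes T :: "'k::field_char_0 mat set"
  assumes T: "torus n T" and XY: "X \<in> Lie n T" "Y \<in> Lie n T"
  shows "bracket X Y = 0\<^sub>m n n"
proof -
  have G: "subgroup T (GL n)" using T unfolding torus_def alg_group_def by blast
  have Tc: "T \<subseteq> carrier_mat n n" using GL_carrier subgroup_GL(1)[OF G] by blast
  note Xc = Lie_carrier[OF XY(1)]
  have "X * A = A * X" if A: "A \<in> T" for A
  proof -
    have Ac: "A \<in> carrier_mat n n" using A Tc by blast
    have "bracket A X = 0\<^sub>m n n"
      by (rule Lie_commute_const[OF Ac Tc torus_commute[OF T A] XY(1)])
    then show ?thesis using bracket_eq_zero_iff[OF Ac Xc] by simp
  qed
  then show ?thesis by (rule Lie_commute_const[OF Xc Tc _ XY(2)])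
qed

lemma semisimple_Ad:
  assumes g: "g \<in> carrier (GL n)" and x: "semisimple_elem x" "x \<in> carrier_mat n n"
  shows "semisimple_elem (Ad n g x)"
proof -
  obtain P P' D where P: "P \<in> carrier_mat n n" "P' \<in> carrier_mat n n" "D \<in> carrier_mat n n" "diagonal_mat D"
    "P * P' = 1\<^sub>m n" "P' * P = 1\<^sub>m n" "x = P * D * P'" by (rule semisimple_elemE[OF x])
  note gc = GL_carrier[OF g] and gi = GL_inv(2-4)[OF g]
  show ?thesis
  proof (rule semisimple_elemI[of _ n "g * P" "P' * GL_inv n g" D])
    show "g * P * (P' * GL_inv n g) = 1\<^sub>m n"
      using mat_assoc4[OF gc P(1,2) gi(1)] P(5) gi(2) right_mult_one_mat[OF gc] by simp
    show "P' * GL_inv n g * (g * P) = 1\<^sub>m n"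
      using mat_assoc4[OF P(2) gi(1) gc P(1)] P(6) gi(3) right_mult_one_mat[OF P(2)] by simp
    show "Ad n g x = g * P * D * (P' * GL_inv n g)"
      unfolding Ad_def P(7) using gc gi(1) P(1-3) by (simp add: assoc_mult_mat[of _ n n _ n _ n])
  qed (use gc gi(1) P(1,2) Ad_carrier[OF g x(2)] in \<open>auto intro: P(3,4)\<close>)
qed

lemma nilpotent_Ad:
  assumes g: "g \<in> carrier (GL n)" and e: "nilpotent_elem n e" "e \<in> carrier_mat n n"
  shows "nilpotent_elem n (Ad n g e)"
proof -
  have "Ad n g e ^\<^sub>m k = Ad n g (e ^\<^sub>m k)" for k
  proof (induction k)
    case 0
    have "dim_row (Ad n g e) = n" using Ad_carrier[OF g e(2)] by auto
    moreover have "Ad n g (1\<^sub>m n) = 1\<^sub>m n"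
      unfolding Ad_def using right_mult_one_mat[OF GL_carrier[OF g]] GL_inv(3)[OF g] by simp
    ultimately show ?case using e(2) by simp
  next
    case (Suc k)
    then show ?case using Ad_mult[OF g pow_carrier_mat[OF e(2)] e(2)] by simp
  qed
  then show ?thesis using e(1) Ad_zero[OF g] unfolding nilpotent_elem_def by metis
qed

lemma lie_grading_degree_one:
  assumes "lie_grading n m L gr"
  shows "mat_subspace n (degree_one m gr)" "degree_one m gr \<subseteq> L"
    "x \<in> gr 0 \<Longrightarrow> y \<in> degree_one m gr \<Longrightarrow> bracket x y \<in> degree_one m gr"
proof -
  let ?Z = "integer_mod_group m"
  \<comment> \<open>\<open>1 mod int m\<close> is 1 for \<open>m = 0\<close> because reduction
    modulo 0 is the identity, and 0 for \<open>m = 1\<close>; it lies in the carrier in all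
    cases.\<close>
  have c: "0 \<in> carrier ?Z" "1 mod int m \<in> carrier ?Z"
    by (auto simp: integer_mod_group_def carrier_integer_mod_group)
  have s: "0 \<otimes>\<^bsub>?Z\<^esub> (1 mod int m) = 1 mod int m"
    by (auto simp: integer_mod_group_def)
  note g = assms[unfolded lie_grading_def Let_def]
  show "mat_subspace n (degree_one m gr)" "degree_one m gr \<subseteq> L"
    using g c(2) unfolding degree_one_def subspace_iff_mat_subspace[symmetric] by auto
  show "bracket x y \<in> degree_one m gr" if "x \<in> gr 0" "y \<in> degree_one m gr"
  proof -
    have "\<forall>i \<in> carrier ?Z. \<forall>j \<in> carrier ?Z. \<forall>x \<in> gr i. \<forall>y \<in> gr j. bracket x y \<in> gr (i \<otimes>\<^bsub>?Z\<^esub> j)"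
      using g by (elim conjE)
    from this[rule_format, OF c that[unfolded degree_one_def]] show ?thesis unfolding s degree_one_def .
  qed
qed

section \<open>Packets that meet, for a subspace \<open>V\<close> stable under the adjoint action of
  \<open>G0\<close>\<close>

context
  fixes n :: nat and L V G0 t :: "'k::{alg_closed_field, field_char_0} mat set"
  assumes L: "mat_subspace n L" and V: "mat_subspace n V" and VL: "V \<subseteq> L" and t: "mat_subspace n t" and tL: "t \<subseteq> L"
    and G0: "subgroup G0 (GL n)"
    and AdL: "\<And>g x. g \<in> G0 \<Longrightarrow> x \<in> L \<Longrightarrow> Ad n g x \<in> L"
    and AdV: "\<And>g x. g \<in> G0 \<Longrightarrow> x \<in> V \<Longrightarrow> Ad n g x \<in> V"
    and comm: "\<And>h k. h \<in> t \<Longrightarrow> k \<in> t \<Longrightarrow> bracket h k = 0\<^sub>m n n"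
    and stable: "\<And>h z. h \<in> t \<Longrightarrow> z \<in> L \<Longrightarrow> bracket h z \<in> L"
    and Cartan: "Cartan_subspace n V (t \<inter> V)"
begin

lemma Cartan_semisimple: "x \<in> t \<Longrightarrow> x \<in> V \<Longrightarrow> semisimple_elem x"
  using Cartan unfolding Cartan_subspace_def commuting_semisimple_subspace_def by blast

text \<open>Adding the line of \<open>w\<close> to the Cartan subspace gives a space of commuting
  semisimple elements, so maximality forces the line inside. All multiples of \<open>w\<close> are
  assumed semisimple because the elements \<open>s + c w\<close> are sums to which
  \<open>semisimple_add\<close> applies.\<close>

lemma Cartan_maximal:
  assumes w: "w \<in> V" "\<And>c. semisimple_elem (c \<cdot>\<^sub>m w)" "\<And>s. s \<in> t \<Longrightarrow> s \<in> V \<Longrightarrow> bracket w s = 0\<^sub>m n n"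
  shows "w \<in> t"
proof -
  let ?C = "t \<inter> V"
  note Vc = mat_subspaceD(1)[OF V] and tc = mat_subspaceD(1)[OF t]
  note wc = Vc[OF w(1)]
  define D where "D = {s + c \<cdot>\<^sub>m w | s c. s \<in> ?C}"
  have DI: "s + c \<cdot>\<^sub>m w \<in> D" if "s \<in> ?C" for s c unfolding D_def using that by blast
  have DE: "\<exists>s c. s \<in> ?C \<and> d = s + c \<cdot>\<^sub>m w" if "d \<in> D" for d using that unfolding D_def by blast
  have C: "mat_subspace n ?C" using t V unfolding mat_subspace_def by auto
  note Cc = mat_subspaceD(1)[OF C]
  have cw: "c \<cdot>\<^sub>m w \<in> carrier_mat n n" for c using wc by simp
  have zw: "s + 0 \<cdot>\<^sub>m w = s" if "s \<in> ?C" for s using Cc[OF that] wc by (intro eq_matI) auto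
  have DV: "D \<subseteq> V"
  proof
    fix d assume "d \<in> D"
    then obtain s c where "s \<in> ?C" "d = s + c \<cdot>\<^sub>m w" using DE by blast
    then show "d \<in> V" using mat_subspaceD(3)[OF V, of s] mat_subspaceD(4)[OF V w(1)] by simp
  qed
  have sub: "mat_subspace n D"
    unfolding mat_subspace_def
  proof (intro conjI ballI allI)
    show "D \<subseteq> carrier_mat n n" using DV Vc by blast
    show "0\<^sub>m n n \<in> D" using DI[OF mat_subspaceD(2)[OF C], of 0] zw[OF mat_subspaceD(2)[OF C]] by simp
    show "d + d' \<in> D" if dd: "d \<in> D" "d' \<in> D" for d d'
    proof -
      obtain s c s' c' where s: "s \<in> ?C" "d = s + c \<cdot>\<^sub>m w" "s' \<in> ?C" "d' = s' + c' \<cdot>\<^sub>m w"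
        using DE[OF dd(1)] DE[OF dd(2)] by blast
      have "d + d' = (s + s') + (c + c') \<cdot>\<^sub>m w"
        unfolding s(2,4) using Cc[OF s(1)] Cc[OF s(3)] wc by (intro eq_matI) (auto simp: algebra_simps)
      then show ?thesis using DI[OF mat_subspaceD(3)[OF C s(1,3)]] by simp
    qed
    show "a \<cdot>\<^sub>m d \<in> D" if d: "d \<in> D" for a d
    proof -
      obtain s c where s: "s \<in> ?C" "d = s + c \<cdot>\<^sub>m w" using DE[OF d] by blast
      have "a \<cdot>\<^sub>m d = a \<cdot>\<^sub>m s + (a * c) \<cdot>\<^sub>m w"
        unfolding s(2) using Cc[OF s(1)] wc by (intro eq_matI) (auto simp: algebra_simps)
      then show ?thesis using DI[OF mat_subspaceD(4)[OF C s(1)]] by simp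
    qed
  qed
  have ws: "bracket (c \<cdot>\<^sub>m w) s = 0\<^sub>m n n" if "s \<in> ?C" for c s
    using bracket_smult_left[OF wc Cc[OF that], of c] w(3)[of s] that by simp
  have ss: "semisimple_elem d" if "d \<in> D" for d
  proof -
    obtain s c where s: "s \<in> ?C" "d = s + c \<cdot>\<^sub>m w" using DE[OF \<open>d \<in> D\<close>] by blast
    have "s * (c \<cdot>\<^sub>m w) = (c \<cdot>\<^sub>m w) * s" using ws[OF s(1), of c] bracket_eq_zero_iff[OF cw Cc[OF s(1)]] by simp
    then show ?thesis unfolding s(2)
      using semisimple_add[OF _ Cc[OF s(1)] w(2)[of c] cw] Cartan_semisimple s(1) by blast
  qed
  have wD: "bracket d (c \<cdot>\<^sub>m w) = 0\<^sub>m n n" "s \<in> ?C \<Longrightarrow> bracket d s = 0\<^sub>m n n" if d: "d \<in> D" for d c s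
  proof -
    obtain s' c' where s: "s' \<in> ?C" "d = s' + c' \<cdot>\<^sub>m w" using DE[OF d] by blast
    have "bracket (c' \<cdot>\<^sub>m w) (c \<cdot>\<^sub>m w) = 0\<^sub>m n n"
      using bracket_smult_left[OF wc cw, of c' c] bracket_smult_right[OF wc wc, of c] bracket_eq_zero_iff[OF wc wc] by simp
    then show "bracket d (c \<cdot>\<^sub>m w) = 0\<^sub>m n n"
      unfolding s(2) bracket_add_left[OF Cc[OF s(1)] cw cw]
      using bracket_commute_zero[OF cw Cc[OF s(1)] ws[OF s(1)]] by simp
    show "bracket d s = 0\<^sub>m n n" if "s \<in> ?C"
      unfolding s(2) bracket_add_left[OF Cc[OF s(1)] cw Cc[OF that]] ws[OF that]
      using comm s(1) that by simp
  qed
  have DD: "bracket d d' = 0\<^sub>m n n" if dd: "d \<in> D" "d' \<in> D" for d d'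
  proof -
    obtain s c where s: "s \<in> ?C" "d' = s + c \<cdot>\<^sub>m w" using DE[OF dd(2)] by blast
    have dc: "d \<in> carrier_mat n n" using dd(1) DV Vc by blast
    show ?thesis unfolding s(2) bracket_add_right[OF dc Cc[OF s(1)] cw] wD(1)[OF dd(1)] wD(2)[OF dd(1) s(1)] by simp
  qed
  have "?C \<subseteq> D" using DI[of _ 0] zw by force
  moreover have "commuting_semisimple_subspace n D"
    unfolding commuting_semisimple_subspace_def subspace_iff_mat_subspace using sub ss DD by blast
  ultimately have "D = ?C" using Cartan DV unfolding Cartan_subspace_def by blast
  moreover have "0\<^sub>m n n + 1 \<cdot>\<^sub>m w \<in> D" by (rule DI[OF mat_subspaceD(2)[OF C]])
  moreover have "0\<^sub>m n n + 1 \<cdot>\<^sub>m w = w" using wc by (intro eq_matI) auto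
  ultimately show ?thesis by auto
qed

text \<open>The hypotheses are symmetric in the two packets, so one inclusion suffices. With
  \<open>g = b^{-1} a\<close>, the fact \<open>key\<close> lets \<open>k (x + e)\<close> be
  rewritten as \<open>(k g^{-1}) (g x + e')\<close> with \<open>g x\<close> in the second
  cell.\<close>

lemma packet_subset:
  assumes c: "c \<in> cells (roots n L t) t" "e \<in> centralizer_in n L c" "e \<in> V" "nilpotent_elem n e"
    and c': "c' \<in> cells (roots n L t) t" "e' \<in> centralizer_in n L c'" "e' \<in> V" "nilpotent_elem n e'"
    and y: "y \<in> c" "y \<in> V" and y': "y' \<in> c'" "y' \<in> V"
    and a: "a \<in> G0" and b: "b \<in> G0" and eq: "Ad n a (y + e) = Ad n b (y' + e')"
  shows "{Ad n a (x + e) | a x. a \<in> G0 \<and> x \<in> c \<inter> V} \<subseteq> {Ad n a (x + e') | a x. a \<in> G0 \<and> x \<in> c' \<inter> V}"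
proof -
  note Lc = mat_subspaceD(1)[OF L] and Vc = mat_subspaceD(1)[OF V] and tc = mat_subspaceD(1)[OF t]
  have yt: "y \<in> t" and yt': "y' \<in> t" using cell_iff[OF c(1) y(1), of y] cell_iff[OF c'(1) y'(1), of y'] y y' by auto
  note yc = tc[OF yt] and yc' = tc[OF yt'] and ec = Vc[OF c(3)] and ec' = Vc[OF c'(3)]
  define g where "g = GL_inv n b * a"
  note aG = subgroup_GL(1)[OF G0 a] and bG = subgroup_GL(1)[OF G0 b]
  have g: "g \<in> G0" unfolding g_def using subgroup_GL(3,4)[OF G0] a b by blast
  note gG = subgroup_GL(1)[OF G0 g] and hG = GL_inv(1)[OF subgroup_GL(1)[OF G0 g]] and h = subgroup_GL(4)[OF G0 g]
  have geq: "Ad n g (y + e) = y' + e'"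
    unfolding g_def Ad_comp[OF GL_inv(1)[OF bG] aG add_carrier_mat[OF ec]] eq
    using Ad_inverse(1)[OF bG add_carrier_mat[OF ec']] .
  have ye: "y * e = e * y" if "y \<in> c" "e \<in> centralizer_in n L c" "y \<in> carrier_mat n n" "e \<in> carrier_mat n n" for y e c
    using bracket_eq_zero_iff[OF that(4,3)] that(1,2) unfolding centralizer_in_def by auto
  have gy: "Ad n g y = y'" and ge: "Ad n g e = e'"
  proof -
    note A = semisimple_Ad[OF gG Cartan_semisimple[OF yt y(2)] yc] Ad_carrier[OF gG yc]
      Cartan_semisimple[OF yt' y'(2)] yc' nilpotent_Ad[OF gG c(4) ec] Ad_carrier[OF gG ec] c'(4) ec'
    have 1: "Ad n g y * Ad n g e = Ad n g e * Ad n g y"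
      using Ad_mult[OF gG yc ec] Ad_mult[OF gG ec yc] ye[OF y(1) c(2) yc ec] by simp
    have 2: "Ad n g y + Ad n g e = y' + e'" using geq Ad_add[OF gG yc ec] by simp
    show "Ad n g y = y'" "Ad n g e = e'"
      using jordan_unique[OF A 1 ye[OF y'(1) c'(2) yc' ec'] 2] by auto
  qed
  have key: "Ad n g x \<in> c' \<inter> V" if x: "x \<in> c" "x \<in> V" for x
  proof -
    have xt: "x \<in> t" and xy: "\<And>\<alpha>. \<alpha> \<in> roots n L t \<Longrightarrow> \<alpha> x = 0 \<longleftrightarrow> \<alpha> y = 0"
      using cell_iff[OF c(1) y(1), of x] x by auto
    note xc = tc[OF xt] and gxc = Ad_carrier[OF gG tc[OF xt]]
    have gV: "Ad n g x \<in> V" by (rule AdV[OF g x(2)])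
    have cent: "bracket x z = 0\<^sub>m n n \<longleftrightarrow> bracket y z = 0\<^sub>m n n" if "z \<in> L" for z
      using centralizer_cell[OF L t tL comm stable xt yt _ Cartan_semisimple[OF yt y(2)] that]
        centralizer_cell[OF L t tL comm stable yt xt _ Cartan_semisimple[OF xt x(2)] that] xy by blast
    have Ad0: "bracket (Ad n g u) z = 0\<^sub>m n n \<longleftrightarrow> bracket u (Ad n (GL_inv n g) z) = 0\<^sub>m n n"
      if uc: "u \<in> carrier_mat n n" and z: "z \<in> L" for u z
    proof -
      let ?z = "Ad n (GL_inv n g) z"
      have zc: "?z \<in> carrier_mat n n" using Ad_carrier[OF hG Lc[OF z]] .
      have e1: "bracket (Ad n g u) z = Ad n g (bracket u ?z)"
        unfolding Ad_bracket[OF gG uc zc] Ad_inverse(2)[OF gG Lc[OF z]] ..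
      have e2: "bracket u ?z = Ad n (GL_inv n g) (bracket (Ad n g u) z)"
        unfolding e1 Ad_inverse(1)[OF gG bracket_carrier[OF uc zc]] ..
      show ?thesis
      proof
        assume "bracket (Ad n g u) z = 0\<^sub>m n n"
        then show "bracket u ?z = 0\<^sub>m n n" unfolding e2 using Ad_zero[OF hG] by simp
      next
        assume "bracket u ?z = 0\<^sub>m n n"
        then show "bracket (Ad n g u) z = 0\<^sub>m n n" unfolding e1 using Ad_zero[OF gG] by simp
      qed
    qed
    \<comment> \<open>Conjugation by \<open>g\<close> carries centralizers in \<open>L\<close> to
      centralizers in \<open>L\<close>; those of \<open>x\<close> and \<open>y\<close> agree, so
      those of \<open>g x\<close> and \<open>g y = y'\<close> agree.\<close>
    have centg: "bracket (Ad n g x) z = 0\<^sub>m n n \<longleftrightarrow> bracket y' z = 0\<^sub>m n n" if z: "z \<in> L" for z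
      unfolding Ad0[OF xc z] cent[OF AdL[OF h z]] Ad0[OF yc z, unfolded gy] ..
    have gt: "Ad n g x \<in> t"
    proof (rule Cartan_maximal[OF gV])
      fix k
      have "k \<cdot>\<^sub>m x \<in> t" "k \<cdot>\<^sub>m x \<in> V" using mat_subspaceD(4)[OF t xt] mat_subspaceD(4)[OF V x(2)] by auto
      from semisimple_Ad[OF gG Cartan_semisimple[OF this] tc[OF this(1)]]
      show "semisimple_elem (k \<cdot>\<^sub>m Ad n g x)" unfolding Ad_smult[OF gG xc] .
    next
      fix s assume "s \<in> t" "s \<in> V"
      then show "bracket (Ad n g x) s = 0\<^sub>m n n" using centg[of s] comm[OF yt'] tL by blast
    qed
    \<comment> \<open>A root vanishes at \<open>h\<close> in \<open>t\<close> exactly when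
      \<open>h\<close> commutes with a root vector, so elements of \<open>t\<close> with equal
      centralizers in \<open>L\<close> lie in the same cell.\<close>
    have "\<alpha> (Ad n g x) = 0 \<longleftrightarrow> \<alpha> y' = 0" if "\<alpha> \<in> roots n L t" for \<alpha>
    proof -
      have "\<exists>x\<in>L. x \<noteq> 0\<^sub>m n n \<and> (\<forall>h\<in>t. bracket h x = \<alpha> h \<cdot>\<^sub>m x)"
        using that unfolding roots_def by (elim CollectE conjE)
      then obtain z where z: "z \<in> L" "z \<noteq> 0\<^sub>m n n" and zt: "\<forall>h\<in>t. bracket h z = \<alpha> h \<cdot>\<^sub>m z"
        by (elim bexE conjE)
      note z = z zt[rule_format]
      have "\<alpha> h = 0 \<longleftrightarrow> bracket h z = 0\<^sub>m n n" if "h \<in> t" for h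
      proof
        assume "\<alpha> h = 0"
        then show "bracket h z = 0\<^sub>m n n" using z(3)[OF that] Lc[OF z(1)] by (intro eq_matI) auto
      next
        assume 0: "bracket h z = 0\<^sub>m n n"
        show "\<alpha> h = 0"
        proof (rule ccontr)
          assume nz: "\<alpha> h \<noteq> 0"
          have "z = inverse (\<alpha> h) \<cdot>\<^sub>m (\<alpha> h \<cdot>\<^sub>m z)" using nz by (intro eq_matI) auto
          also have "\<dots> = 0\<^sub>m n n" unfolding z(3)[OF that, symmetric] 0 by (intro eq_matI) auto
          finally show False using z(2) by simp
        qed
      qed
      then show ?thesis using centg[OF z(1)] gt yt' by blast
    qed
    then show ?thesis using cell_iff[OF c'(1) y'(1), of "Ad n g x"] gt gV by blast
  qed
  show ?thesis
  proof
    fix w assume "w \<in> {Ad n a (x + e) | a x. a \<in> G0 \<and> x \<in> c \<inter> V}"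
    then obtain k x where k: "k \<in> G0" "x \<in> c" "x \<in> V" "w = Ad n k (x + e)" by blast
    note kG = subgroup_GL(1)[OF G0 k(1)]
    note xc = Vc[OF k(3)]
    have s: "Ad n g (x + e) = Ad n g x + e'" using Ad_add[OF gG xc ec] ge by simp
    have "w = Ad n k (Ad n (GL_inv n g) (Ad n g (x + e)))"
      unfolding k(4) Ad_inverse(1)[OF gG add_carrier_mat[OF ec]] ..
    also have "\<dots> = Ad n (k * GL_inv n g) (Ad n g x + e')"
      unfolding s Ad_comp[OF kG hG add_carrier_mat[OF ec']] ..
    finally have "w = Ad n (k * GL_inv n g) (Ad n g x + e')" .
    moreover have "k * GL_inv n g \<in> G0" using subgroup_GL(3)[OF G0 k(1) h] .
    ultimately show "w \<in> {Ad n a (x + e') | a x. a \<in> G0 \<and> x \<in> c' \<inter> V}" using key[OF k(2,3)] by blast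
  qed
qed

lemma packets_equal_or_disjoint:
  assumes P: "P \<in> packets n L V G0 t" and Q: "Q \<in> packets n L V G0 t"
  shows "P = Q \<or> P \<inter> Q = {}"
proof (cases "P \<inter> Q = {}")
  case False
  obtain c e where p: "P = {Ad n a (x + e) | a x. a \<in> G0 \<and> x \<in> c \<inter> V}"
    "c \<in> cells (roots n L t) t" "e \<in> centralizer_in n L c" "e \<in> V" "nilpotent_elem n e"
    using P unfolding packets_def by blast
  obtain c' e' where q: "Q = {Ad n a (x + e') | a x. a \<in> G0 \<and> x \<in> c' \<inter> V}"
    "c' \<in> cells (roots n L t) t" "e' \<in> centralizer_in n L c'" "e' \<in> V" "nilpotent_elem n e'"
    using Q unfolding packets_def by blast
  obtain w where w: "w \<in> P" "w \<in> Q" using False by blast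
  obtain a y where y: "a \<in> G0" "y \<in> c" "y \<in> V" "w = Ad n a (y + e)" using w(1) unfolding p(1) by blast
  obtain b y' where y': "b \<in> G0" "y' \<in> c'" "y' \<in> V" "w = Ad n b (y' + e')" using w(2) unfolding q(1) by blast
  have eq: "Ad n a (y + e) = Ad n b (y' + e')" using y(4) y'(4) by simp
  have "P \<subseteq> Q" unfolding p(1) q(1) by (rule packet_subset[OF p(2-5) q(2-5) y(2,3) y'(2,3) y(1) y'(1) eq])
  moreover have "Q \<subseteq> P" unfolding p(1) q(1)
    by (rule packet_subset[OF q(2-5) p(2-5) y'(2,3) y(2,3) y'(1) y(1) eq[symmetric]])
  ultimately show ?thesis by blast
qed simp

end

theorem corollary3p12:
  fixes n m :: nat
    and G G0 T t :: "'k :: {alg_closed_field, field_char_0} mat set"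
    and gr :: "int \<Rightarrow> 'k mat set"
  assumes "semisimple_group n G" and "simply_connected_group n G"
    and "lie_grading n m (Lie n G) gr"
    and "connected_alg_group n G0" and "G0 \<subseteq> G" and "Lie n G0 = gr 0"
    and "maximal_torus n G T" and "t = Lie n T"
    and "Cartan_subspace n (degree_one m gr) (t \<inter> degree_one m gr)"
  shows "\<forall>P \<in> packets n (Lie n G) (degree_one m gr) G0 t.
         \<forall>Q \<in> packets n (Lie n G) (degree_one m gr) G0 t. P = Q \<or> P \<inter> Q = {}"
proof (intro ballI)
  fix P Q assume PQ: "P \<in> packets n (Lie n G) (degree_one m gr) G0 t" "Q \<in> packets n (Lie n G) (degree_one m gr) G0 t"
  note V = lie_grading_degree_one[OF assms(3)]
  have G: "subgroup G (GL n)" using assms(1)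
    unfolding semisimple_group_def connected_alg_group_def alg_group_def by blast
  have G0: "subgroup G0 (GL n)" using assms(4) unfolding connected_alg_group_def alg_group_def by blast
  have T: "torus n T" "T \<subseteq> G" using assms(7) unfolding maximal_torus_def by auto
  have tL: "t \<subseteq> Lie n G" unfolding assms(8) by (rule Lie_mono[OF T(2)])
  show "P = Q \<or> P \<inter> Q = {}"
  proof (rule packets_equal_or_disjoint[OF mat_subspace_Lie V(1,2) _ tL G0 _ _ _ _ assms(9) PQ])
    show "mat_subspace n t" unfolding assms(8) by (rule mat_subspace_Lie)
    show "Ad n g x \<in> Lie n G" if "g \<in> G0" "x \<in> Lie n G" for g x
      using Ad_Lie[OF G _ that(2)] assms(5) that(1) by blast
    show "Ad n g x \<in> degree_one m gr" if "g \<in> G0" "x \<in> degree_one m gr" for g x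
    \<comment> \<open>As \<open>Lie n G0\<close> is \<open>gr 0\<close>, infinitesimal stability is
      the grading rule for degrees 0 and 1.\<close>
    proof (rule connected_Ad_stable[OF assms(4) V(1) _ that])
      show "bracket X v \<in> degree_one m gr" if "X \<in> Lie n G0" "v \<in> degree_one m gr" for X v
        using V(3) that unfolding assms(6) .
    qed
    show "bracket h k = 0\<^sub>m n n" if "h \<in> t" "k \<in> t" for h k
      using Lie_torus_commute[OF T(1)] that unfolding assms(8) .
    show "bracket h z \<in> Lie n G" if "h \<in> t" "z \<in> Lie n G" for h z
      using Lie_bracket[OF G] that tL by blast
  qed
qed

end
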